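(* Let $\gamma>-1$ be real. The following assertions hold. (i) For every integer $n\ge 0$, the family of functions $\mathcal{R}^{\gamma}_{m,n}$, $m=0,1,2,\dots$, forms an orthogonal basis of the true weighted poly-Bergman space $\mathcal{A}^{2,\gamma}_n(\mathbb{D})$. (ii) The spaces $\mathcal{A}^{2,\gamma}_n(\mathbb{D})$, $n=0,1,2,\dots$, form an orthogonal sequence of reproducing kernel Hilbert spaces in $L^{2,\gamma}(\mathbb{D})$, and we have $$L^{2,\gamma}(\mathbb{D})=\bigoplus_{n=0}^{\infty}\mathcal{A}^{2,\gamma}_n(\mathbb{D})\quad\text{and}\quad H^{2,\gamma}_n(\mathbb{D})=\bigoplus_{k=0}^{n}\mathcal{A}^{2,\gamma}_k(\mathbb{D})\quad (n\ge 0),$$ as orthogonal Hilbert space direct sums. (iii) For every integer $n\ge 0$, the reproducing kernel $K^{\gamma}_n(z,w)$ of $\mathcal{A}^{2,\gamma}_n(\mathbb{D})$ is given, for $z,w\in\mathbb{D}$, by $$K^{\gamma}_n(z,w)=\frac{\gamma+n+1}{\pi\, n!\,(\gamma+1)_n}\,(1-|z|^2)^{-\gamma}(1-|w|^2)^{-\gamma}\,\partial_z^{n}\partial_{\bar w}^{n}\left\{(1-|z|^2)^{\gamma+n}(1-|w|^2)^{\gamma+n}\,{}_2F_1\!\left(\begin{array}{c}\gamma+n+2,\ \gamma+1\\ \gamma+n+1\end{array}\bigg|\, z\bar w\right)\right\}.$$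
   Context: $\mathbb{D}=\{z\in\mathbb{C}:|z|<1\}$ is the open unit disc. For real $\gamma>-1$, $L^{2,\gamma}(\mathbb{D})=L^2(\mathbb{D},d\mu_\gamma)$ is the Hilbert space of complex-valued functions on $\mathbb{D}$ square integrable for the measure $d\mu_\gamma(z)=(1-|z|^2)^{\gamma}\,dx\,dy$, $z=x+iy$, with scalar product $\langle f,g\rangle_\gamma=\int_{\mathbb{D}}f\,\overline{g}\,d\mu_\gamma$. The Wirtinger operators are $\partial_{z}=\frac12\left(\frac{\partial}{\partial x}-i\frac{\partial}{\partial y}\right)$ and $\partial_{\bar z}=\frac12\left(\frac{\partial}{\partial x}+i\frac{\partial}{\partial y}\right)$, and similarly $\partial_{\bar w}$ in the variable $w$. The weighted poly-Bergman space is $H^{2,\gamma}_n(\mathbb{D})=\{F\in L^{2,\gamma}(\mathbb{D});\ \partial_{\bar z}^{\,n+1}F=0\}$, $n\ge 0$. In particular $H^{2,\gamma}_0(\mathbb{D})=\mathcal{A}^{2,\gamma}(\mathbb{D})$ is the weighted Bergman space of holomorphic functions on $\mathbb{D}$ belonging to $L^{2,\gamma}(\mathbb{D})$. The $n$-th true weighted poly-Bergman space is defined by $\mathcal{A}^{2,\gamma}_0(\mathbb{D})=\mathcal{A}^{2,\gamma}(\mathbb{D})$ and, for $n\ge 1$, $\mathcal{A}^{2,\gamma}_n(\mathbb{D})=H^{2,\gamma}_n(\mathbb{D})\ominus H^{2,\gamma}_{n-1}(\mathbb{D})$, i.e. the orthogonal complement of $H^{2,\gamma}_{n-1}(\mathbb{D})$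 in $H^{2,\gamma}_n(\mathbb{D})$. For nonnegative integers $m,n$ the disc polynomial is $$\mathcal{R}^{\gamma}_{m,n}(z,\bar z)=\frac{z^m\bar z^n}{|z|^{2(m\wedge n)}}\,P^{(\gamma,|m-n|)}_{m\wedge n}(2|z|^2-1),\qquad m\wedge n=\min(m,n),$$ where $P^{(\alpha,\beta)}_{k}$ is the Jacobi polynomial of degree $k$ normalized by $P^{(\alpha,\beta)}_k(1)=1$ (the prefactor is understood as the monomial $z^{m-m\wedge n}\,\bar z^{\,n-m\wedge n}$). Explicitly, $$\mathcal{R}^{\gamma}_{m,n}(z,\bar z)=m!\,n!\sum_{j=0}^{m\wedge n}\frac{(-1)^j(1-z\bar z)^j}{j!\,(\gamma+1)_j}\,\frac{z^{m-j}}{(m-j)!}\,\frac{\bar z^{\,n-j}}{(n-j)!}.$$ Here $(a)_0=1$, $(a)_k=a(a+1)\cdots(a+k-1)$ is the Pochhammer symbol, and the Gauss hypergeometric function is $${}_2F_1\!\left(\begin{array}{c}a,\ b\\ c\end{array}\bigg|\,x\right)=\sum_{j=0}^{\infty}\frac{(a)_j(b)_j}{(c)_j}\frac{x^j}{j!},\qquad |x|<1.$$ The reproducing kernel $K$ of a reproducing kernel Hilbert space $\mathcal{H}\subset L^{2,\gamma}(\mathbb{D})$ is the function on $\mathbb{D}\times\mathbb{D}$ such that $K(\cdot,w)\in\mathcal{H}$ and $f(w)=\langle f,K(\cdot,w)\rangle_\gamma$ for all $f\in\mathcal{H}$ and $w\in\mathbb{D}$. Elements of $\mathcal{A}^{2,\gamma}_n(\mathbb{D})$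 are identified with their smooth (polyanalytic) representatives. "Orthogonal basis" means a complete orthogonal system in the Hilbert space sense. *)

theory Defs
  imports "HOL-Analysis.Analysis"
begin

abbreviation unit_disc :: "complex set"
  where "unit_disc \<equiv> ball 0 1"

definition disc_measure :: "real \<Rightarrow> complex measure"
  where "disc_measure \<gamma> =
    density (lebesgue_on unit_disc) (\<lambda>z. ennreal ((1 - (cmod z)\<^sup>2) powr \<gamma>))"

text \<open>
  The elements of the spaces below are functions, not classes modulo null sets. They are total
  functions on the complex plane, but their values outside the disc are irrelevant: the measure
  lives on the disc, and all pointwise and differentiability conditions are imposed on the open
  disc only.
\<close>

definition L2_disc :: "real \<Rightarrow> (complex \<Rightarrow> complex) set"
  where "L2_disc \<gamma> = {f. f \<in> borel_measurable (disc_measure \<gamma>) \<and>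
                         integrable (disc_measure \<gamma>) (\<lambda>z. (cmod (f z))\<^sup>2)}"

definition L2_inner :: "real \<Rightarrow> (complex \<Rightarrow> complex) \<Rightarrow> (complex \<Rightarrow> complex) \<Rightarrow> complex"
  where "L2_inner \<gamma> f g = (LINT z|disc_measure \<gamma>. f z * cnj (g z))"

definition L2_norm :: "real \<Rightarrow> (complex \<Rightarrow> complex) \<Rightarrow> real"
  where "L2_norm \<gamma> f = sqrt (LINT z|disc_measure \<gamma>. (cmod (f z))\<^sup>2)"

definition L2_tendsto :: "real \<Rightarrow> (nat \<Rightarrow> complex \<Rightarrow> complex) \<Rightarrow> (complex \<Rightarrow> complex) \<Rightarrow> bool"
  where "L2_tendsto \<gamma> X f \<longleftrightarrow> (\<lambda>i. L2_norm \<gamma> (\<lambda>z. X i z - f z)) \<longlonglongrightarrow> 0"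

definition L2_Cauchy :: "real \<Rightarrow> (nat \<Rightarrow> complex \<Rightarrow> complex) \<Rightarrow> bool"
  where "L2_Cauchy \<gamma> X \<longleftrightarrow>
    (\<forall>e>0. \<exists>N. \<forall>i\<ge>N. \<forall>j\<ge>N. L2_norm \<gamma> (\<lambda>z. X i z - X j z) < e)"

definition L2_orthogonal ::
    "real \<Rightarrow> (complex \<Rightarrow> complex) set \<Rightarrow> (complex \<Rightarrow> complex) set \<Rightarrow> bool"
  where "L2_orthogonal \<gamma> U V \<longleftrightarrow> (\<forall>f\<in>U. \<forall>g\<in>V. L2_inner \<gamma> f g = 0)"

definition hilbert_subspace :: "real \<Rightarrow> (complex \<Rightarrow> complex) set \<Rightarrow> bool"
  where "hilbert_subspace \<gamma> V \<longleftrightarrow>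
    V \<subseteq> L2_disc \<gamma> \<and>
    (\<lambda>z. 0) \<in> V \<and>
    (\<forall>f\<in>V. \<forall>g\<in>V. (\<lambda>z. f z + g z) \<in> V) \<and>
    (\<forall>c. \<forall>f\<in>V. (\<lambda>z. c * f z) \<in> V) \<and>
    (\<forall>X. (\<forall>i. X i \<in> V) \<and> L2_Cauchy \<gamma> X \<longrightarrow> (\<exists>f\<in>V. L2_tendsto \<gamma> X f))"

definition hilbert_direct_sum ::
    "real \<Rightarrow> nat set \<Rightarrow> (nat \<Rightarrow> (complex \<Rightarrow> complex) set) \<Rightarrow> (complex \<Rightarrow> complex) set \<Rightarrow> bool"
  where "hilbert_direct_sum \<gamma> I V H \<longleftrightarrow>
    hilbert_subspace \<gamma> H \<and>
    (\<forall>i\<in>I. hilbert_subspace \<gamma> (V i) \<and> V i \<subseteq> H) \<and>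
    (\<forall>i\<in>I. \<forall>j\<in>I. i \<noteq> j \<longrightarrow> L2_orthogonal \<gamma> (V i) (V j)) \<and>
    (\<forall>f\<in>H. \<exists>g. (\<forall>i\<in>I. g i \<in> V i) \<and>
              L2_tendsto \<gamma> (\<lambda>N z. \<Sum>i\<in>I \<inter> {..<N}. g i z) f)"

definition orthogonal_basis ::
    "real \<Rightarrow> (complex \<Rightarrow> complex) set \<Rightarrow> (nat \<Rightarrow> complex \<Rightarrow> complex) \<Rightarrow> bool"
  where "orthogonal_basis \<gamma> H e \<longleftrightarrow>
    (\<forall>m. e m \<in> H \<and> L2_norm \<gamma> (e m) \<noteq> 0) \<and>
    (\<forall>k m. k \<noteq> m \<longrightarrow> L2_inner \<gamma> (e k) (e m) = 0) \<and>
    (\<forall>f\<in>H. \<exists>c. L2_tendsto \<gamma> (\<lambda>N z. \<Sum>m<N. c m * e m z) f)"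

definition rkhs :: "real \<Rightarrow> (complex \<Rightarrow> complex) set \<Rightarrow> bool"
  where "rkhs \<gamma> H \<longleftrightarrow>
    hilbert_subspace \<gamma> H \<and>
    (\<forall>w\<in>unit_disc. \<exists>C. \<forall>f\<in>H. cmod (f w) \<le> C * L2_norm \<gamma> f)"

definition reproducing_kernel ::
    "real \<Rightarrow> (complex \<Rightarrow> complex) set \<Rightarrow> (complex \<Rightarrow> complex \<Rightarrow> complex) \<Rightarrow> bool"
  where "reproducing_kernel \<gamma> H K \<longleftrightarrow>
    (\<forall>w\<in>unit_disc. (\<lambda>z. K z w) \<in> H \<and> (\<forall>f\<in>H. f w = L2_inner \<gamma> f (\<lambda>z. K z w)))"

definition partial_x :: "(complex \<Rightarrow> complex) \<Rightarrow> complex \<Rightarrow> complex"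
  where "partial_x f z = vector_derivative (\<lambda>t. f (z + of_real t)) (at 0)"

definition partial_y :: "(complex \<Rightarrow> complex) \<Rightarrow> complex \<Rightarrow> complex"
  where "partial_y f z = vector_derivative (\<lambda>t. f (z + \<i> * of_real t)) (at 0)"

definition wirtinger :: "(complex \<Rightarrow> complex) \<Rightarrow> complex \<Rightarrow> complex"
  where "wirtinger f z = (partial_x f z - \<i> * partial_y f z) / 2"

definition wirtinger_bar :: "(complex \<Rightarrow> complex) \<Rightarrow> complex \<Rightarrow> complex"
  where "wirtinger_bar f z = (partial_x f z + \<i> * partial_y f z) / 2"

text \<open>\<open>Ck_on k S f\<close>: continuous (real) differentiability of order \<open>k\<close> on the open set \<open>S\<close>.\<close>

primrec Ck_on :: "nat \<Rightarrow> complex set \<Rightarrow> (complex \<Rightarrow> complex) \<Rightarrow> bool"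
  where
    "Ck_on 0 S f \<longleftrightarrow> continuous_on S f"
  | "Ck_on (Suc k) S f \<longleftrightarrow>
       (\<forall>z\<in>S. f differentiable (at z)) \<and> Ck_on k S (partial_x f) \<and> Ck_on k S (partial_y f)"

definition smooth_on :: "complex set \<Rightarrow> (complex \<Rightarrow> complex) \<Rightarrow> bool"
  where "smooth_on S f \<longleftrightarrow> (\<forall>k. Ck_on k S f)"

definition bergman_space :: "real \<Rightarrow> (complex \<Rightarrow> complex) set"
  where "bergman_space \<gamma> = {F \<in> L2_disc \<gamma>. F holomorphic_on unit_disc}"

definition poly_bergman_space :: "real \<Rightarrow> nat \<Rightarrow> (complex \<Rightarrow> complex) set"
  where "poly_bergman_space \<gamma> n =
    {F \<in> L2_disc \<gamma>. smooth_on unit_disc F \<and>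
                    (\<forall>z\<in>unit_disc. (wirtinger_bar ^^ (n + 1)) F z = 0)}"

primrec true_poly_bergman_space :: "real \<Rightarrow> nat \<Rightarrow> (complex \<Rightarrow> complex) set"
  where
    "true_poly_bergman_space \<gamma> 0 = bergman_space \<gamma>"
  | "true_poly_bergman_space \<gamma> (Suc n) =
       {F \<in> poly_bergman_space \<gamma> (Suc n). \<forall>G\<in>poly_bergman_space \<gamma> n. L2_inner \<gamma> F G = 0}"

definition hyp2F1 :: "'a \<Rightarrow> 'a \<Rightarrow> 'a \<Rightarrow> 'a \<Rightarrow> 'a::real_normed_field"
  where "hyp2F1 a b c x =
    (\<Sum>j. pochhammer a j * pochhammer b j / pochhammer c j * (x ^ j / fact j))"

text \<open>
  The Jacobi polynomial of degree \<open>k\<close>, normalized to take the value 1 at 1 (the classical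
  normalization has the additional factor \<open>pochhammer (\<alpha> + 1) k / fact k\<close>). The series
  terminates, as \<open>pochhammer (- real k) j = 0\<close> for \<open>j > k\<close>.
\<close>

definition jacobi :: "real \<Rightarrow> real \<Rightarrow> nat \<Rightarrow> real \<Rightarrow> real"
  where "jacobi \<alpha> \<beta> k x =
    hyp2F1 (- real k) (real k + \<alpha> + \<beta> + 1) (\<alpha> + 1) ((1 - x) / 2)"

definition disc_poly :: "real \<Rightarrow> nat \<Rightarrow> nat \<Rightarrow> complex \<Rightarrow> complex"
  where "disc_poly \<gamma> m n z =
    z ^ (m - min m n) * cnj z ^ (n - min m n) *
    of_real (jacobi \<gamma> \<bar>real m - real n\<bar> (min m n) (2 * (cmod z)\<^sup>2 - 1))"

end

(* Polyanalytic functions are the sums of zbar^k g_k(z) with g_k holomorphic. For a power series D,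
     T_n D = (-1)^n / (gamma+1)_n (1-|z|^2)^(-gamma) d_z^n ((1-|z|^2)^(gamma+n) D)
   is polyanalytic of order n+1 and T_n z^m = R_{m,n}. Rotations and Beta integrals give the inner
   products of R_{m,n} with monomials, hence orthogonality and norms. Since 1/||R_{m,n}|| grows
   subexponentially in m, the Fourier series in (R_{m,n})_m converges on the disc and defines the
   projection disc_proj n. A polyanalytic function of order n+1 orthogonal to all R_{m,k} with k <= n
   vanishes, so the true spaces are the ranges of these projections. Stone-Weierstrass makes the
   monomials total in L2. The kernel is the series of R_{m,n}(z) cnj(R_{m,n}(w)) / ||R_{m,n}||^2,
   which T_n, applied in z and conjugated in w, produces from a hypergeometric series in z wbar. *)

theory Submission
  imports Defs "HOL-Complex_Analysis.Complex_Analysis" "HOL-Real_Asymp.Real_Asymp"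
begin

section \<open>Wirtinger derivatives and polyanalytic functions\<close>

text \<open>Members of the spaces are functions constrained only on the open disc, and an L2 limit
  is determined only up to a null set. Closedness and point evaluation therefore rest on explicit
  series: each projection is a pointwise sum, so it singles out a smooth representative, and the
  equation \<open>f = disc_proj n f\<close> on the disc replaces the orthogonal complement.

  The obstacle is that the components \<open>g k\<close> of a square integrable polyanalytic
  function need not be square integrable: for \<open>(1 - |z|^2) h(z)\<close> they are
  \<open>h\<close> and \<open>- z h\<close>. Their series can be integrated termwise only over
  smaller concentric discs, where rotation invariance survives but orthogonality to lower monomials
  does not.

  \<open>T_n\<close> acts on a whole power series, so beyond the usual differentiation of power
  series no derivative is interchanged with an infinite sum. The hypergeometric parameters come from
  the norms: with \<open>c = \<gamma> + n + 1\<close> the quotient \<open>(c + 1)_m / (c)_m\<close>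
  equals \<open>(c + m) / c\<close>, and \<open>c + m\<close> is the linear factor of
  \<open>1 / ||R_{m,n}||^2\<close>.\<close>

abbreviation "\<delta> z \<equiv> 1 - (cmod z)\<^sup>2"
abbreviation "\<D> \<equiv> unit_disc"

text \<open>Every real-linear map of the plane sends \<open>h\<close> to
  \<open>a * h + b * cnj h\<close> for unique \<open>a\<close> and \<open>b\<close>. As a relation
  this carries both Wirtinger derivatives through the calculus rules at once, and it includes
  differentiability, which values of \<open>partial_x\<close> and \<open>partial_y\<close> alone do
  not assert.\<close>

definition has_wirtinger :: "(complex \<Rightarrow> complex) \<Rightarrow> complex \<Rightarrow> complex \<Rightarrow> complex \<Rightarrow> bool"
  where "has_wirtinger f a b z \<longleftrightarrow> (f has_derivative (\<lambda>h. a * h + b * cnj h)) (at z)"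

lemma has_wirtinger_partial_x:
  assumes "has_wirtinger f a b z"
  shows "partial_x f z = a + b"
proof -
  have "((\<lambda>t. f (z + of_real t)) has_derivative (\<lambda>t. a * of_real t + b * cnj (of_real t))) (at 0)"
    by (rule has_derivative_compose[of "\<lambda>t. z + of_real t", where g=f])
      (use assms in \<open>auto simp: has_wirtinger_def intro!: derivative_eq_intros\<close>)
  then have "((\<lambda>t. f (z + of_real t)) has_vector_derivative (a + b)) (at 0)"
    unfolding has_vector_derivative_def by (simp add: scaleR_conv_of_real algebra_simps)
  then show ?thesis unfolding partial_x_def by (rule vector_derivative_at)
qed

lemma has_wirtinger_partial_y:
  assumes "has_wirtinger f a b z"
  shows "partial_y f z = \<i> * (a - b)"
proof -
  have "((\<lambda>t. f (z + \<i> * of_real t)) has_derivative (\<lambda>t. a * (\<i> * of_real t) + b * cnj (\<i> * of_real t))) (at 0)"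
    by (rule has_derivative_compose[of "\<lambda>t. z + \<i> * of_real t", where g=f])
      (use assms in \<open>auto simp: has_wirtinger_def intro!: derivative_eq_intros\<close>)
  then have "((\<lambda>t. f (z + \<i> * of_real t)) has_vector_derivative (\<i> * (a - b))) (at 0)"
    unfolding has_vector_derivative_def by (simp add: scaleR_conv_of_real algebra_simps)
  then show ?thesis unfolding partial_y_def by (rule vector_derivative_at)
qed

lemma has_wirtinger_wirtinger:
  assumes "has_wirtinger f a b z"
  shows "wirtinger f z = a" "wirtinger_bar f z = b"
  unfolding wirtinger_def wirtinger_bar_def has_wirtinger_partial_x[OF assms] has_wirtinger_partial_y[OF assms]
  by (simp_all add: mult.assoc[symmetric])

lemma has_wirtinger_differentiable: "has_wirtinger f a b z \<Longrightarrow> f differentiable (at z)"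
  unfolding has_wirtinger_def differentiable_def by blast

lemma differentiable_has_wirtinger:
  assumes "f differentiable (at z)"
  shows "has_wirtinger f (wirtinger f z) (wirtinger_bar f z) z"
proof -
  obtain D where D: "(f has_derivative D) (at z)" using assms unfolding differentiable_def by blast
  interpret bounded_linear D by (rule has_derivative_bounded_linear[OF D])
  \<comment> \<open>Solves \<open>D 1 = a + b\<close> and
    \<open>D \<i> = \<i> * (a - b)\<close>.\<close>
  define a b where "a = (D 1 - \<i> * D \<i>) / 2" and "b = (D 1 + \<i> * D \<i>) / 2"
  have "D h = a * h + b * cnj h" for h
  proof -
    have "h = Re h *\<^sub>R 1 + Im h *\<^sub>R \<i>" by (simp add: complex_eq_iff)
    then have "D h = D (Re h *\<^sub>R 1 + Im h *\<^sub>R \<i>)" by (rule arg_cong)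
    also have "\<dots> = Re h *\<^sub>R D 1 + Im h *\<^sub>R D \<i>" unfolding add scaleR ..
    also have "\<dots> = a * h + b * cnj h"
      by (simp add: a_def b_def complex_eq_iff field_simps)
    finally show ?thesis .
  qed
  then have "has_wirtinger f a b z" using D unfolding has_wirtinger_def by presburger
  then show ?thesis using has_wirtinger_wirtinger by metis
qed

lemma has_wirtinger_const: "has_wirtinger (\<lambda>z. c) 0 0 z"
  by (simp add: has_wirtinger_def)

lemma has_wirtinger_add:
  "has_wirtinger f a b z \<Longrightarrow> has_wirtinger g c d z \<Longrightarrow> has_wirtinger (\<lambda>z. f z + g z) (a + c) (b + d) z"
  unfolding has_wirtinger_def by (auto intro!: derivative_eq_intros simp: algebra_simps)

lemma has_wirtinger_diff:
  "has_wirtinger f a b z \<Longrightarrow> has_wirtinger g c d z \<Longrightarrow> has_wirtinger (\<lambda>z. f z - g z) (a - c) (b - d) z"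
  unfolding has_wirtinger_def by (auto intro!: derivative_eq_intros simp: algebra_simps)

lemma has_wirtinger_mult:
  "has_wirtinger f a b z \<Longrightarrow> has_wirtinger g c d z \<Longrightarrow>
    has_wirtinger (\<lambda>z. f z * g z) (a * g z + f z * c) (b * g z + f z * d) z"
  unfolding has_wirtinger_def by (auto intro!: derivative_eq_intros simp: algebra_simps)

lemma has_wirtinger_cmult:
  "has_wirtinger f a b z \<Longrightarrow> has_wirtinger (\<lambda>z. c * f z) (c * a) (c * b) z"
  using has_wirtinger_mult[OF has_wirtinger_const[of c]] by simp

lemma has_wirtinger_sum:
  "(\<And>i. i \<in> A \<Longrightarrow> has_wirtinger (f i) (a i) (b i) z) \<Longrightarrow>
    has_wirtinger (\<lambda>z. \<Sum>i\<in>A. f i z) (\<Sum>i\<in>A. a i) (\<Sum>i\<in>A. b i) z"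
  by (induction A rule: infinite_finite_induct) (simp_all add: has_wirtinger_const has_wirtinger_add)

lemma has_wirtinger_holomorphic:
  "(f has_field_derivative f') (at z) \<Longrightarrow> has_wirtinger f f' 0 z"
  by (simp add: has_wirtinger_def has_field_derivative_def mult_commute_abs)

lemma has_wirtinger_cnj:
  assumes "has_wirtinger f a b z"
  shows "has_wirtinger (\<lambda>z. cnj (f z)) (cnj b) (cnj a) z"
proof -
  have "((\<lambda>z. cnj (f z)) has_derivative (\<lambda>h. cnj (a * h + b * cnj h))) (at z)"
    using assms unfolding has_wirtinger_def by (rule has_derivative_cnj)
  then show ?thesis by (simp add: has_wirtinger_def add.commute)
qed

lemma has_wirtinger_cnj_power: "has_wirtinger (\<lambda>z. cnj z ^ k) 0 (of_nat k * cnj z ^ (k - 1)) z"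
proof -
  have "has_wirtinger (\<lambda>z. z ^ k) (of_nat k * z ^ (k - 1)) 0 z"
    by (rule has_wirtinger_holomorphic) (auto intro!: derivative_eq_intros)
  from has_wirtinger_cnj[OF this] show ?thesis by simp
qed

lemma has_wirtinger_transform:
  assumes "has_wirtinger f a b z" "open S" "z \<in> S" "\<And>w. w \<in> S \<Longrightarrow> f w = g w"
  shows "has_wirtinger g a b z"
  using assms unfolding has_wirtinger_def by (blast intro: has_derivative_transform_within_open)

text \<open>Formally \<open>\<delta> z = 1 - z * cnj z\<close>, so the chain rule produces the
  factors \<open>cnj z\<close> and \<open>z\<close>. The computation passes through real coordinates
  because the power is a real \<open>powr\<close>; the open disc keeps its base positive.\<close>

lemma has_wirtinger_weight:
  assumes "cmod z < 1"
  shows "has_wirtinger (\<lambda>z. of_real (\<delta> z powr s))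
    (of_real (- s * \<delta> z powr (s - 1)) * cnj z)
    (of_real (- s * \<delta> z powr (s - 1)) * z) z"
proof -
  let ?v = "s * \<delta> z powr (s - 1)"
  let ?i = "\<lambda>h. - 2 * (Re z * Re h + Im z * Im h)"
  have pos: "0 < \<delta> z" using assms by (simp add: abs_square_less_1)
  have eq: "(\<lambda>z. \<delta> z) = (\<lambda>z. 1 - ((Re z)\<^sup>2 + (Im z)\<^sup>2))" by (simp add: cmod_power2)
  have 1: "((\<lambda>z. \<delta> z) has_derivative (\<lambda>h. - 2 * (Re z * Re h + Im z * Im h))) (at z)"
    unfolding eq by (auto intro!: derivative_eq_intros simp: algebra_simps)
  have "((\<lambda>x. x powr s) has_field_derivative s * \<delta> z powr (s - 1)) (at (\<delta> z))"
    using pos by (rule has_real_derivative_powr)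
  then have "((\<lambda>z. \<delta> z powr s) has_derivative
      (\<lambda>h. s * \<delta> z powr (s - 1) * ?i h)) (at z)"
    unfolding has_field_derivative_def by (rule has_derivative_compose[OF 1])
  then have "((\<lambda>z. complex_of_real (\<delta> z powr s)) has_derivative
      (\<lambda>h. of_real (?v * ?i h))) (at z)"
    by (rule has_derivative_of_real)
  moreover have "of_real (?v * ?i h) =
      of_real (- s * \<delta> z powr (s - 1)) * cnj z * h +
      of_real (- s * \<delta> z powr (s - 1)) * z * cnj h" for h
    by (simp add: complex_eq_iff algebra_simps)
  ultimately show ?thesis unfolding has_wirtinger_def by (simp only:)
qed

text \<open>A partial derivative sees only values on a short segment through \<open>z\<close>. This
  is what permits rewriting functions known only on the disc inside iterated derivatives.\<close>

lemma partial_cong: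
  assumes "open S" "z \<in> S" "\<And>w. w \<in> S \<Longrightarrow> f w = g w"
  shows "partial_x f z = partial_x g z" "partial_y f z = partial_y g z"
proof -
  have "open ((\<lambda>t::real. z + of_real t) -` S)" "open ((\<lambda>t::real. z + \<i> * of_real t) -` S)"
    by (intro open_vimage assms continuous_intros)+
  then have "\<forall>\<^sub>F t in nhds (0::real). z + of_real t \<in> S" "\<forall>\<^sub>F t in nhds (0::real). z + \<i> * of_real t \<in> S"
    using eventually_nhds_in_open[of "(\<lambda>t. z + of_real t) -` S" "0::real"]
      eventually_nhds_in_open[of "(\<lambda>t. z + \<i> * of_real t) -` S" "0::real"] assms(2) by auto
  then have "\<forall>\<^sub>F t in nhds (0::real). f (z + of_real t) = g (z + of_real t)"
    and "\<forall>\<^sub>F t in nhds (0::real). f (z + \<i> * of_real t) = g (z + \<i> * of_real t)"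
    by - (erule eventually_mono, erule assms(3))+
  then show "partial_x f z = partial_x g z" "partial_y f z = partial_y g z"
    unfolding partial_x_def partial_y_def by (auto intro!: vector_derivative_cong_eq)
qed

lemma wirtinger_cong:
  assumes "open S" "z \<in> S" "\<And>w. w \<in> S \<Longrightarrow> f w = g w"
  shows "wirtinger f z = wirtinger g z" "wirtinger_bar f z = wirtinger_bar g z"
  unfolding wirtinger_def wirtinger_bar_def using partial_cong[OF assms] by simp_all

lemma funpow_wirtinger_cong:
  assumes "open S" "\<And>w. w \<in> S \<Longrightarrow> f w = g w" "z \<in> S"
  shows "(wirtinger ^^ n) f z = (wirtinger ^^ n) g z"
  using assms(3)
  by (induction n arbitrary: z) (auto simp: assms(2) intro: wirtinger_cong[OF assms(1)])

lemma funpow_wirtinger_bar_cong: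
  assumes "open S" "\<And>w. w \<in> S \<Longrightarrow> f w = g w" "z \<in> S"
  shows "(wirtinger_bar ^^ n) f z = (wirtinger_bar ^^ n) g z"
  using assms(3)
  by (induction n arbitrary: z) (auto simp: assms(2) intro: wirtinger_cong[OF assms(1)])

lemma Ck_on_cong:
  assumes "open S" "\<And>w. w \<in> S \<Longrightarrow> f w = g w" "Ck_on k S f"
  shows "Ck_on k S g"
  using assms(2,3)
proof (induction k arbitrary: f g)
  case 0
  then show ?case by (metis Ck_on.simps(1) continuous_on_cong)
next
  case (Suc k)
  have "g differentiable (at z)" if "z \<in> S" for z
  proof -
    have "has_wirtinger f (wirtinger f z) (wirtinger_bar f z) z"
      using Suc.prems(2) that by (intro differentiable_has_wirtinger) simp
    then have "has_wirtinger g (wirtinger f z) (wirtinger_bar f z) z"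
      by (rule has_wirtinger_transform[OF _ assms(1) that Suc.prems(1)])
    then show ?thesis by (rule has_wirtinger_differentiable)
  qed
  moreover have "Ck_on k S (partial_x g)" "Ck_on k S (partial_y g)"
    using Suc.prems partial_cong[OF assms(1) _ Suc.prems(1)]
    by (auto intro: Suc.IH[of "partial_x f"] Suc.IH[of "partial_y f"])
  ultimately show ?case by simp
qed

lemma Ck_on_lincomb:
  assumes "open S" "Ck_on k S f" "Ck_on k S g"
  shows "Ck_on k S (\<lambda>z. c * f z + d * g z)"
  using assms(2,3)
proof (induction k arbitrary: f g)
  case 0
  then show ?case by (auto intro!: continuous_intros)
next
  case (Suc k)
  have *: "has_wirtinger (\<lambda>z. c * f z + d * g z) (c * wirtinger f z + d * wirtinger g z)
      (c * wirtinger_bar f z + d * wirtinger_bar g z) z" if "z \<in> S" for z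
    using Suc.prems that
    by (intro has_wirtinger_add has_wirtinger_cmult differentiable_has_wirtinger) auto
  have p: "partial_x h z = wirtinger h z + wirtinger_bar h z" "partial_y h z = \<i> * (wirtinger h z - wirtinger_bar h z)" for h z
    unfolding wirtinger_def wirtinger_bar_def by (simp_all add: complex_eq_iff field_simps)
  have "Ck_on k S (\<lambda>z. c * partial_x f z + d * partial_x g z)" "Ck_on k S (\<lambda>z. c * partial_y f z + d * partial_y g z)"
    using Suc by auto
  then have "Ck_on k S (partial_x (\<lambda>z. c * f z + d * g z))" "Ck_on k S (partial_y (\<lambda>z. c * f z + d * g z))"
    by - (erule Ck_on_cong[OF assms(1), rotated],
        simp add: has_wirtinger_partial_x[OF *] has_wirtinger_partial_y[OF *] p[of f] p[of g] algebra_simps)+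
  then show ?case by (simp add: has_wirtinger_differentiable[OF *])
qed

text \<open>For \<open>N = 0\<close> only the zero function on the disc.\<close>

definition polyanalytic :: "nat \<Rightarrow> (complex \<Rightarrow> complex) \<Rightarrow> bool"
  where "polyanalytic N F \<longleftrightarrow> (\<exists>g. (\<forall>k<N. g k holomorphic_on \<D>) \<and>
    (\<forall>z\<in>\<D>. F z = (\<Sum>k<N. cnj z ^ k * g k z)))"

text \<open>Differentiation in \<open>z\<close> acts on the holomorphic components and keeps the
  order; the conjugate derivative acts on the powers of \<open>cnj z\<close> and shifts the
  components down by one. For \<open>N = 0\<close> the truncated \<open>N - 1\<close> stays at the
  class of functions vanishing on the disc.\<close>

lemma polyanalytic_wirtinger:
  assumes "polyanalytic N F"
  shows "\<exists>A B. (\<forall>z\<in>\<D>. has_wirtinger F (A z) (B z) z) \<and>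
    polyanalytic N A \<and> polyanalytic (N - 1) B"
proof -
  obtain g where g: "\<And>k. k < N \<Longrightarrow> g k holomorphic_on \<D>"
    and F: "\<And>z. z \<in> \<D> \<Longrightarrow> F z = (\<Sum>k<N. cnj z ^ k * g k z)"
    using assms unfolding polyanalytic_def by blast
  define A where "A z = (\<Sum>k<N. cnj z ^ k * deriv (g k) z)" for z
  define B where "B z = (\<Sum>k<N. of_nat k * cnj z ^ (k - 1) * g k z)" for z
  have "has_wirtinger F (A z) (B z) z" if z: "z \<in> \<D>" for z
  proof (rule has_wirtinger_transform[OF _ open_ball z])
    have "has_wirtinger (\<lambda>z. cnj z ^ k * g k z) (0 * g k z + cnj z ^ k * deriv (g k) z)
        (of_nat k * cnj z ^ (k - 1) * g k z + cnj z ^ k * 0) z" if "k < N" for k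
      by (intro has_wirtinger_mult has_wirtinger_cnj_power has_wirtinger_holomorphic
          holomorphic_derivI[OF g[OF that] open_ball z])
    then show "has_wirtinger (\<lambda>z. \<Sum>k<N. cnj z ^ k * g k z) (A z) (B z) z"
      unfolding A_def B_def by (intro has_wirtinger_sum) auto
  qed (simp add: F)
  moreover have "polyanalytic N A"
    unfolding polyanalytic_def A_def using g by (auto intro!: exI[of _ "\<lambda>k. deriv (g k)"] holomorphic_deriv)
  moreover have "polyanalytic (N - 1) B"
    unfolding polyanalytic_def
  proof (intro exI[of _ "\<lambda>k z. of_nat (Suc k) * g (Suc k) z"] conjI allI impI ballI)
    show "(\<lambda>z. of_nat (Suc k) * g (Suc k) z) holomorphic_on \<D>" if "k < N - 1" for k
      using that by (intro holomorphic_intros g) auto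
    show "B z = (\<Sum>k<N - 1. cnj z ^ k * (of_nat (Suc k) * g (Suc k) z))" for z
      unfolding B_def by (cases N) (simp_all add: sum.lessThan_Suc_shift mult_ac del: sum.lessThan_Suc)
  qed
  ultimately show ?thesis by blast
qed

lemma polyanalytic_lincomb:
  assumes "polyanalytic N F" "polyanalytic N G"
  shows "polyanalytic N (\<lambda>z. c * F z + d * G z)"
proof -
  obtain f g where "\<And>k. k < N \<Longrightarrow> f k holomorphic_on \<D>" "\<And>k. k < N \<Longrightarrow> g k holomorphic_on \<D>"
    "\<And>z. z \<in> \<D> \<Longrightarrow> F z = (\<Sum>k<N. cnj z ^ k * f k z)"
    "\<And>z. z \<in> \<D> \<Longrightarrow> G z = (\<Sum>k<N. cnj z ^ k * g k z)"
    using assms unfolding polyanalytic_def by blast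
  then show ?thesis
    unfolding polyanalytic_def
    by (intro exI[of _ "\<lambda>k z. c * f k z + d * g k z"])
      (auto intro!: holomorphic_intros simp: sum_distrib_left sum.distrib algebra_simps)
qed

lemma polyanalytic_cong:
  "(\<And>z. z \<in> \<D> \<Longrightarrow> F z = G z) \<Longrightarrow> polyanalytic N F \<longleftrightarrow> polyanalytic N G"
  unfolding polyanalytic_def by auto

lemma polyanalytic_mono:
  assumes "polyanalytic N F" "N \<le> M"
  shows "polyanalytic M F"
proof -
  obtain g where g: "\<forall>k<N. g k holomorphic_on \<D>" "\<forall>z\<in>\<D>. F z = (\<Sum>k<N. cnj z ^ k * g k z)"
    using assms(1) unfolding polyanalytic_def by blast
  show ?thesis
    unfolding polyanalytic_def
    by (rule exI[of _ "\<lambda>k. if k < N then g k else (\<lambda>z. 0)"])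
      (use g assms(2) in \<open>auto intro!: sum.mono_neutral_cong_left split: if_splits\<close>)
qed

text \<open>The class of a fixed order is closed under both partial derivatives, being
  \<open>A + B\<close> and \<open>\<i> * (A - B)\<close>, so induction on the differentiability
  order needs no bookkeeping of \<open>N\<close>.\<close>

lemma polyanalytic_smooth:
  assumes "polyanalytic N F"
  shows "smooth_on \<D> F"
proof -
  have "Ck_on k \<D> F" for k
    using assms
  proof (induction k arbitrary: F)
    case 0
    then obtain A B where AB: "\<And>z. z \<in> \<D> \<Longrightarrow> has_wirtinger F (A z) (B z) z"
      using polyanalytic_wirtinger by blast
    from AB(1) have "\<And>z. z \<in> \<D> \<Longrightarrow> isCont F z"
      using differentiable_imp_continuous_within has_wirtinger_differentiable by blast
    then show ?case by (simp add: continuous_at_imp_continuous_on)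
  next
    case (Suc k)
    obtain A B where AB: "\<And>z. z \<in> \<D> \<Longrightarrow> has_wirtinger F (A z) (B z) z"
      "polyanalytic N A" "polyanalytic (N - 1) B"
      using polyanalytic_wirtinger[OF Suc.prems] by blast
    have "polyanalytic N B" by (rule polyanalytic_mono[OF AB(3)]) simp
    then have "polyanalytic N (\<lambda>z. 1 * A z + 1 * B z)" "polyanalytic N (\<lambda>z. \<i> * A z + (- \<i>) * B z)"
      using AB by (intro polyanalytic_lincomb; simp)+
    then have "Ck_on k \<D> (\<lambda>z. 1 * A z + 1 * B z)" "Ck_on k \<D> (\<lambda>z. \<i> * A z + (- \<i>) * B z)"
      by (blast intro: Suc.IH)+
    then have "Ck_on k \<D> (partial_x F)" "Ck_on k \<D> (partial_y F)"
      by - (erule Ck_on_cong[OF open_ball, rotated],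
        simp add: has_wirtinger_partial_x[OF AB(1)] has_wirtinger_partial_y[OF AB(1)] algebra_simps)+
    then show ?case by (simp add: has_wirtinger_differentiable[OF AB(1)])
  qed
  then show ?thesis by (simp add: smooth_on_def)
qed

lemma polyanalytic_imp_wirtinger_bar_eq_0:
  "polyanalytic N F \<Longrightarrow> z \<in> \<D> \<Longrightarrow> (wirtinger_bar ^^ N) F z = 0"
proof (induction N arbitrary: F)
  case 0
  then show ?case by (auto simp: polyanalytic_def)
next
  case (Suc N)
  obtain A B where AB: "\<And>z. z \<in> \<D> \<Longrightarrow> has_wirtinger F (A z) (B z) z" "polyanalytic N B"
    using polyanalytic_wirtinger[OF Suc.prems(1)] unfolding diff_Suc_1 by blast
  have "(wirtinger_bar ^^ Suc N) F z = (wirtinger_bar ^^ N) (wirtinger_bar F) z"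
    by (simp add: funpow_swap1)
  also have "\<dots> = (wirtinger_bar ^^ N) B z"
    by (rule funpow_wirtinger_bar_cong[OF open_ball _ Suc.prems(2)]) (simp add: has_wirtinger_wirtinger[OF AB(1)])
  also have "\<dots> = 0" using AB(2) Suc.prems(2) by (rule Suc.IH)
  finally show ?case .
qed

text \<open>By induction the conjugate derivative of \<open>F\<close> is a polynomial in
  \<open>cnj z\<close> with holomorphic coefficients. Such a polynomial has an explicit
  antiderivative in \<open>cnj z\<close>, and subtracting it from \<open>F\<close> leaves a solution
  of the Cauchy-Riemann equations. Smoothness is what passes from \<open>F\<close> to
  \<open>wirtinger_bar F\<close>.\<close>

lemma wirtinger_bar_eq_0_imp_polyanalytic:
  assumes "smooth_on \<D> F" "\<And>z. z \<in> \<D> \<Longrightarrow> (wirtinger_bar ^^ N) F z = 0"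
  shows "polyanalytic N F"
  using assms
proof (induction N arbitrary: F)
  case 0
  then show ?case by (simp add: polyanalytic_def)
next
  case (Suc N)
  have Ck: "Ck_on (Suc k) \<D> F" for k using Suc.prems(1) by (simp add: smooth_on_def del: Ck_on.simps)
  have diff: "F differentiable (at z)" if "z \<in> \<D>" for z using Ck[of 0] that by simp
  have "Ck_on k \<D> (wirtinger_bar F)" for k
  proof -
    have "Ck_on k \<D> (\<lambda>z. 1 / 2 * partial_x F z + \<i> / 2 * partial_y F z)"
      using Ck[of k] by (intro Ck_on_lincomb) auto
    then show ?thesis by (rule Ck_on_cong[OF open_ball, rotated]) (simp add: wirtinger_bar_def field_simps)
  qed
  then have "smooth_on \<D> (wirtinger_bar F)" by (simp add: smooth_on_def)
  moreover have "(wirtinger_bar ^^ N) (wirtinger_bar F) z = 0" if "z \<in> \<D>" for z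
    using Suc.prems(2)[OF that] by (simp add: funpow_swap1)
  ultimately have "polyanalytic N (wirtinger_bar F)" by (rule Suc.IH)
  then obtain g where g: "\<And>k. k < N \<Longrightarrow> g k holomorphic_on \<D>"
    and bar: "\<And>z. z \<in> \<D> \<Longrightarrow> wirtinger_bar F z = (\<Sum>k<N. cnj z ^ k * g k z)"
    unfolding polyanalytic_def by blast
  let ?q = "\<lambda>k z. g k z / of_nat (Suc k)" and ?q' = "\<lambda>k z. deriv (g k) z / of_nat (Suc k)"
  \<comment> \<open>Termwise antiderivative in \<open>cnj z\<close>: each \<open>cnj z ^ k\<close>
    becomes \<open>cnj z ^ Suc k / Suc k\<close>.\<close>
  define G where "G z = (\<Sum>k<N. cnj z ^ Suc k * ?q k z)" for z
  define H where "H z = F z - G z" for z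
  have "H field_differentiable (at z)" if z: "z \<in> \<D>" for z
  proof -
    have "has_wirtinger (\<lambda>z. cnj z ^ Suc k * ?q k z)
        (0 * ?q k z + cnj z ^ Suc k * ?q' k z)
        (of_nat (Suc k) * cnj z ^ (Suc k - 1) * ?q k z + cnj z ^ Suc k * 0) z" if "k < N" for k
      by (intro has_wirtinger_mult has_wirtinger_cnj_power has_wirtinger_holomorphic DERIV_cdivide
          holomorphic_derivI[OF g[OF that] open_ball z])
    then have "has_wirtinger G
        (\<Sum>k<N. 0 * ?q k z + cnj z ^ Suc k * ?q' k z)
        (\<Sum>k<N. of_nat (Suc k) * cnj z ^ (Suc k - 1) * ?q k z + cnj z ^ Suc k * 0) z"
      unfolding G_def by (intro has_wirtinger_sum) auto
    from has_wirtinger_diff[OF differentiable_has_wirtinger[OF diff[OF z]] this]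
    have "has_wirtinger H (wirtinger F z - (\<Sum>k<N. 0 * ?q k z + cnj z ^ Suc k * ?q' k z)) 0 z"
      unfolding H_def bar[OF z] by (simp add: mult_ac del: of_nat_Suc)
    then show ?thesis
      unfolding field_differentiable_def has_field_derivative_def has_wirtinger_def by auto
  qed
  then have H: "H holomorphic_on \<D>"
    by (simp add: holomorphic_on_def field_differentiable_at_within)
  show ?case
    unfolding polyanalytic_def
  proof (intro exI[of _ "case_nat H ?q"] conjI allI impI ballI)
    show "case_nat H ?q k holomorphic_on \<D>" if "k < Suc N" for k
      using that H g by (cases k) (auto intro!: holomorphic_intros simp del: of_nat_Suc)
    show "F z = (\<Sum>k<Suc N. cnj z ^ k * case_nat H ?q k z)" for z
      by (subst sum.lessThan_Suc_shift) (simp add: H_def G_def)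
  qed
qed

lemma polyanalytic_1: "polyanalytic (Suc 0) F \<longleftrightarrow> F holomorphic_on \<D>"
  unfolding polyanalytic_def
  by (auto intro!: exI[of _ "\<lambda>k. F"]) (metis holomorphic_cong)

section \<open>Power series on the disc, their derivatives and weighted versions\<close>

lemma summable_diffs_disc:
  fixes c :: "nat \<Rightarrow> complex"
  assumes "\<And>z. cmod z < 1 \<Longrightarrow> summable (\<lambda>n. c n * z ^ n)" "cmod z < 1"
  shows "summable (\<lambda>n. (diffs ^^ j) c n * z ^ n)"
  using assms(2)
  by (induction j arbitrary: z) (auto intro: assms(1) termdiff_converges[of _ 1])

lemma has_field_derivative_diffs_disc:
  fixes c :: "nat \<Rightarrow> complex"
  assumes "\<And>z. cmod z < 1 \<Longrightarrow> summable (\<lambda>n. c n * z ^ n)" "cmod z < 1"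
  shows "((\<lambda>z. \<Sum>n. (diffs ^^ j) c n * z ^ n) has_field_derivative
    (\<Sum>n. (diffs ^^ Suc j) c n * z ^ n)) (at z)"
  unfolding funpow.simps o_def
  by (rule termdiffs_strong'[where K=1]) (use summable_diffs_disc[OF assms(1)] assms(2) in auto)

lemma funpow_diffs:
  fixes c :: "nat \<Rightarrow> complex"
  shows "(diffs ^^ j) c p = of_nat (fact j * ((p + j) choose j)) * c (p + j)"
proof (induction j arbitrary: p)
  case (Suc j)
  have "Suc p * (fact j * ((Suc p + j) choose j)) = fact (Suc j) * ((p + Suc j) choose Suc j)"
  proof -
    have "Suc j * ((p + Suc j) choose Suc j) = Suc p * ((p + Suc j) choose j)"
      using binomial_absorb_comp[of "p + Suc j" j] binomial_absorption[of j "p + Suc j"] by simp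
    moreover have "Suc p + j = p + Suc j" by simp
    ultimately have "Suc p * (fact j * ((Suc p + j) choose j)) = fact j * (Suc j * ((p + Suc j) choose Suc j))"
      by (simp only: mult.left_commute[of "Suc p"])
    then show ?thesis by (simp only: fact_Suc of_nat_id mult_ac)
  qed
  then have "(of_nat (Suc p) :: complex) * of_nat (fact j * ((Suc p + j) choose j)) = of_nat (fact (Suc j) * ((p + Suc j) choose Suc j))"
    by (simp only: of_nat_mult[symmetric])
  moreover have "(diffs ^^ Suc j) c p = of_nat (Suc p) * (diffs ^^ j) c (Suc p)"
    by (simp only: funpow.simps o_def diffs_def[of "(diffs ^^ j) c"])
  moreover have "Suc p + j = p + Suc j" by simp
  ultimately show ?case
    by (simp only: Suc.IH mult.assoc[symmetric])
qed simp

text \<open>The derivative series is reindexed by the original exponent \<open>m\<close>; terms with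
  \<open>m < j\<close> vanish through the binomial coefficient, so the truncated
  \<open>m - j\<close> is harmless. In this form all \<open>j\<close> can be summed over a common
  index, matching the terms of \<open>disc_poly\<close>.\<close>

lemma sums_funpow_diffs:
  fixes c :: "nat \<Rightarrow> complex"
  assumes "\<And>z. cmod z < 1 \<Longrightarrow> summable (\<lambda>n. c n * z ^ n)" "cmod z < 1"
  shows "(\<lambda>m. c m * of_nat (fact j * (m choose j)) * z ^ (m - j)) sums (\<Sum>n. (diffs ^^ j) c n * z ^ n)"
proof -
  define S where "S = (\<Sum>n. (diffs ^^ j) c n * z ^ n)"
  have "(\<lambda>n. (diffs ^^ j) c n * z ^ n) sums S"
    unfolding S_def using summable_diffs_disc[OF assms] by (rule summable_sums)
  also have "(\<lambda>n. (diffs ^^ j) c n * z ^ n) = (\<lambda>n. c (n + j) * of_nat (fact j * ((n + j) choose j)) * z ^ (n + j - j))"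
    by (simp add: funpow_diffs mult_ac)
  finally have "(\<lambda>m. c m * of_nat (fact j * (m choose j)) * z ^ (m - j)) sums S"
    by (rule sums_zero_iff_shift[THEN iffD1, rotated]) simp
  then show ?thesis by (simp only: S_def)
qed

lemma polyanalytic_mult_holomorphic:
  assumes "polyanalytic N F" "h holomorphic_on \<D>"
  shows "polyanalytic N (\<lambda>z. h z * F z)"
proof -
  obtain f where "\<And>k. k < N \<Longrightarrow> f k holomorphic_on \<D>"
    "\<And>z. z \<in> \<D> \<Longrightarrow> F z = (\<Sum>k<N. cnj z ^ k * f k z)"
    using assms(1) unfolding polyanalytic_def by blast
  then show ?thesis
    unfolding polyanalytic_def
    by (intro exI[of _ "\<lambda>k z. h z * f k z"])
      (auto intro!: holomorphic_intros assms(2) simp: sum_distrib_left mult_ac)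
qed

lemma polyanalytic_mult_cnj:
  assumes "polyanalytic N F"
  shows "polyanalytic (Suc N) (\<lambda>z. cnj z * F z)"
proof -
  obtain f where "\<And>k. k < N \<Longrightarrow> f k holomorphic_on \<D>"
    "\<And>z. z \<in> \<D> \<Longrightarrow> F z = (\<Sum>k<N. cnj z ^ k * f k z)"
    using assms(1) unfolding polyanalytic_def by blast
  then show ?thesis
    unfolding polyanalytic_def
    by (intro exI[of _ "case_nat (\<lambda>z. 0) f"])
      (auto simp: sum_distrib_left mult_ac sum.lessThan_Suc_shift less_Suc_eq_0_disj simp del: sum.lessThan_Suc)
qed

lemma polyanalytic_add: "polyanalytic N F \<Longrightarrow> polyanalytic N G \<Longrightarrow> polyanalytic N (\<lambda>z. F z + G z)"
  using polyanalytic_lincomb[of N F G 1 1] by simp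

lemma polyanalytic_diff: "polyanalytic N F \<Longrightarrow> polyanalytic N G \<Longrightarrow> polyanalytic N (\<lambda>z. F z - G z)"
  using polyanalytic_lincomb[of N F G 1 "-1"] by simp

lemma polyanalytic_cmult: "polyanalytic N F \<Longrightarrow> polyanalytic N (\<lambda>z. c * F z)"
  using polyanalytic_lincomb[of N F F c 0] by simp

lemma polyanalytic_zero: "polyanalytic N (\<lambda>z. 0)"
  unfolding polyanalytic_def by (intro exI[of _ "\<lambda>k z. 0"]) auto

lemma polyanalytic_sum:
  "(\<And>i. i \<in> A \<Longrightarrow> polyanalytic N (F i)) \<Longrightarrow> polyanalytic N (\<lambda>z. \<Sum>i\<in>A. F i z)"
  by (induction A rule: infinite_finite_induct) (auto intro: polyanalytic_zero polyanalytic_add)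

text \<open>Each factor \<open>\<delta> z = 1 - z * cnj z\<close> raises the order by at most
  one.\<close>

lemma polyanalytic_weight_term:
  assumes "G holomorphic_on \<D>"
  shows "polyanalytic (Suc (i + j)) (\<lambda>z. of_real (\<delta> z ^ j) * cnj z ^ i * G z)"
proof (induction j)
  case 0
  have "polyanalytic (Suc i) (\<lambda>z. cnj z ^ i * G z)"
  proof (induction i)
    case 0
    then show ?case using assms by (simp add: polyanalytic_1)
  next
    case (Suc i)
    then show ?case using polyanalytic_mult_cnj[OF Suc] by (simp add: mult.assoc)
  qed
  then show ?case by simp
next
  case (Suc j)
  let ?H = "\<lambda>z. of_real (\<delta> z ^ j) * cnj z ^ i * G z"
  have "polyanalytic (Suc (Suc (i + j))) (\<lambda>z. ?H z - cnj z * (z * ?H z))"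
    by (intro polyanalytic_diff polyanalytic_mult_cnj polyanalytic_mult_holomorphic polyanalytic_mono[OF Suc])
      (auto intro!: holomorphic_intros)
  moreover have "?H z - cnj z * (z * ?H z) = of_real (\<delta> z ^ Suc j) * cnj z ^ i * G z" for z
  proof -
    have "of_real (\<delta> z ^ Suc j) = (1 - z * cnj z) * of_real (\<delta> z ^ j)"
      by (simp only: power_Suc of_real_mult of_real_diff complex_norm_square of_real_1)
    then show ?thesis by (simp only:) (simp add: algebra_simps)
  qed
  ultimately show ?case by simp
qed

text \<open>Contribution to the Leibniz formula in which \<open>i\<close> derivatives fall on the
  weight and \<open>j\<close> on the series. \<open>pochhammer (- s) i\<close> is
  \<open>(-1)^i s (s - 1) ... (s - i + 1)\<close>, the constant from differentiating the power of
  \<open>\<delta> z\<close>.\<close>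

definition weighted_term :: "real \<Rightarrow> (nat \<Rightarrow> complex) \<Rightarrow> nat \<Rightarrow> nat \<Rightarrow> complex \<Rightarrow> complex"
  where "weighted_term s c i j z = of_real (pochhammer (- s) i * \<delta> z powr (s - real i)) *
      cnj z ^ i * (\<Sum>n. (diffs ^^ j) c n * z ^ n)"

text \<open>Since \<open>cnj z ^ i\<close> is constant for the \<open>z\<close>-derivative, exactly
  two terms of the same shape arise. The conjugate derivative only has to exist, so it stays
  anonymous.\<close>

lemma has_wirtinger_weighted_term:
  assumes c: "\<And>z. cmod z < 1 \<Longrightarrow> summable (\<lambda>n. c n * z ^ n)" and z: "cmod z < 1"
  shows "\<exists>b. has_wirtinger (weighted_term s c i j)
    (weighted_term s c i (Suc j) z + weighted_term s c (Suc i) j z) b z"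
proof -
  let ?p = "of_real (pochhammer (- s) i) :: complex"
  let ?D = "\<lambda>j z. \<Sum>n. (diffs ^^ j) c n * z ^ n" and ?w = "\<lambda>z. of_real (\<delta> z powr (s - real i)) :: complex"
  let ?a = "of_real (- (s - real i) * \<delta> z powr (s - real i - 1)) * cnj z"
  let ?b = "of_real (- (s - real i) * \<delta> z powr (s - real i - 1)) * z"
  have "has_wirtinger (\<lambda>z. ?p * (?w z * (cnj z ^ i * ?D j z)))
    (?p * (?a * (cnj z ^ i * ?D j z) + ?w z * (0 * ?D j z + cnj z ^ i * ?D (Suc j) z)))
    (?p * (?b * (cnj z ^ i * ?D j z) + ?w z * (of_nat i * cnj z ^ (i - 1) * ?D j z + cnj z ^ i * 0))) z"
    by (intro has_wirtinger_cmult has_wirtinger_mult has_wirtinger_weight has_wirtinger_cnj_power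
        has_wirtinger_holomorphic has_field_derivative_diffs_disc c z)
  moreover have "(\<lambda>z. ?p * (?w z * (cnj z ^ i * ?D j z))) = weighted_term s c i j"
    by (auto simp: weighted_term_def mult_ac)
  moreover have "?p * (?a * (cnj z ^ i * ?D j z) + ?w z * (0 * ?D j z + cnj z ^ i * ?D (Suc j) z)) =
      weighted_term s c i (Suc j) z + weighted_term s c (Suc i) j z"
  proof -
    have "s - real (Suc i) = s - real i - 1" by simp
    moreover have "pochhammer (- s) (Suc i) = pochhammer (- s) i * (- (s - real i))" by (simp add: pochhammer_Suc)
    ultimately show ?thesis unfolding weighted_term_def
      by (simp only: of_real_mult) (simp add: algebra_simps del: funpow.simps)
  qed
  ultimately show ?thesis by metis
qed

lemma funpow_wirtinger_weighted_series:
  fixes c :: "nat \<Rightarrow> complex" and s :: real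
  assumes c: "\<And>z. cmod z < 1 \<Longrightarrow> summable (\<lambda>n. c n * z ^ n)" and z: "cmod z < 1"
  shows "(wirtinger ^^ k) (\<lambda>z. of_real (\<delta> z powr s) * (\<Sum>n. c n * z ^ n)) z =
    (\<Sum>j\<le>k. of_nat (k choose j) * weighted_term s c (k - j) j z)"
proof -
  let ?u = "weighted_term s c"
  have "(wirtinger ^^ k) (?u 0 0) z = (\<Sum>j\<le>k. of_nat (k choose j) * ?u (k - j) j z)" if "cmod z < 1" for z
    using that
  proof (induction k arbitrary: z)
    case (Suc k)
    have "\<forall>i j. \<exists>b. has_wirtinger (?u i j) (?u i (Suc j) z + ?u (Suc i) j z) b z"
      using has_wirtinger_weighted_term[OF c Suc.prems] by blast
    then obtain b where b: "\<And>i j. has_wirtinger (?u i j) (?u i (Suc j) z + ?u (Suc i) j z) (b i j) z"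
      by metis
    have "(wirtinger ^^ Suc k) (?u 0 0) z = wirtinger (\<lambda>z. \<Sum>j\<le>k. of_nat (k choose j) * ?u (k - j) j z) z"
      using Suc by (simp, intro wirtinger_cong[OF open_ball[of 0 1]]) auto
    also have "\<dots> = (\<Sum>j\<le>k. of_nat (k choose j) * (?u (k - j) (Suc j) z + ?u (Suc (k - j)) j z))"
      by (rule has_wirtinger_wirtinger(1), rule has_wirtinger_sum, rule has_wirtinger_cmult, rule b)
    also have "\<dots> = (\<Sum>j\<le>k. of_nat (k choose j) * ?u (Suc k - Suc j) (Suc j) z) + (\<Sum>j\<le>k. of_nat (k choose j) * ?u (Suc k - j) j z)"
      by (simp add: distrib_left sum.distrib Suc_diff_le)
    \<comment> \<open>The extra summand carries \<open>k choose Suc k = 0\<close>; with it,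
      splitting off \<open>j = 0\<close> aligns both sums for Pascal's rule.\<close>
    also have "(\<Sum>j\<le>k. of_nat (k choose j) * ?u (Suc k - j) j z) = (\<Sum>j\<le>Suc k. of_nat (k choose j) * ?u (Suc k - j) j z)"
      by (simp add: binomial_eq_0)
    also have "\<dots> = ?u (Suc k) 0 z + (\<Sum>j\<le>k. of_nat (k choose Suc j) * ?u (Suc k - Suc j) (Suc j) z)"
      by (subst sum.atMost_Suc_shift) simp
    also have "(\<Sum>j\<le>k. of_nat (k choose j) * ?u (Suc k - Suc j) (Suc j) z) + \<dots> =
        ?u (Suc k) 0 z + (\<Sum>j\<le>k. of_nat (Suc k choose Suc j) * ?u (Suc k - Suc j) (Suc j) z)"
      by (simp add: sum.distrib distrib_right)
    also have "\<dots> = (\<Sum>j\<le>Suc k. of_nat (Suc k choose j) * ?u (Suc k - j) j z)"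
      by (subst sum.atMost_Suc_shift) (simp del: binomial_Suc_Suc)
    finally show ?case .
  qed simp
  from this[OF z] show ?thesis by (simp add: weighted_term_def[of s c 0 0, abs_def])
qed

text \<open>Conjugation exchanges the two coefficients of the real differential. Differentiability
  at every intermediate order ensures that each iterated \<open>wirtinger\<close> really is such a
  coefficient.\<close>

lemma funpow_wirtinger_bar_eq_cnj:
  assumes "\<And>k z. k < n \<Longrightarrow> cmod z < 1 \<Longrightarrow> (wirtinger ^^ k) f differentiable (at z)" "cmod z < 1"
  shows "(wirtinger_bar ^^ n) (\<lambda>z. cnj (f z)) z = cnj ((wirtinger ^^ n) f z)"
  using assms
proof (induction n arbitrary: z)
  case (Suc n)
  have "(wirtinger_bar ^^ Suc n) (\<lambda>z. cnj (f z)) z = wirtinger_bar (\<lambda>z. cnj ((wirtinger ^^ n) f z)) z"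
    using Suc by (simp, intro wirtinger_cong[OF open_ball[of 0 1]]) auto
  also have "\<dots> = cnj (wirtinger ((wirtinger ^^ n) f) z)"
    using Suc.prems by (intro has_wirtinger_wirtinger(2)[OF has_wirtinger_cnj[OF differentiable_has_wirtinger]]) auto
  finally show ?case by simp
qed simp

lemma funpow_wirtinger_weighted_series_differentiable:
  fixes c :: "nat \<Rightarrow> complex" and s :: real
  assumes c: "\<And>z. cmod z < 1 \<Longrightarrow> summable (\<lambda>n. c n * z ^ n)" and z: "cmod z < 1"
  shows "(wirtinger ^^ k) (\<lambda>z. of_real (\<delta> z powr s) * (\<Sum>n. c n * z ^ n)) differentiable (at z)"
proof -
  let ?a = "\<lambda>j. weighted_term s c (k - j) (Suc j) z + weighted_term s c (Suc (k - j)) j z"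
  have "\<forall>j. \<exists>b. has_wirtinger (weighted_term s c (k - j) j)
      (?a j) b z"
    using has_wirtinger_weighted_term[OF c z] by blast
  from choice[OF this] obtain b where "\<And>j. has_wirtinger (weighted_term s c (k - j) j)
      (?a j) (b j) z" by blast
  then have "has_wirtinger (\<lambda>z. \<Sum>j\<le>k. of_nat (k choose j) * weighted_term s c (k - j) j z)
      (\<Sum>j\<le>k. of_nat (k choose j) *
        (?a j)) (\<Sum>j\<le>k. of_nat (k choose j) * b j) z"
    by (intro has_wirtinger_sum has_wirtinger_cmult)
  then have "has_wirtinger ((wirtinger ^^ k) (\<lambda>z. of_real (\<delta> z powr s) * (\<Sum>n. c n * z ^ n)))
      (\<Sum>j\<le>k. of_nat (k choose j) *
        (?a j)) (\<Sum>j\<le>k. of_nat (k choose j) * b j) z"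
    by (rule has_wirtinger_transform[OF _ open_ball[of 0 1]])
      (use z in \<open>auto simp: funpow_wirtinger_weighted_series[OF c]\<close>)
  then show ?thesis by (rule has_wirtinger_differentiable)
qed

section \<open>Radial integrals over the disc\<close>

text \<open>Both measures give a box the product of its side lengths. The identification brings
  invariance under orthogonal transformations, available for \<open>real^2\<close>, to the complex
  plane.\<close>

lemma lborel_complex_eq_distr_vec2:
  "(lborel :: complex measure) =
    distr (lborel :: (real^2) measure) borel (\<lambda>v. Complex (vec_nth v 1) (vec_nth v 2))"
  (is "_ = distr _ _ ?g")
proof (rule lborel_eqI)
  have g: "?g \<in> borel_measurable borel"
    unfolding Complex_eq by measurable
  show "sets (distr lborel borel ?g) = sets borel" by simp
  fix l u :: complex
  assume le: "\<And>b. b \<in> Basis \<Longrightarrow> l \<bullet> b \<le> u \<bullet> b"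
  have le12: "Re l \<le> Re u" "Im l \<le> Im u"
    using le[of 1] le[of \<i>] by (auto simp: Basis_complex_def inner_complex_def)
  let ?l = "vector [Re l, Im l] :: real^2" and ?u = "vector [Re u, Im u] :: real^2"
  have pre: "?g -` box l u = box ?l ?u"
    by (auto simp: mem_box_cart in_box_complex_iff forall_2)
  have leB: "\<And>b. b \<in> Basis \<Longrightarrow> ?l \<bullet> b \<le> ?u \<bullet> b"
    using le12 by (auto simp: Basis_vec_def inner_axis forall_2[symmetric] exhaust_2)
      (metis (full_types) exhaust_2 vector_2(1) vector_2(2))
  have B2: "(Basis :: (real^2) set) = {axis 1 1, axis 2 1}"
    by (auto simp: Basis_vec_def axis_eq_axis) (metis (full_types) exhaust_2)
  have "emeasure (distr lborel borel ?g) (box l u) = emeasure lborel (?g -` box l u)"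
    using g by (subst emeasure_distr) auto
  also have "\<dots> = (\<Prod>b\<in>Basis. (?u - ?l) \<bullet> b)"
    unfolding pre by (rule emeasure_lborel_box[OF leB])
  also have "(\<Prod>b\<in>Basis. (?u - ?l) \<bullet> b) = (\<Prod>b\<in>Basis. (u - l) \<bullet> b)"
    by (simp add: B2 Basis_complex_def axis_eq_axis inner_axis inner_complex_def)
  finally show "emeasure (distr lborel borel ?g) (box l u) = (\<Prod>b\<in>Basis. (u - l) \<bullet> b)" .
qed

lemma lborel_complex_rotation:
  fixes u :: complex
  assumes "cmod u = 1"
  shows "lborel = distr lborel borel (\<lambda>z. u * z)"
proof (rule lborel_eqI)
  let ?g = "\<lambda>v::real^2. Complex (vec_nth v 1) (vec_nth v 2)"
  let ?h = "\<lambda>z. vector [Re z, Im z] :: real^2"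
  let ?T = "\<lambda>v. ?h (cnj u * ?g v)"
  have g: "?g \<in> borel_measurable borel"
    unfolding Complex_eq by measurable
  show "sets (distr lborel borel ((*) u)) = sets borel" by simp
  fix l r :: complex
  assume le: "\<And>b. b \<in> Basis \<Longrightarrow> l \<bullet> b \<le> r \<bullet> b"
  have hg: "?h (?g v) = v" for v by (simp add: vec_eq_iff forall_2)
  have gh: "?g (?h z) = z" for z by simp
  have uu: "u * cnj u = 1" "cnj u * u = 1"
    using assms by (simp_all add: complex_norm_square[symmetric] mult.commute)
  have uu': "u * (cnj u * z) = z" "cnj u * (u * z) = z" for z
    using uu by (simp_all add: mult.assoc[symmetric])
  have lin: "linear ?T"
    by (rule linearI) (auto simp: vec_eq_iff forall_2 algebra_simps)
  have nrm: "norm v = cmod (?g v)" for v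
    by (simp add: norm_vec_def L2_set_def UNIV_2 cmod_def)
  have orth: "orthogonal_transformation ?T"
    unfolding orthogonal_transformation
    using lin assms by (simp only: nrm gh norm_mult complex_mod_cnj) simp
  let ?B = "?g -` box l r"
  have Bbox: "?B = box (?h l) (?h r)"
    by (auto simp: mem_box_cart in_box_complex_iff forall_2)
  \<comment> \<open>Invariance is known for images, whereas a distribution measures preimages: the
    preimage under multiplication by \<open>u\<close> is the image under the inverse rotation by
    \<open>cnj u\<close>.\<close>
  have eq: "?g -` ((*) u -` box l r) = ?T ` ?B"
  proof (intro set_eqI iffI)
    fix v assume "v \<in> ?g -` ((*) u -` box l r)"
    then have "?h (u * ?g v) \<in> ?B" by (simp only: vimage_eq gh)
    moreover have "v = ?T (?h (u * ?g v))"
      by (simp only: gh uu' hg)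
    ultimately show "v \<in> ?T ` ?B" by blast
  next
    fix v assume "v \<in> ?T ` ?B"
    then obtain w where "w \<in> ?B" "v = ?T w" by blast
    then show "v \<in> ?g -` ((*) u -` box l r)" by (simp only: vimage_eq gh uu')
  qed
  have Bm: "?B \<in> lmeasurable" unfolding Bbox by simp
  have TBm: "?T ` ?B \<in> lmeasurable"
    by (rule measurable_orthogonal_image[OF orth Bm])
  have op: "open ((*) u -` box l r)"
    by (intro open_vimage continuous_intros open_box)
  then have S: "(*) u -` box l r \<in> sets borel" by (rule borel_open)
  have TBb: "?T ` ?B \<in> sets borel"
    unfolding eq[symmetric] using measurable_sets[OF g S] by simp
  have distr: "emeasure lborel X = emeasure lborel (?g -` X)" if "X \<in> sets borel" for X
    by (subst lborel_complex_eq_distr_vec2, subst emeasure_distr) (use g that in simp_all)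
  have "emeasure (distr lborel borel ((*) u)) (box l r) = emeasure lborel ((*) u -` box l r)"
    by (subst emeasure_distr) auto
  also have "\<dots> = emeasure lborel (?g -` ((*) u -` box l r))"
    by (rule distr[OF S])
  also have "\<dots> = emeasure lebesgue (?T ` ?B)"
    using TBb by (simp add: eq emeasure_completion)
  also have "\<dots> = emeasure lebesgue ?B"
    unfolding emeasure_eq_measure2[OF TBm] emeasure_eq_measure2[OF Bm]
      measure_orthogonal_image[OF orth Bm] ..
  also have "\<dots> = emeasure lborel ?B" by (simp add: Bbox)
  also have "\<dots> = emeasure (lborel :: complex measure) (box l r)"
    by (rule distr[symmetric]) simp
  also have "\<dots> = (\<Prod>b\<in>Basis. (r - l) \<bullet> b)" using le by (rule emeasure_lborel_box)
  finally show "emeasure (distr lborel borel ((*) u)) (box l r) = (\<Prod>b\<in>Basis. (r - l) \<bullet> b)" .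
qed

lemma integral_complex_rotation:
  fixes f :: "complex \<Rightarrow> complex"
  assumes "cmod u = 1" and f: "f \<in> borel_measurable borel"
  shows "integral\<^sup>L lborel (\<lambda>z. f (u * z)) = integral\<^sup>L lborel f"
proof -
  have "integral\<^sup>L lborel f = integral\<^sup>L (distr lborel borel ((*) u)) f"
    using lborel_complex_rotation[OF assms(1)] by simp
  also have "\<dots> = integral\<^sup>L lborel (\<lambda>z. f (u * z))"
    by (rule integral_distr) (use f in auto)
  finally show ?thesis ..
qed

lemma integral_radial_phase_eq_0:
  fixes f :: "complex \<Rightarrow> complex" and p q :: nat
  assumes f: "f \<in> borel_measurable borel" and "p \<noteq> q"
    and rot: "\<And>u z. cmod u = 1 \<Longrightarrow> f (u * z) = u ^ p * cnj u ^ q * f z"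
  shows "integral\<^sup>L lborel f = 0"
proof -
  let ?a = "pi / (real p - real q)"
  \<comment> \<open>The angle \<open>pi / (p - q)\<close> makes the phase
    \<open>u ^ p * cnj u ^ q\<close> equal to \<open>-1\<close>, so the integral equals its own
    negative.\<close>
  define u where "u = cis ?a"
  have u: "cmod u = 1" by (simp add: u_def)
  have "u ^ p = cis (real p * ?a)"
    unfolding u_def by (rule Complex.DeMoivre)
  moreover have "cnj u ^ q = cis (real q * - ?a)"
    unfolding u_def cis_cnj by (rule Complex.DeMoivre)
  ultimately have "u ^ p * cnj u ^ q = cis (real p * ?a - real q * ?a)"
    by (simp only: cis_mult mult_minus_right add_uminus_conv_diff)
  also have "real p * ?a - real q * ?a = pi"
  proof -
    have "real p - real q \<noteq> 0" using assms(2) by simp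
    then show ?thesis by (simp only: left_diff_distrib[symmetric]) simp
  qed
  finally have "u ^ p * cnj u ^ q = -1" by simp
  then have "integral\<^sup>L lborel (\<lambda>z. f (u * z)) = - integral\<^sup>L lborel f"
    by (simp add: rot[OF u])
  then show ?thesis using integral_complex_rotation[OF u f] by simp
qed

lemma emeasure_disc_superlevel:
  assumes "0 \<le> x" "x < 1"
  shows "emeasure lborel {z::complex. cmod z < 1 \<and> x < (cmod z)\<^sup>2} = ennreal (pi * (1 - x))"
proof -
  have "x < (cmod z)\<^sup>2 \<longleftrightarrow> sqrt x < cmod z" for z :: complex
    by (metis abs_norm_cancel real_sqrt_abs real_sqrt_less_iff)
  then have eq: "{z::complex. cmod z < 1 \<and> x < (cmod z)\<^sup>2} = ball 0 1 - cball 0 (sqrt x)"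
    by (simp only: set_eq_iff mem_Collect_eq Diff_iff mem_ball mem_cball dist_0_norm not_le) simp
  have sub: "cball (0::complex) (sqrt x) \<subseteq> ball 0 1"
  proof -
    have "sqrt x < 1" using assms by simp
    then show ?thesis by (simp only: subset_iff mem_ball mem_cball dist_0_norm) (meson le_less_trans)
  qed
  have "emeasure lborel (ball 0 1 - cball (0::complex) (sqrt x)) =
    emeasure lborel (ball (0::complex) 1) - emeasure lborel (cball (0::complex) (sqrt x))"
    by (rule emeasure_Diff) (use sub emeasure_lborel_cball_finite[of "0::complex" "sqrt x"] in auto)
  also have "emeasure lborel (ball (0::complex) 1) = ennreal pi"
    by (subst emeasure_ball) (auto simp: unit_ball_vol_2)
  also have "emeasure lborel (cball (0::complex) (sqrt x)) = ennreal (pi * x)"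
    using assms by (subst emeasure_cball) (auto simp: unit_ball_vol_2)
  also have "ennreal pi - ennreal (pi * x) = ennreal (pi * (1 - x))"
    using assms by (simp add: ennreal_minus[symmetric] algebra_simps)
  finally show ?thesis using eq by simp
qed

text \<open>This replaces polar coordinates. The area outside radius \<open>sqrt x\<close> is affine
  in \<open>x\<close>, so the squared modulus has constant density \<open>pi\<close> on the unit
  interval; finite measures on the line are determined by their upper half-lines.\<close>

lemma distr_disc_norm_square:
  "distr (restrict_space lborel \<D>) borel (\<lambda>z. (cmod z)\<^sup>2) =
    density lborel (\<lambda>t. ennreal (pi * indicator {0..1} t))"
proof (rule measure_eqI_lessThan)
  let ?M = "distr (restrict_space lborel \<D>) borel (\<lambda>z. (cmod z)\<^sup>2)"
  let ?N = "density lborel (\<lambda>t. ennreal (pi * indicator {0..1::real} t))"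
  have M: "emeasure ?M {x<..} = emeasure lborel {z::complex. cmod z < 1 \<and> x < (cmod z)\<^sup>2}" for x
    by (subst emeasure_distr)
      (auto simp: emeasure_restrict_space space_restrict_space
        intro!: measurable_restrict_space1 arg_cong[where f="emeasure lborel"])
  have N: "emeasure ?N {x<..} = ennreal pi * emeasure lborel ({x<..} \<inter> {0..1})" for x :: real
    by (subst emeasure_density)
      (auto simp: ennreal_mult' nn_integral_cmult mult.assoc indicator_inter_arith
        simp flip: ennreal_indicator indicator_inter_arith nn_integral_indicator
        intro!: arg_cong2[where f="(*)"] nn_integral_cong split: split_indicator)
  show eq: "emeasure ?M {x<..} = emeasure ?N {x<..}" for x
  proof -
    consider "x < 0" | "0 \<le> x" "x < 1" | "1 \<le> x" by linarith
    then show ?thesis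
    proof cases
      case 1
      have "{z::complex. cmod z < 1 \<and> x < (cmod z)\<^sup>2} = ball 0 1"
        using 1 by (auto intro: less_le_trans)
      moreover have "{x<..} \<inter> {0..1} = {0..1::real}" using 1 by auto
      moreover have "emeasure lborel (ball (0::complex) 1) = ennreal pi"
        by (subst emeasure_ball) (auto simp: unit_ball_vol_2)
      ultimately show ?thesis unfolding M N by simp
    next
      case 2
      then have "{x<..} \<inter> {0..1} = {x<..1::real}" by auto
      then show ?thesis unfolding M N using 2
        by (simp add: emeasure_disc_superlevel ennreal_mult)
    next
      case 3
      then have "{x<..} \<inter> {0..1} = ({}::real set)" by auto
      moreover have "{z::complex. cmod z < 1 \<and> x < (cmod z)\<^sup>2} = {}"
      proof (rule equals0I, clarify)
        fix z :: complex assume "cmod z < 1" "x < (cmod z)\<^sup>2"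
        moreover have "(cmod z)\<^sup>2 \<le> 1" using \<open>cmod z < 1\<close> by (simp add: power_le_one)
        ultimately show False using 3 by linarith
      qed
      ultimately show ?thesis unfolding M N by (simp only: emeasure_empty mult_zero_right)
    qed
  qed
  have "emeasure ?N {x<..} \<le> ennreal pi * emeasure lborel {0..1::real}" for x
    unfolding N by (intro mult_left_mono emeasure_mono) auto
  then show "emeasure ?M {x<..} < \<infinity>" for x
    unfolding eq by (rule le_less_trans) (simp add: ennreal_mult_less_top)
qed auto

lemma nn_integral_disc_radial:
  fixes h :: "real \<Rightarrow> ennreal"
  assumes h: "h \<in> borel_measurable borel"
  shows "(\<integral>\<^sup>+z. h ((cmod z)\<^sup>2) * indicator \<D> z \<partial>lborel) =
    ennreal pi * (\<integral>\<^sup>+t. h t * indicator {0..1} t \<partial>lborel)"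
proof -
  have "(\<integral>\<^sup>+z. h ((cmod z)\<^sup>2) * indicator \<D> z \<partial>lborel) =
    (\<integral>\<^sup>+z. h ((cmod z)\<^sup>2) \<partial>restrict_space lborel \<D>)"
    by (subst nn_integral_restrict_space) auto
  also have "\<dots> = (\<integral>\<^sup>+t. h t \<partial>distr (restrict_space lborel \<D>) borel (\<lambda>z. (cmod z)\<^sup>2))"
    by (rule nn_integral_distr[symmetric]) (auto intro!: measurable_restrict_space1 h)
  also have "\<dots> = (\<integral>\<^sup>+t. ennreal pi * (h t * indicator {0..1} t) \<partial>lborel)"
    unfolding distr_disc_norm_square using h
    by (subst nn_integral_density)
      (auto intro!: nn_integral_cong simp: ennreal_mult' ennreal_indicator split: split_indicator)
  also have "\<dots> = ennreal pi * (\<integral>\<^sup>+t. h t * indicator {0..1} t \<partial>lborel)"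
    using h by (intro nn_integral_cmult) auto
  finally show ?thesis .
qed

lemma nn_integral_Beta:
  fixes a b :: real
  assumes "a > 0" "b > 0"
  shows "(\<integral>\<^sup>+t. ennreal (t powr (a - 1) * (1 - t) powr (b - 1)) * indicator {0..1} t \<partial>lborel) =
    ennreal (Beta a b)"
proof -
  let ?f = "\<lambda>t. t powr (a - 1) * (1 - t) powr (b - 1)"
  have "((\<lambda>t. ?f t) has_integral Beta a b) {0..1}"
    using assms by (rule has_integral_Beta_real)
  then have "((\<lambda>t. if t \<in> {0..1} then ?f t else 0)
      has_integral Beta a b) UNIV"
    by (simp only: has_integral_restrict_UNIV)
  then have "(\<integral>\<^sup>+t. ennreal (if t \<in> {0..1} then ?f t else 0) \<partial>lborel)
      = ennreal (Beta a b)"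
    by (rule nn_integral_has_integral_lborel[rotated 2]) auto
  also have "(\<integral>\<^sup>+t. ennreal (if t \<in> {0..1} then ?f t else 0) \<partial>lborel) =
    (\<integral>\<^sup>+t. ennreal (?f t) * indicator {0..1} t \<partial>lborel)"
    by (intro nn_integral_cong) (auto split: split_indicator)
  finally show ?thesis .
qed

section \<open>Finite hypergeometric sums\<close>

text \<open>Chu-Vandermonde: up to the factor \<open>fact p / pochhammer c p\<close>, the
  \<open>j\<close>-th term is the product of \<open>M\<close> over \<open>j\<close> and
  \<open>c + p - 1\<close> over \<open>p - j\<close>. It serves both to rewrite the Jacobi
  polynomial and to evaluate the leading coefficient of \<open>disc_poly\<close>.\<close>

lemma sum_choose_pochhammer:
  fixes c :: real
  assumes "c > 0"
  shows "(\<Sum>j\<le>p. fact j * real (p choose j) * real (M choose j) / pochhammer c j) =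
    pochhammer (c + real M) p / pochhammer c p"
proof -
  have pos: "pochhammer c j > 0" for j using assms by (rule pochhammer_pos)
  have "fact j * real (p choose j) * real (M choose j) / pochhammer c j =
      fact p / pochhammer c p * ((real M gchoose j) * ((c + real p - 1) gchoose (p - j)))"
    if "j \<le> p" for j
  proof -
    have 1: "(c + real p - 1) gchoose (p - j) = pochhammer (c + real j) (p - j) / fact (p - j)"
      using that by (simp add: gbinomial_pochhammer' of_nat_diff)
    have 2: "pochhammer c p = pochhammer c j * pochhammer (c + real j) (p - j)"
      using that by (rule pochhammer_product)
    have 3: "fact j * real (p choose j) = fact p / fact (p - j)"
      using that by (simp add: binomial_fact)
    have "pochhammer (c + real j) (p - j) > 0" using assms by (intro pochhammer_pos) simp
    then show ?thesis using pos[of j]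
      unfolding 1 2 3 by (simp add: binomial_gbinomial field_simps)
  qed
  then have "(\<Sum>j\<le>p. fact j * real (p choose j) * real (M choose j) / pochhammer c j) =
      (\<Sum>j=0..p. fact p / pochhammer c p * ((real M gchoose j) * ((c + real p - 1) gchoose (p - j))))"
    by (simp add: atLeast0AtMost)
  also have "\<dots> = fact p / pochhammer c p * ((real M + (c + real p - 1)) gchoose p)"
    by (simp only: sum_distrib_left[symmetric] gbinomial_Vandermonde)
  also have "\<dots> = pochhammer (c + real M) p / pochhammer c p"
    by (simp add: gbinomial_pochhammer' algebra_simps)
  finally show ?thesis .
qed

text \<open>The sum is the \<open>n\<close>-th backward difference of \<open>N choose b\<close> as a
  function of \<open>N\<close>; by Pascal's rule each difference lowers both the upper and the lower
  entry by one.\<close>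

lemma alternating_choose_sum:
  assumes "n \<le> N"
  shows "(\<Sum>j\<le>n. (-1) ^ j * real (n choose j) * real ((N - j) choose b)) =
    (if n \<le> b then real ((N - n) choose (b - n)) else 0)"
  using assms
proof (induction n arbitrary: N)
  case (Suc n)
  then obtain N' where N': "N = Suc N'" "n \<le> N'" by (cases N) auto
  let ?g = "\<lambda>j. real ((N - j) choose b)"
  have "(\<Sum>j\<le>Suc n. (-1) ^ j * real (Suc n choose j) * ?g j) =
      ?g 0 + (\<Sum>j\<le>n. (-1) ^ Suc j * real (Suc n choose Suc j) * ?g (Suc j))"
    by (subst sum.atMost_Suc_shift) simp
  also have "\<dots> = ?g 0 + (\<Sum>j\<le>n. (-1) ^ Suc j * real (n choose Suc j) * ?g (Suc j))
      + (\<Sum>j\<le>n. (-1) ^ Suc j * real (n choose j) * ?g (Suc j))"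
    by (simp add: sum.distrib algebra_simps sum_negf flip: sum.distrib)
  also have "?g 0 + (\<Sum>j\<le>n. (-1) ^ Suc j * real (n choose Suc j) * ?g (Suc j)) =
      (\<Sum>j\<le>Suc n. (-1) ^ j * real (n choose j) * ?g j)"
    by (subst sum.atMost_Suc_shift) simp
  also have "\<dots> = (\<Sum>j\<le>n. (-1) ^ j * real (n choose j) * ?g j)" by simp
  also have "\<dots> = (if n \<le> b then real ((N - n) choose (b - n)) else 0)"
    using Suc by simp
  also have "(\<Sum>j\<le>n. (-1) ^ Suc j * real (n choose j) * ?g (Suc j)) =
      - (\<Sum>j\<le>n. (-1) ^ j * real (n choose j) * real ((N' - j) choose b))"
    by (simp add: N' sum_negf)
  also have "(\<Sum>j\<le>n. (-1) ^ j * real (n choose j) * real ((N' - j) choose b)) =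
      (if n \<le> b then real ((N' - n) choose (b - n)) else 0)"
    using Suc N' by simp
  \<comment> \<open>One more difference by Pascal's rule. In the boundary case \<open>n = b\<close>
    both binomials are \<open>1\<close> and cancel.\<close>
  also have "(if n \<le> b then real ((N - n) choose (b - n)) else 0) +
      - (if n \<le> b then real ((N' - n) choose (b - n)) else 0) =
      (if Suc n \<le> b then real ((N - Suc n) choose (b - Suc n)) else 0)"
  proof (cases "Suc n \<le> b")
    case True
    then obtain k where k: "b = Suc n + k" by (auto simp: le_iff_add)
    have "N - n = Suc (N' - n)" using N' by simp
    then show ?thesis by (simp add: k N')
  next
    case False
    then show ?thesis by (cases "n = b") auto
  qed
  finally show ?case .
qed simp

text \<open>\<open>Gamma c\<close> cancels, leaving only factorials and Pochhammer symbols. The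
  denominator depends on \<open>a + j\<close> alone, hence is constant in sums where
  \<open>a + j\<close> is fixed.\<close>

lemma Beta_nat_shift:
  fixes c :: real
  assumes "c > 0"
  shows "Beta (real a + 1) (c + real j) = fact a * pochhammer c j / pochhammer c (a + j + 1)"
proof -
  have nz: "c \<notin> \<int>\<^sub>\<le>\<^sub>0" using assms by (auto elim!: nonpos_Ints_cases)
  have G: "Gamma (c + real k) = pochhammer c k * Gamma c" for k
    using pochhammer_Gamma[OF nz, of k] Gamma_real_pos[OF assms] by (simp add: field_simps)
  have "Gamma (real a + 1 + (c + real j)) = Gamma (c + real (a + j + 1))"
    by (simp add: add_ac)
  then show ?thesis
    using Gamma_real_pos[OF assms]
    by (simp only: Beta_def G) (simp add: Gamma_fact[symmetric] add.commute)
qed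

section \<open>The weighted space of square integrable functions\<close>

context
  fixes \<gamma> :: real
begin

abbreviation "\<mu> \<equiv> disc_measure \<gamma>"
abbreviation "L2 \<equiv> L2_disc \<gamma>"
abbreviation "nrm \<equiv> L2_norm \<gamma>"
abbreviation "ip \<equiv> L2_inner \<gamma>"
abbreviation "R \<equiv> disc_poly \<gamma>"
abbreviation "PB \<equiv> poly_bergman_space \<gamma>"
abbreviation "TB \<equiv> true_poly_bergman_space \<gamma>"
abbreviation "poch \<equiv> pochhammer (\<gamma> + 1)"
abbreviation "\<M> \<equiv> borel_measurable \<mu>"

lemma space_disc_measure [simp]: "space \<mu> = \<D>"
  by (simp add: disc_measure_def)

lemma borel_measurable_disc_measure_iff:
  "f \<in> \<M> \<longleftrightarrow> f \<in> borel_measurable (lebesgue_on \<D>)"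
  by (simp add: disc_measure_def)

lemma borel_imp_disc_measurable:
  "f \<in> borel_measurable borel \<Longrightarrow> f \<in> \<M>"
  by (simp add: borel_measurable_disc_measure_iff measurable_restrict_space1 measurable_completion)

lemma nn_integral_disc_measure:
  fixes f :: "complex \<Rightarrow> ennreal"
  assumes f: "f \<in> borel_measurable borel"
  shows "integral\<^sup>N \<mu> f =
    (\<integral>\<^sup>+z. ennreal (\<delta> z powr \<gamma>) * f z * indicator \<D> z \<partial>lborel)"
proof -
  let ?F = "\<lambda>z. ennreal (\<delta> z powr \<gamma>) * f z * indicator \<D> z"
  have "integral\<^sup>N \<mu> f =
    (\<integral>\<^sup>+z. ennreal (\<delta> z powr \<gamma>) * f z \<partial>lebesgue_on \<D>)"
    unfolding disc_measure_def using f
    by (intro nn_integral_density measurable_restrict_space1 measurable_completion) auto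
  also have "\<dots> = (\<integral>\<^sup>+z. ?F z \<partial>lebesgue)"
    by (subst nn_integral_restrict_space) auto
  also have "\<dots> = (\<integral>\<^sup>+z. ?F z \<partial>lborel)"
    by (rule nn_integral_completion)
  finally show ?thesis .
qed

lemma integral_disc_measure:
  fixes f :: "complex \<Rightarrow> complex"
  assumes f: "f \<in> borel_measurable borel"
  shows "integral\<^sup>L \<mu> f =
    integral\<^sup>L lborel (\<lambda>z. indicator \<D> z *\<^sub>R (\<delta> z powr \<gamma> *\<^sub>R f z))"
proof -
  let ?F = "\<lambda>z. indicator \<D> z *\<^sub>R (\<delta> z powr \<gamma> *\<^sub>R f z)"
  have "integral\<^sup>L \<mu> f =
    integral\<^sup>L (lebesgue_on \<D>) (\<lambda>z. \<delta> z powr \<gamma> *\<^sub>R f z)"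
    unfolding disc_measure_def using f
    by (intro integral_density measurable_restrict_space1 measurable_completion) auto
  also have "\<dots> = integral\<^sup>L lebesgue ?F"
    by (subst integral_restrict_space) auto
  also have "\<dots> = integral\<^sup>L lborel ?F"
  proof (rule integral_completion)
    have "(\<lambda>z. \<delta> z powr \<gamma> *\<^sub>R f z) \<in> borel_measurable borel"
      by (intro borel_measurable_scaleR f) auto
    then show "?F \<in> borel_measurable lborel"
      unfolding measurable_lborel1 measurable_lborel2 by (intro borel_measurable_scaleR borel_measurable_indicator f; simp)
  qed
  finally show ?thesis .
qed

lemma integral_disc_measure_phase_eq_0:
  fixes f :: "complex \<Rightarrow> complex" and p q :: nat
  assumes f: "f \<in> borel_measurable borel" and "p \<noteq> q"
    and rot: "\<And>u z. cmod u = 1 \<Longrightarrow> f (u * z) = u ^ p * cnj u ^ q * f z"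
  shows "integral\<^sup>L \<mu> f = 0"
  unfolding integral_disc_measure[OF f]
  by (rule integral_radial_phase_eq_0[OF _ \<open>p \<noteq> q\<close>])
    (use f in \<open>auto simp: norm_mult rot indicator_def\<close>)

lemma L2_disc_measurable: "f \<in> L2 \<Longrightarrow> f \<in> \<M>"
  by (simp add: L2_disc_def)

lemma L2_disc_integrable: "f \<in> L2 \<Longrightarrow> integrable \<mu> (\<lambda>z. (cmod (f z))\<^sup>2)"
  by (simp add: L2_disc_def)

lemma L2_disc_add:
  assumes "f \<in> L2" "g \<in> L2"
  shows "(\<lambda>z. f z + g z) \<in> L2"
proof -
  have [measurable]: "f \<in> \<M>" "g \<in> \<M>"
    using assms by (auto intro: L2_disc_measurable)
  have "integrable \<mu> (\<lambda>z. (cmod (f z + g z))\<^sup>2)"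
  proof (rule Bochner_Integration.integrable_bound)
    show "integrable \<mu> (\<lambda>z. 2 * (cmod (f z))\<^sup>2 + 2 * (cmod (g z))\<^sup>2)"
      using assms by (auto intro!: L2_disc_integrable)
    have "(cmod (f z + g z))\<^sup>2 \<le> 2 * (cmod (f z))\<^sup>2 + 2 * (cmod (g z))\<^sup>2" for z
    proof -
      have "(cmod (f z + g z))\<^sup>2 \<le> (cmod (f z) + cmod (g z))\<^sup>2"
        by (intro power_mono norm_triangle_ineq) auto
      also have "\<dots> \<le> 2 * (cmod (f z))\<^sup>2 + 2 * (cmod (g z))\<^sup>2"
        using zero_le_power2[of "cmod (f z) - cmod (g z)"] by (simp add: power2_sum power2_diff)
      finally show ?thesis .
    qed
    then show "AE z in \<mu>. norm ((cmod (f z + g z))\<^sup>2)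
        \<le> norm (2 * (cmod (f z))\<^sup>2 + 2 * (cmod (g z))\<^sup>2)"
      by (intro AE_I2) auto
  qed measurable
  then show ?thesis by (simp add: L2_disc_def)
qed

lemma L2_disc_cmult:
  assumes "f \<in> L2"
  shows "(\<lambda>z. c * f z) \<in> L2"
proof -
  have [measurable]: "f \<in> \<M>" by (rule L2_disc_measurable[OF assms])
  have "(\<lambda>z. c * f z) \<in> \<M>" by measurable
  then show ?thesis using assms by (simp add: L2_disc_def norm_mult power_mult_distrib)
qed

lemma L2_disc_diff:
  assumes "f \<in> L2" "g \<in> L2"
  shows "(\<lambda>z. f z - g z) \<in> L2"
  using L2_disc_add[OF assms(1) L2_disc_cmult[OF assms(2), of "-1"]] by simp

lemma L2_disc_zero: "(\<lambda>z. 0) \<in> L2"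
  by (simp add: L2_disc_def)

lemma L2_disc_sum:
  "(\<And>i. i \<in> A \<Longrightarrow> f i \<in> L2) \<Longrightarrow> (\<lambda>z. \<Sum>i\<in>A. f i z) \<in> L2"
  by (induction A rule: infinite_finite_induct) (auto intro: L2_disc_zero L2_disc_add)

lemma L2_disc_cong:
  assumes "\<And>z. z \<in> \<D> \<Longrightarrow> f z = g z"
  shows "f \<in> L2 \<longleftrightarrow> g \<in> L2"
proof -
  have "f \<in> \<M> \<longleftrightarrow> g \<in> \<M>"
    by (rule measurable_cong) (simp add: assms)
  moreover have "integrable \<mu> (\<lambda>z. (cmod (f z))\<^sup>2) \<longleftrightarrow>
      integrable \<mu> (\<lambda>z. (cmod (g z))\<^sup>2)"
    by (rule Bochner_Integration.integrable_cong) (simp_all add: assms)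
  ultimately show ?thesis by (simp add: L2_disc_def)
qed

lemma L2_disc_integrable_mult:
  assumes "f \<in> L2" "g \<in> L2"
  shows "integrable \<mu> (\<lambda>z. f z * cnj (g z))"
proof (rule Bochner_Integration.integrable_bound)
  have [measurable]: "f \<in> \<M>" "g \<in> \<M>"
    using assms by (auto intro: L2_disc_measurable)
  show "integrable \<mu> (\<lambda>z. (cmod (f z))\<^sup>2 + (cmod (g z))\<^sup>2)"
    using assms by (auto intro!: L2_disc_integrable)
  have "(\<lambda>z. cnj (g z)) \<in> \<M>"
    by (rule borel_measurable_continuous_on[where f=cnj]) (auto intro!: continuous_intros)
  then show "(\<lambda>z. f z * cnj (g z)) \<in> \<M>" by measurable
  have "cmod (f z) * cmod (g z) \<le> (cmod (f z))\<^sup>2 + (cmod (g z))\<^sup>2" for z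
  proof -
    have "0 \<le> (cmod (f z) - cmod (g z))\<^sup>2" "0 \<le> cmod (f z) * cmod (g z)" by simp_all
    then show ?thesis unfolding power2_diff by linarith
  qed
  then show "AE z in \<mu>. norm (f z * cnj (g z)) \<le> norm ((cmod (f z))\<^sup>2 + (cmod (g z))\<^sup>2)"
    by (intro AE_I2) (auto simp: norm_mult)
qed

lemma L2_inner_cong:
  assumes "\<And>z. z \<in> \<D> \<Longrightarrow> f z = f' z" "\<And>z. z \<in> \<D> \<Longrightarrow> g z = g' z"
  shows "ip f g = ip f' g'"
  unfolding L2_inner_def by (rule Bochner_Integration.integral_cong) (simp_all add: assms)

lemma L2_norm_cong:
  assumes "\<And>z. z \<in> \<D> \<Longrightarrow> f z = f' z"
  shows "nrm f = nrm f'"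
  unfolding L2_norm_def by (rule arg_cong[where f=sqrt], rule Bochner_Integration.integral_cong) (simp_all add: assms)

lemma L2_inner_add_left:
  assumes "f \<in> L2" "g \<in> L2" "h \<in> L2"
  shows "ip (\<lambda>z. f z + g z) h = ip f h + ip g h"
  unfolding L2_inner_def using assms
  by (simp add: distrib_right L2_disc_integrable_mult)

lemma L2_inner_diff_left:
  assumes "f \<in> L2" "g \<in> L2" "h \<in> L2"
  shows "ip (\<lambda>z. f z - g z) h = ip f h - ip g h"
  unfolding L2_inner_def using assms
  by (simp add: left_diff_distrib L2_disc_integrable_mult)

lemma L2_inner_cmult_left: "ip (\<lambda>z. c * f z) h = c * ip f h"
  unfolding L2_inner_def by (simp add: mult.assoc)

lemma L2_inner_commute: "ip f g = cnj (ip g f)"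
  unfolding L2_inner_def by (subst Bochner_Integration.integral_cnj[symmetric]) (simp add: mult.commute)

lemma L2_inner_zero_left: "ip (\<lambda>z. 0) h = 0"
  by (simp add: L2_inner_def)

lemma L2_inner_sum_left:
  assumes "\<And>i. i \<in> A \<Longrightarrow> f i \<in> L2" "h \<in> L2"
  shows "ip (\<lambda>z. \<Sum>i\<in>A. f i z) h = (\<Sum>i\<in>A. ip (f i) h)"
  using assms(1)
  by (induction A rule: infinite_finite_induct)
    (simp_all add: L2_inner_zero_left L2_inner_add_left L2_disc_sum assms(2))

lemma L2_inner_add_right:
  assumes "f \<in> L2" "g \<in> L2" "h \<in> L2"
  shows "ip h (\<lambda>z. f z + g z) = ip h f + ip h g"
  by (subst (1 2 3) L2_inner_commute) (simp add: L2_inner_add_left assms)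

lemma L2_inner_diff_right:
  assumes "f \<in> L2" "g \<in> L2" "h \<in> L2"
  shows "ip h (\<lambda>z. f z - g z) = ip h f - ip h g"
  by (subst (1 2 3) L2_inner_commute) (simp add: L2_inner_diff_left assms)

lemma L2_inner_cmult_right: "ip h (\<lambda>z. c * f z) = cnj c * ip h f"
  by (subst (1 2) L2_inner_commute) (simp add: L2_inner_cmult_left)

lemma L2_inner_sum_right:
  assumes "\<And>i. i \<in> A \<Longrightarrow> f i \<in> L2" "h \<in> L2"
  shows "ip h (\<lambda>z. \<Sum>i\<in>A. f i z) = (\<Sum>i\<in>A. ip h (f i))"
  by (subst (1 2) L2_inner_commute) (simp add: L2_inner_sum_left assms)

lemma L2_norm_nonneg: "0 \<le> nrm f"
  by (simp add: L2_norm_def)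

lemma L2_norm_power2: "(nrm f)\<^sup>2 = (LINT z|\<mu>. (cmod (f z))\<^sup>2)"
  by (simp add: L2_norm_def)

lemma L2_inner_self: "ip f f = of_real ((nrm f)\<^sup>2)"
  unfolding L2_norm_power2 L2_inner_def
  by (simp flip: complex_norm_square integral_complex_of_real)

lemma L2_norm_add_power2:
  assumes "f \<in> L2" "g \<in> L2"
  shows "(nrm (\<lambda>z. f z + g z))\<^sup>2 =
    (nrm f)\<^sup>2 + 2 * Re (ip f g) + (nrm g)\<^sup>2"
proof -
  have "ip (\<lambda>z. f z + g z) (\<lambda>z. f z + g z) =
    ip f f + (ip f g + cnj (ip f g)) + ip g g"
    using assms L2_inner_commute[of g f]
    by (simp add: L2_inner_add_left L2_inner_add_right L2_disc_add)
  then have "complex_of_real ((nrm (\<lambda>z. f z + g z))\<^sup>2) =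
    of_real ((nrm f)\<^sup>2 + 2 * Re (ip f g) + (nrm g)\<^sup>2)"
    by (simp only: L2_inner_self complex_add_cnj) simp
  then show ?thesis by (simp only: of_real_eq_iff)
qed

lemma L2_norm_cmult: "nrm (\<lambda>z. c * f z) = cmod c * nrm f"
  by (simp add: L2_norm_def norm_mult power_mult_distrib real_sqrt_mult)

lemma L2_norm_minus_commute: "nrm (\<lambda>z. f z - g z) = nrm (\<lambda>z. g z - f z)"
  by (simp add: L2_norm_def norm_minus_commute)

lemma L2_norm_zero: "nrm (\<lambda>z. 0) = 0"
  by (simp add: L2_norm_def)

lemma L2_Cauchy_Schwarz:
  assumes f: "f \<in> L2" and g: "g \<in> L2"
  shows "cmod (ip f g) \<le> nrm f * nrm g"
proof -
  define A B P where "A = (nrm f)\<^sup>2" and "B = (nrm g)\<^sup>2" and "P = (cmod (ip f g))\<^sup>2"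
  have nn: "A \<ge> 0" "B \<ge> 0" "P \<ge> 0" by (simp_all add: A_def B_def P_def)
  \<comment> \<open>Expansion of the squared norm of \<open>f - s * ip f g * g\<close>.\<close>
  have quad: "0 \<le> A - 2 * s * P + s\<^sup>2 * P * B" for s :: real
  proof -
    define c where "c = - (of_real s * ip f g)"
    have "cnj c * ip f g = of_real (- s * P)"
      by (simp add: c_def P_def complex_norm_square mult_ac del: of_real_power)
    then have re: "Re (ip f (\<lambda>z. c * g z)) = - s * P"
      by (simp add: L2_inner_cmult_right)
    have nc: "(nrm (\<lambda>z. c * g z))\<^sup>2 = s\<^sup>2 * P * B"
      unfolding L2_norm_cmult by (simp add: power_mult_distrib c_def norm_mult P_def B_def)
    have "0 \<le> (nrm (\<lambda>z. f z + c * g z))\<^sup>2" by simp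
    also have "\<dots> = A + 2 * (- s * P) + s\<^sup>2 * P * B"
      using L2_norm_add_power2[OF f L2_disc_cmult[OF g], of c] re nc by (simp add: A_def)
    finally show ?thesis by simp
  qed
  have "P \<le> A * B"
  proof (cases "B = 0")
    case True
    show ?thesis
    proof (rule ccontr)
      assume "\<not> P \<le> A * B"
      then have "P > 0" using True by simp
      \<comment> \<open>At this \<open>s\<close> the quadratic, affine because \<open>B = 0\<close>,
        takes the value \<open>A - 2 * (A + 1) < 0\<close>.\<close>
      then show False using quad[of "(A + 1) / P"] nn True by simp
    qed
  next
    case False
    then show ?thesis using quad[of "1 / B"] nn by (simp add: field_simps power2_eq_square)
  qed
  then show ?thesis
    unfolding A_def B_def P_def power_mult_distrib[symmetric]
    by (rule power2_le_imp_le) (simp add: L2_norm_nonneg)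
qed

lemma L2_norm_triangle:
  assumes f: "f \<in> L2" and g: "g \<in> L2"
  shows "nrm (\<lambda>z. f z + g z) \<le> nrm f + nrm g"
proof (rule power2_le_imp_le)
  have "Re (ip f g) \<le> nrm f * nrm g"
    using L2_Cauchy_Schwarz[OF assms] complex_Re_le_cmod order_trans by blast
  then show "(nrm (\<lambda>z. f z + g z))\<^sup>2 \<le> (nrm f + nrm g)\<^sup>2"
    by (simp add: L2_norm_add_power2[OF assms] power2_sum)
qed (simp add: L2_norm_nonneg)

lemma L2_norm_triangle_diff:
  assumes f: "f \<in> L2" and g: "g \<in> L2" and h: "h \<in> L2"
  shows "nrm (\<lambda>z. f z - h z) \<le> nrm (\<lambda>z. f z - g z) + nrm (\<lambda>z. g z - h z)"
  using L2_norm_triangle[OF L2_disc_diff[OF f g] L2_disc_diff[OF g h]] by simp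

lemma L2_norm_sum:
  assumes "\<And>i. i \<in> A \<Longrightarrow> f i \<in> L2"
  shows "nrm (\<lambda>z. \<Sum>i\<in>A. f i z) \<le> (\<Sum>i\<in>A. nrm (f i))"
  using assms
proof (induction A rule: infinite_finite_induct)
  case (insert x A)
  then have "nrm (\<lambda>z. f x z + (\<Sum>i\<in>A. f i z)) \<le> nrm (f x) + nrm (\<lambda>z. \<Sum>i\<in>A. f i z)"
    by (intro L2_norm_triangle L2_disc_sum) auto
  with insert show ?case by (simp add: order_trans)
qed (simp_all add: L2_norm_zero)

lemma L2_tendsto_inner:
  assumes X: "\<And>i. X i \<in> L2" and f: "f \<in> L2" and h: "h \<in> L2"
    and lim: "L2_tendsto \<gamma> X f"
  shows "(\<lambda>i. ip (X i) h) \<longlonglongrightarrow> ip f h"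
proof (rule LIM_zero_cancel, rule Lim_null_comparison)
  show "\<forall>\<^sub>F i in sequentially. norm (ip (X i) h - ip f h)
      \<le> nrm (\<lambda>z. X i z - f z) * nrm h"
    using L2_Cauchy_Schwarz[OF L2_disc_diff[OF X f] h]
    by (simp add: L2_inner_diff_left X f h)
  show "(\<lambda>i. nrm (\<lambda>z. X i z - f z) * nrm h) \<longlonglongrightarrow> 0"
    using lim unfolding L2_tendsto_def by (rule tendsto_mult_left_zero)
qed

lemma nn_integral_L2_norm:
  assumes "f \<in> L2"
  shows "(\<integral>\<^sup>+z. ennreal ((cmod (f z))\<^sup>2) \<partial>\<mu>) = ennreal ((nrm f)\<^sup>2)"
  unfolding L2_norm_power2 by (rule nn_integral_eq_integral) (simp_all add: L2_disc_integrable assms)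

lemma L2_norm_le:
  assumes f: "f \<in> \<M>" and "0 \<le> e"
    and le: "(\<integral>\<^sup>+z. ennreal ((cmod (f z))\<^sup>2) \<partial>\<mu>) \<le> ennreal (e\<^sup>2)"
  shows "f \<in> L2" "nrm f \<le> e"
proof -
  have "integrable \<mu> (\<lambda>z. (cmod (f z))\<^sup>2)"
    by (rule integrableI_nonneg) (use f le in \<open>auto intro: le_less_trans\<close>)
  then show L2: "f \<in> L2" using f by (simp add: L2_disc_def)
  have "(nrm f)\<^sup>2 \<le> e\<^sup>2" using le by (simp add: nn_integral_L2_norm[OF L2])
  then show "nrm f \<le> e" using \<open>0 \<le> e\<close> by (rule power2_le_imp_le)
qed

text \<open>Fatou's lemma applied to \<open>|X i - X j|^2\<close> as \<open>j\<close> grows. It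
  identifies the norm limit with a prescribed pointwise limit, which is how the sums of explicit
  series are recognized as L2 limits.\<close>

lemma L2_Cauchy_pointwise_limit:
  assumes X: "\<And>i. X i \<in> L2" and C: "L2_Cauchy \<gamma> X"
    and g: "g \<in> \<M>"
    and lim: "AE z in \<mu>. (\<lambda>i. X i z) \<longlonglongrightarrow> g z"
  shows "g \<in> L2" "L2_tendsto \<gamma> X g"
proof -
  note [measurable] = g L2_disc_measurable[OF X]
  let ?d = "\<lambda>i j z. ennreal ((cmod (X i z - X j z))\<^sup>2)"
  let ?e = "\<lambda>i z. ennreal ((cmod (X i z - g z))\<^sup>2)"
  have *: "\<exists>N. \<forall>i\<ge>N. (\<lambda>z. X i z - g z) \<in> L2 \<and> nrm (\<lambda>z. X i z - g z) \<le> e" if "e > 0" for e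
  proof -
    obtain N where N: "\<And>i j. i \<ge> N \<Longrightarrow> j \<ge> N \<Longrightarrow> nrm (\<lambda>z. X i z - X j z) < e"
      using C \<open>e > 0\<close> unfolding L2_Cauchy_def by blast
    have "(\<lambda>z. X i z - g z) \<in> L2 \<and> nrm (\<lambda>z. X i z - g z) \<le> e" if "i \<ge> N" for i
    proof -
      have "AE z in \<mu>.
          ?e i z = liminf (\<lambda>j. ?d i j z)"
        using lim
      proof eventually_elim
        case (elim z)
        have "(\<lambda>j. ?d i j z) \<longlonglongrightarrow> ?e i z"
          by (intro tendsto_intros elim)
        then show ?case by (metis lim_imp_Liminf sequentially_bot)
      qed
      then have "(\<integral>\<^sup>+z. ?e i z \<partial>\<mu>) =
          (\<integral>\<^sup>+z. liminf (\<lambda>j. ?d i j z) \<partial>\<mu>)"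
        by (rule nn_integral_cong_AE)
      also have "\<dots> \<le> liminf (\<lambda>j. \<integral>\<^sup>+z. ?d i j z \<partial>\<mu>)"
        by (rule nn_integral_liminf) measurable
      also have "\<dots> \<le> ennreal (e\<^sup>2)"
      proof (rule Liminf_le)
        show "\<forall>\<^sub>F j in sequentially. (\<integral>\<^sup>+z. ?d i j z \<partial>\<mu>) \<le> ennreal (e\<^sup>2)"
          using eventually_ge_at_top[of N]
        proof eventually_elim
          case (elim j)
          have "(nrm (\<lambda>z. X i z - X j z))\<^sup>2 \<le> e\<^sup>2"
            using N[OF \<open>i \<ge> N\<close> elim] by (intro power_mono) (auto simp: L2_norm_nonneg)
          then show ?case
            by (simp add: nn_integral_L2_norm L2_disc_diff X)
        qed
      qed simp
      finally have "(\<integral>\<^sup>+z. ?e i z \<partial>\<mu>) \<le> ennreal (e\<^sup>2)" .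
      then show ?thesis using \<open>e > 0\<close> by (intro conjI L2_norm_le) auto
    qed
    then show ?thesis by blast
  qed
  obtain N where "(\<lambda>z. X N z - g z) \<in> L2" using *[of 1] by auto
  from L2_disc_diff[OF X this, of N] show "g \<in> L2" by simp
  show "L2_tendsto \<gamma> X g"
    unfolding L2_tendsto_def
  proof (rule LIMSEQ_I)
    fix r :: real assume "r > 0"
    then obtain N where "\<forall>i\<ge>N. nrm (\<lambda>z. X i z - g z) \<le> r / 2" using *[of "r / 2"] by auto
    then show "\<exists>N. \<forall>i\<ge>N. norm (nrm (\<lambda>z. X i z - g z) - 0) < r"
      using \<open>r > 0\<close> by (intro exI[of _ N]) (auto simp: L2_norm_nonneg intro: le_less_trans)
  qed
qed

text \<open>Riesz-Fischer: a subsequence with geometrically small increments converges almost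
  everywhere, Fatou turns its pointwise limit into a norm limit, and the Cauchy property extends
  this to the whole sequence.\<close>

lemma L2_disc_complete:
  assumes X: "\<And>i. X i \<in> L2" and C: "L2_Cauchy \<gamma> X"
  shows "\<exists>f\<in>L2. L2_tendsto \<gamma> X f"
proof -
  note [measurable] = L2_disc_measurable[OF X]
  have "\<exists>r. \<forall>k. (\<forall>i\<ge>r k. \<forall>j\<ge>r k. nrm (\<lambda>z. X i z - X j z) < (1 / 2) ^ k) \<and> r k < r (Suc k)"
  proof (rule dependent_nat_choice)
    show "\<exists>m. \<forall>i\<ge>m. \<forall>j\<ge>m. nrm (\<lambda>z. X i z - X j z) < (1 / 2) ^ 0"
      using C unfolding L2_Cauchy_def by simp
    fix m k
    obtain N where "\<forall>i\<ge>N. \<forall>j\<ge>N. nrm (\<lambda>z. X i z - X j z) < (1 / 2) ^ Suc k"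
      using C unfolding L2_Cauchy_def by (metis divide_pos_pos zero_less_numeral zero_less_one zero_less_power)
    then show "\<exists>m'. (\<forall>i\<ge>m'. \<forall>j\<ge>m'. nrm (\<lambda>z. X i z - X j z) < (1 / 2) ^ Suc k) \<and> m < m'"
      by (intro exI[of _ "max N (Suc m)"]) auto
  qed
  then obtain r where r: "\<And>k i j. i \<ge> r k \<Longrightarrow> j \<ge> r k \<Longrightarrow> nrm (\<lambda>z. X i z - X j z) < (1 / 2) ^ k"
    and rS: "\<And>k. r k < r (Suc k)" by blast
  have mono: "strict_mono r" using rS by (simp add: strict_mono_Suc_iff)
  define d where "d k z = X (r (Suc k)) z - X (r k) z" for k z
  have d_L2: "d k \<in> L2" for k unfolding d_def by (intro L2_disc_diff X)
  note [measurable] = L2_disc_measurable[OF d_L2]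
  have d_norm: "nrm (d k) \<le> (1 / 2) ^ k" for k
    unfolding d_def using r[of k "r (Suc k)" "r k"] rS[of k] by simp
  \<comment> \<open>The weight \<open>2 ^ k\<close> is affordable since the squared norms decay like
    \<open>4^(-k)\<close>, and finiteness of the weighted sum will force absolute convergence of the
    increments.\<close>
  let ?s = "\<lambda>z. \<Sum>k. ennreal (2 ^ k * (cmod (d k z))\<^sup>2)"
  have "(\<integral>\<^sup>+z. ?s z \<partial>\<mu>) =
      (\<Sum>k. \<integral>\<^sup>+z. ennreal (2 ^ k * (cmod (d k z))\<^sup>2) \<partial>\<mu>)"
    by (rule nn_integral_suminf) measurable
  also have "\<dots> = (\<Sum>k. ennreal (2 ^ k * (nrm (d k))\<^sup>2))"
    by (simp add: ennreal_mult' nn_integral_cmult nn_integral_L2_norm[OF d_L2])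
  also have "\<dots> \<le> (\<Sum>k. ennreal ((1 / 2) ^ k))"
  proof (rule suminf_le)
    fix k
    have "(nrm (d k))\<^sup>2 \<le> ((1 / 2) ^ k)\<^sup>2"
      by (intro power_mono d_norm L2_norm_nonneg)
    then have "2 ^ k * (nrm (d k))\<^sup>2 \<le> 2 ^ k * ((1 / 2) ^ k)\<^sup>2" by simp
    also have "2 ^ k * ((1 / 2) ^ k)\<^sup>2 = (1 / 2 :: real) ^ k"
      by (simp add: power2_eq_square power_one_over)
    finally show "ennreal (2 ^ k * (nrm (d k))\<^sup>2) \<le> ennreal ((1 / 2) ^ k)"
      by (rule ennreal_leI)
  qed auto
  also have "\<dots> < \<infinity>"
    by (subst suminf_ennreal2) (auto simp: summable_geometric)
  finally have fin: "(\<integral>\<^sup>+z. ?s z \<partial>\<mu>) < \<infinity>" .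
  have "AE z in \<mu>. ?s z \<noteq> \<infinity>"
    by (rule nn_integral_PInf_AE) (use fin in \<open>auto simp: less_top\<close>)
  then have conv: "AE z in \<mu>. convergent (\<lambda>k. X (r k) z)"
  proof eventually_elim
    case (elim z)
    have s1: "summable (\<lambda>k. 2 ^ k * (cmod (d k z))\<^sup>2)"
      by (rule summable_suminf_not_top) (use elim in auto)
    have s2: "summable (\<lambda>k. (1 / 2 :: real) ^ k)" by (rule summable_geometric) simp
    have "summable (\<lambda>k. d k z)"
    proof (rule summable_comparison_test'[OF summable_add[OF s2 s1], of 0])
      fix k
      \<comment> \<open>Arithmetic-geometric mean in the form
        \<open>2 |d| <= 2^(-k) + 2^k |d|^2\<close>.\<close>
      have "0 \<le> (1 / 2 :: real) ^ k * (1 - 2 ^ k * cmod (d k z))\<^sup>2" by simp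
      also have "(1 / 2 :: real) ^ k * (1 - 2 ^ k * cmod (d k z))\<^sup>2 =
          (1 / 2) ^ k + 2 ^ k * (cmod (d k z))\<^sup>2 - 2 * cmod (d k z)"
        by (simp add: power2_diff power_divide field_simps) (simp add: power2_eq_square)
      finally show "norm (d k z) \<le> (1 / 2) ^ k + 2 ^ k * (cmod (d k z))\<^sup>2"
        using norm_ge_zero[of "d k z"] by linarith
    qed
    then have "convergent (\<lambda>n. X (r 0) z + (\<Sum>k<n. d k z))"
      by (intro convergent_add convergent_const) (simp add: summable_iff_convergent)
    moreover have "X (r 0) z + (\<Sum>k<n. d k z) = X (r n) z" for n
      unfolding d_def by (subst sum_lessThan_telescope) simp
    ultimately show ?case by simp
  qed
  \<comment> \<open>Where the subsequence diverges \<open>lim\<close> has an unspecified value; this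
    happens only on a null set.\<close>
  define g where "g z = lim (\<lambda>k. X (r k) z)" for z
  have gm: "g \<in> \<M>"
    unfolding g_def by (rule borel_measurable_lim_metric) measurable
  have lim: "AE z in \<mu>. (\<lambda>k. X (r k) z) \<longlonglongrightarrow> g z"
    using conv by eventually_elim (simp add: g_def convergent_LIMSEQ_iff)
  have rC: "L2_Cauchy \<gamma> (\<lambda>k. X (r k))"
    unfolding L2_Cauchy_def
  proof (intro allI impI)
    fix e :: real assume "e > 0"
    then obtain N where "\<forall>i\<ge>N. \<forall>j\<ge>N. nrm (\<lambda>z. X i z - X j z) < e"
      using C unfolding L2_Cauchy_def by blast
    then show "\<exists>N. \<forall>i\<ge>N. \<forall>j\<ge>N. nrm (\<lambda>z. X (r i) z - X (r j) z) < e"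
      using seq_suble[OF mono] by (meson order_trans)
  qed
  note g = L2_Cauchy_pointwise_limit[OF X rC gm lim]
  have "L2_tendsto \<gamma> X g"
    unfolding L2_tendsto_def
  proof (rule LIMSEQ_I)
    fix e :: real assume "e > 0"
    obtain N where N: "\<And>i j. i \<ge> N \<Longrightarrow> j \<ge> N \<Longrightarrow> nrm (\<lambda>z. X i z - X j z) < e / 2"
      using C \<open>e > 0\<close> unfolding L2_Cauchy_def by (meson half_gt_zero)
    obtain M where M: "\<And>i. i \<ge> M \<Longrightarrow> nrm (\<lambda>z. X (r i) z - g z) < e / 2"
      using g(2) \<open>e > 0\<close> unfolding L2_tendsto_def lim_sequentially dist_real_def
      by (metis L2_norm_nonneg abs_of_nonneg diff_zero half_gt_zero)
    have "nrm (\<lambda>z. X i z - g z) < e" if "i \<ge> max N M" for i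
    proof -
      have "r i \<ge> N" using seq_suble[OF mono, of i] that by simp
      then show ?thesis
        using L2_norm_triangle_diff[OF X X g(1), of i "r i"] N[of i "r i"] M[of i] that by simp
    qed
    then show "\<exists>N. \<forall>i\<ge>N. norm (nrm (\<lambda>z. X i z - g z) - 0) < e"
      by (intro exI[of _ "max N M"]) (auto simp: L2_norm_nonneg)
  qed
  with g(1) show ?thesis by blast
qed

lemma hilbert_subspace_L2_disc: "hilbert_subspace \<gamma> (L2)"
  unfolding hilbert_subspace_def
  by (auto intro: L2_disc_zero L2_disc_add L2_disc_cmult L2_disc_complete)

lemma L2_norm_sum_orthogonal:
  assumes "finite A" and u: "\<And>i. i \<in> A \<Longrightarrow> u i \<in> L2"
    and orth: "\<And>i j. i \<in> A \<Longrightarrow> j \<in> A \<Longrightarrow> i \<noteq> j \<Longrightarrow> ip (u i) (u j) = 0"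
  shows "(nrm (\<lambda>z. \<Sum>i\<in>A. u i z))\<^sup>2 = (\<Sum>i\<in>A. (nrm (u i))\<^sup>2)"
proof -
  have "ip (\<lambda>z. \<Sum>i\<in>A. u i z) (\<lambda>z. \<Sum>i\<in>A. u i z) = (\<Sum>i\<in>A. \<Sum>j\<in>A. ip (u i) (u j))"
    using u by (simp add: L2_inner_sum_left L2_inner_sum_right L2_disc_sum)
  also have "\<dots> = (\<Sum>i\<in>A. \<Sum>j\<in>A. if j = i then ip (u i) (u i) else 0)"
    using orth by (intro sum.cong) auto
  also have "\<dots> = (\<Sum>i\<in>A. ip (u i) (u i))" using \<open>finite A\<close> by simp
  finally have "complex_of_real ((nrm (\<lambda>z. \<Sum>i\<in>A. u i z))\<^sup>2) = of_real (\<Sum>i\<in>A. (nrm (u i))\<^sup>2)"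
    by (simp only: L2_inner_self of_real_sum)
  then show ?thesis by (simp only: of_real_eq_iff)
qed

lemma L2_Cauchy_seriesI:
  assumes "\<And>e. e > 0 \<Longrightarrow> \<exists>N. \<forall>j\<ge>N. \<forall>i. nrm (\<lambda>z. \<Sum>k=j..<i. u k z) < e"
  shows "L2_Cauchy \<gamma> (\<lambda>N z. \<Sum>k<N. u k z)"
  unfolding L2_Cauchy_def
proof (intro allI impI)
  fix e :: real assume "e > 0"
  then obtain N where N: "\<And>i j. j \<ge> N \<Longrightarrow> nrm (\<lambda>z. \<Sum>k=j..<i. u k z) < e" using assms by blast
  have *: "nrm (\<lambda>z. (\<Sum>k<i. u k z) - (\<Sum>k<j. u k z)) < e" if "N \<le> j" "j \<le> i" for i j
    using N[OF that(1), of i] that(2) by (simp add: sum_diff_nat_ivl lessThan_atLeast0)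
  show "\<exists>N. \<forall>i\<ge>N. \<forall>j\<ge>N. nrm (\<lambda>z. (\<Sum>k<i. u k z) - (\<Sum>k<j. u k z)) < e"
  proof (intro exI[of _ N] allI impI)
    fix i j assume "i \<ge> N" "j \<ge> N"
    then show "nrm (\<lambda>z. (\<Sum>k<i. u k z) - (\<Sum>k<j. u k z)) < e"
      using *[of i j] *[of j i] L2_norm_minus_commute[of "\<lambda>z. \<Sum>k<i. u k z" "\<lambda>z. \<Sum>k<j. u k z"]
      by (cases "j \<le> i") auto
  qed
qed

lemma L2_Bessel:
  assumes u: "\<And>i. u i \<in> L2" and f: "f \<in> L2"
    and orth: "\<And>i j. i \<noteq> j \<Longrightarrow> ip (u i) (u j) = 0"
    and fu: "\<And>i. ip f (u i) = ip (u i) (u i)"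
  shows "(\<Sum>i<N. (nrm (u i))\<^sup>2) \<le> (nrm f)\<^sup>2"
    and "L2_Cauchy \<gamma> (\<lambda>N z. \<Sum>i<N. u i z)"
proof -
  have norm_sum: "(nrm (\<lambda>z. \<Sum>i\<in>A. u i z))\<^sup>2 = (\<Sum>i\<in>A. (nrm (u i))\<^sup>2)" if "finite A" for A
    using that u orth by (intro L2_norm_sum_orthogonal) auto
  show le: "(\<Sum>i<N. (nrm (u i))\<^sup>2) \<le> (nrm f)\<^sup>2" for N
  proof -
    let ?S = "\<lambda>z. (\<Sum>i<N. u i z)"
    let ?s = "\<Sum>i<N. (nrm (u i))\<^sup>2"
    have "ip f (\<lambda>z. (-1) * ?S z) = - (\<Sum>i<N. ip (u i) (u i))"
      using u f fu by (simp only: L2_inner_cmult_right L2_inner_sum_right) simp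
    then have 1: "Re (ip f (\<lambda>z. (-1) * ?S z)) = - ?s"
      by (simp add: L2_inner_self)
    have 2: "(nrm (\<lambda>z. (-1) * ?S z))\<^sup>2 = ?s"
      by (simp only: L2_norm_cmult power_mult_distrib norm_sum[OF finite_lessThan]) simp
    have "0 \<le> (nrm (\<lambda>z. f z + (-1) * ?S z))\<^sup>2" by simp
    also have "\<dots> = (nrm f)\<^sup>2 + 2 * Re (ip f (\<lambda>z. (-1) * ?S z)) + (nrm (\<lambda>z. (-1) * ?S z))\<^sup>2"
      by (intro L2_norm_add_power2 f L2_disc_cmult L2_disc_sum u)
    finally show ?thesis unfolding 1 2 by simp
  qed
  have summ: "summable (\<lambda>i. (nrm (u i))\<^sup>2)"
    by (rule bounded_imp_summable[of _ "(nrm f)\<^sup>2"])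
      (use le[of "Suc _"] in \<open>auto simp: lessThan_Suc_atMost\<close>)
  show "L2_Cauchy \<gamma> (\<lambda>N z. \<Sum>i<N. u i z)"
  proof (rule L2_Cauchy_seriesI)
    fix e :: real assume "e > 0"
    then have "e\<^sup>2 > 0" by simp
    then obtain N where "\<And>m n. m \<ge> N \<Longrightarrow> norm (\<Sum>i=m..<n. (nrm (u i))\<^sup>2) < e\<^sup>2"
      using summ unfolding summable_Cauchy by blast
    then have "(nrm (\<lambda>z. \<Sum>k=j..<i. u k z))\<^sup>2 < e\<^sup>2" if "j \<ge> N" for i j
      using that by (simp add: norm_sum sum_nonneg)
    then show "\<exists>N. \<forall>j\<ge>N. \<forall>i. nrm (\<lambda>z. \<Sum>k=j..<i. u k z) < e"
      using power2_less_imp_less \<open>e > 0\<close> less_imp_le by blast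
  qed
qed

lemma AE_disc_measure_not_in_negligible:
  assumes "negligible N"
  shows "AE z in \<mu>. z \<notin> N"
proof -
  have "AE z in lebesgue. z \<notin> N"
    using assms by (intro AE_not_in) (simp add: negligible_iff_null_sets)
  then have "AE z in lebesgue_on \<D>. z \<notin> N"
    by (subst AE_restrict_space_iff) auto
  then show ?thesis
    unfolding disc_measure_def
    by (subst AE_density) (auto intro!: measurable_restrict_space1 measurable_completion)
qed

text \<open>Coefficient of \<open>\<delta> z ^ j * z ^ (m - j) * cnj z ^ (n - j)\<close> in the disc
  polynomial. It vanishes for \<open>j > min m n\<close>, so sums may run to \<open>n\<close> and
  truncated exponents never contribute.\<close>

definition disc_coeff :: "nat \<Rightarrow> nat \<Rightarrow> nat \<Rightarrow> real"
  where "disc_coeff m n j =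
    (-1) ^ j * fact j * real (n choose j) * real (m choose j) / poch j"

definition disc_fourier :: "nat \<Rightarrow> (complex \<Rightarrow> complex) \<Rightarrow> nat \<Rightarrow> complex"
  where "disc_fourier n f m =
    ip f (R m n) / of_real ((nrm (R m n))\<^sup>2)"

text \<open>A pointwise sum rather than an abstract L2 projection, so that it yields a definite
  polyanalytic function with values at points.\<close>

definition disc_proj :: "nat \<Rightarrow> (complex \<Rightarrow> complex) \<Rightarrow> complex \<Rightarrow> complex"
  where "disc_proj n f z = (\<Sum>m. disc_fourier n f m * R m n z)"

text \<open>The reproducing property at \<open>R m n\<close> forces the inner product of the kernel
  with \<open>R m n\<close> to be \<open>cnj (R m n w)\<close>; division by the squared norm gives
  the Fourier coefficient.\<close>

definition kernel_coeff :: "nat \<Rightarrow> complex \<Rightarrow> nat \<Rightarrow> complex"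
  where "kernel_coeff n w m = cnj (R m n w) / of_real ((nrm (R m n))\<^sup>2)"

definition disc_kernel :: "nat \<Rightarrow> complex \<Rightarrow> complex \<Rightarrow> complex"
  where "disc_kernel n z w = (\<Sum>m. kernel_coeff n w m * R m n z)"

lemma disc_poly_rotate:
  assumes "cmod u = 1"
  shows "R m n (u * z) = u ^ m * cnj u ^ n * R m n z"
proof -
  have "u * cnj u = 1" using assms by (simp add: complex_norm_square[symmetric])
  then have k: "u ^ k * cnj u ^ k = 1" for k by (simp flip: power_mult_distrib)
  \<comment> \<open>The \<open>min m n\<close> powers missing from the monomial prefactor come in
    cancelling pairs, so the phase has one shape for \<open>m <= n\<close> and
    \<open>n <= m\<close>.\<close>
  have "u ^ m * cnj u ^ n = u ^ (m - min m n) * cnj u ^ (n - min m n) * (u ^ min m n * cnj u ^ min m n)"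
    by (simp add: mult_ac flip: power_add)
  also have "\<dots> = u ^ (m - min m n) * cnj u ^ (n - min m n)" by (simp only: k mult_1_right)
  finally show ?thesis
    by (simp add: disc_poly_def norm_mult assms power_mult_distrib mult_ac)
qed

lemma poly_bergman_space_iff:
  "F \<in> PB n \<longleftrightarrow> F \<in> L2 \<and> polyanalytic (Suc n) F"
  unfolding poly_bergman_space_def
  using polyanalytic_smooth polyanalytic_imp_wirtinger_bar_eq_0 wirtinger_bar_eq_0_imp_polyanalytic[of F "Suc n"]
  by (auto simp del: funpow.simps)

lemma bergman_space_eq: "bergman_space \<gamma> = PB 0"
  by (auto simp: poly_bergman_space_iff polyanalytic_1 bergman_space_def)

lemma disc_fourier_cong:
  "(\<And>z. z \<in> \<D> \<Longrightarrow> f z = g z) \<Longrightarrow> disc_fourier n f = disc_fourier n g"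
  unfolding disc_fourier_def using L2_inner_cong[of f g _ _] by auto

lemma disc_proj_cong:
  "(\<And>z. z \<in> \<D> \<Longrightarrow> f z = g z) \<Longrightarrow> disc_proj n f = disc_proj n g"
  unfolding disc_proj_def using disc_fourier_cong[of f g n] by auto

lemma polyanalytic_measurable:
  assumes "polyanalytic N F"
  shows "F \<in> \<M>"
proof -
  have "continuous_on \<D> F"
    using polyanalytic_smooth[OF assms] unfolding smooth_on_def by (metis Ck_on.simps(1))
  then show ?thesis
    unfolding borel_measurable_disc_measure_iff
    by (intro continuous_imp_measurable_on_sets_lebesgue) auto
qed

lemma integral_disc_exhaustion:
  fixes h :: "complex \<Rightarrow> complex"
  assumes h: "integrable \<mu> h" and \<rho>: "\<rho> \<longlonglongrightarrow> 1"
  shows "(\<lambda>i. LINT z|\<mu>. indicator (ball 0 (\<rho> i)) z * h z) \<longlonglongrightarrow> integral\<^sup>L \<mu> h"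
proof (rule integral_dominated_convergence)
  let ?h = "\<lambda>i z. indicator (ball 0 (\<rho> i)) z * h z"
  show "h \<in> \<M>" using h by (rule borel_measurable_integrable)
  have ind: "(\<lambda>z. indicator (ball 0 (\<rho> i)) z :: complex) \<in> \<M>" for i
    by (rule borel_imp_disc_measurable) (auto intro!: borel_measurable_indicator)
  show "?h i \<in> \<M>" for i
    by (intro borel_measurable_times ind borel_measurable_integrable[OF h])
  show "integrable \<mu> (\<lambda>z. cmod (h z))" by (rule integrable_norm[OF h])
  show "AE z in \<mu>. norm (?h i z) \<le> cmod (h z)" for i
    by (intro AE_I2) (auto simp: indicator_def)
  show "AE z in \<mu>. (\<lambda>i. ?h i z) \<longlonglongrightarrow> h z"
  proof (rule AE_I2)
    fix z assume "z \<in> space \<mu>"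
    then have "cmod z < 1" by simp
    then have "\<forall>\<^sub>F i in sequentially. cmod z < \<rho> i" by (rule order_tendstoD[OF \<rho>])
    then have "\<forall>\<^sub>F i in sequentially. ?h i z = h z"
      by eventually_elim (simp add: indicator_def)
    then show "(\<lambda>i. ?h i z) \<longlonglongrightarrow> h z" by (rule tendsto_eventually)
  qed
qed

lemma L2_tendsto_comparison:
  assumes "L2_tendsto \<gamma> X f" "\<And>i. nrm (\<lambda>z. Y i z - g z) \<le> C * nrm (\<lambda>z. X i z - f z)"
  shows "L2_tendsto \<gamma> Y g"
  unfolding L2_tendsto_def
proof (rule Lim_null_comparison)
  show "(\<lambda>i. C * nrm (\<lambda>z. X i z - f z)) \<longlonglongrightarrow> 0"
    using assms(1) unfolding L2_tendsto_def by (rule tendsto_mult_right_zero)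
qed (use assms(2) L2_norm_nonneg in auto)

section \<open>Finite moments of the weight and totality of the monomials\<close>

context
  assumes \<gamma>: "\<gamma> > -1"
begin

lemma gamma_pos: "\<gamma> + 1 > 0"
  using \<gamma> by simp

text \<open>The variable \<open>t = |z|^2\<close> turns the moment into a Beta integral, which
  converges because \<open>\<gamma> + j + 1 > 0\<close>.\<close>

lemma nn_integral_disc_moment:
  "(\<integral>\<^sup>+z. ennreal ((cmod z) ^ (2 * a) * \<delta> z ^ j) \<partial>\<mu>) =
    ennreal (pi * Beta (real a + 1) (\<gamma> + real j + 1))"
proof -
  let ?h = "\<lambda>t::real. ennreal ((1 - t) powr \<gamma> * (t ^ a * (1 - t) ^ j))"
  have "(\<integral>\<^sup>+z. ennreal ((cmod z) ^ (2 * a) * \<delta> z ^ j) \<partial>\<mu>) =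
    (\<integral>\<^sup>+z. ?h ((cmod z)\<^sup>2) * indicator \<D> z \<partial>lborel)"
    by (subst nn_integral_disc_measure)
      (auto simp: power_mult ennreal_mult' intro!: nn_integral_cong)
  also have "\<dots> = ennreal pi * (\<integral>\<^sup>+t. ?h t * indicator {0..1} t \<partial>lborel)"
    by (rule nn_integral_disc_radial) auto
  also have "(\<integral>\<^sup>+t. ?h t * indicator {0..1} t \<partial>lborel) =
    (\<integral>\<^sup>+t. ennreal (t powr (real a + 1 - 1) * (1 - t) powr (\<gamma> + real j + 1 - 1)) * indicator {0..1} t \<partial>lborel)"
  \<comment> \<open>The endpoints are removed because powers and \<open>powr\<close> disagree at
    base zero: \<open>0 ^ 0 = 1\<close> but \<open>0 powr 0 = 0\<close>.\<close>
  proof (rule nn_integral_cong_AE, use AE_lborel_singleton[of "0::real"] AE_lborel_singleton[of "1::real"] in eventually_elim)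
    case (elim t)
    then show ?case
      by (auto simp: powr_add powr_realpow mult_ac split: split_indicator)
  qed
  also have "\<dots> = ennreal (Beta (real a + 1) (\<gamma> + real j + 1))"
    using \<gamma> by (intro nn_integral_Beta) auto
  finally show ?thesis by (simp add: ennreal_mult')
qed

lemma finite_measure_disc_measure:
  "finite_measure \<mu>"
  by (rule finite_measureI) (use nn_integral_disc_moment[of 0 0] in simp)

lemma has_bochner_integral_disc_moment:
  "has_bochner_integral \<mu>
    (\<lambda>z. complex_of_real ((cmod z) ^ (2 * a) * \<delta> z ^ j))
    (complex_of_real (pi * Beta (real a + 1) (\<gamma> + real j + 1)))"
proof (rule has_bochner_integral_of_real, rule has_bochner_integral_nn_integral)
  show "(\<lambda>z. (cmod z) ^ (2 * a) * \<delta> z ^ j) \<in> \<M>"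
    by (rule borel_imp_disc_measurable) auto
  show "AE z in \<mu>. 0 \<le> (cmod z) ^ (2 * a) * \<delta> z ^ j"
    by (rule AE_I2) (simp add: power_le_one abs_square_le_1)
  show "0 \<le> pi * Beta (real a + 1) (\<gamma> + real j + 1)"
    using \<gamma> by (simp add: Beta_def)
  show "(\<integral>\<^sup>+z. ennreal ((cmod z) ^ (2 * a) * \<delta> z ^ j) \<partial>\<mu>) =
    ennreal (pi * Beta (real a + 1) (\<gamma> + real j + 1))"
    by (rule nn_integral_disc_moment)
qed

lemma integrable_disc_measure_bounded:
  fixes f :: "complex \<Rightarrow> 'a :: {banach, second_countable_topology}"
  assumes "f \<in> \<M>" "\<And>z. z \<in> \<D> \<Longrightarrow> norm (f z) \<le> B"
  shows "integrable \<mu> f"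
proof -
  interpret finite_measure \<mu> by (rule finite_measure_disc_measure)
  show ?thesis by (rule integrable_const_bound[of _ B]) (use assms in auto)
qed

lemma L2_disc_bounded:
  assumes "f \<in> \<M>" "\<And>z. z \<in> \<D> \<Longrightarrow> cmod (f z) \<le> B"
  shows "f \<in> L2"
proof -
  have "integrable \<mu> (\<lambda>z. (cmod (f z))\<^sup>2)"
    by (rule integrable_disc_measure_bounded[of _ "B\<^sup>2"])
      (use assms in \<open>auto intro!: power_mono\<close>)
  then show ?thesis using assms by (simp add: L2_disc_def)
qed

lemma L2_disc_continuous:
  assumes "continuous_on UNIV f"
  shows "f \<in> L2"
proof -
  have "compact (f ` cball 0 1)"
    by (intro compact_continuous_image continuous_on_subset[OF assms(1)]) auto
  then obtain B where "\<And>z. z \<in> cball 0 1 \<Longrightarrow> norm (f z) \<le> B"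
    by (meson bounded_iff compact_imp_bounded image_eqI)
  then show ?thesis
    using assms by (intro L2_disc_bounded[of _ B] borel_imp_disc_measurable)
      (auto intro: borel_measurable_continuous_onI)
qed

lemma integrable_L2_continuous:
  assumes "h \<in> L2" "continuous_on UNIV v"
  shows "integrable \<mu> (\<lambda>z. h z * v z)"
proof -
  have "(\<lambda>z. cnj (v z)) \<in> L2"
    using assms by (intro L2_disc_continuous continuous_intros)
  from L2_disc_integrable_mult[OF assms(1) this] show ?thesis by simp
qed

text \<open>The predicate \<open>ann u\<close> demands annihilation of \<open>u\<close> times every
  monomial, so it is stable under multiplication by \<open>z\<close> and \<open>cnj z\<close>, hence
  by every real polynomial function of the plane. Uniform approximation on the closed disc then
  reaches \<open>v\<close>, since \<open>h\<close> is integrable.\<close>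

lemma L2_annihilates_continuous:
  assumes h: "h \<in> L2"
    and orth: "\<And>a b. ip h (\<lambda>z. z ^ a * cnj z ^ b) = 0"
    and v: "continuous_on UNIV v"
  shows "(LINT z|\<mu>. h z * v z) = 0"
proof -
  define I where "I u a b = (LINT z|\<mu>. h z * (u z * (z ^ a * cnj z ^ b)))" for u a b
  define ann where "ann u \<longleftrightarrow> continuous_on UNIV u \<and> (\<forall>a b. I u a b = 0)" for u
  note int = integrable_L2_continuous[OF h]
  have ann_lincomb: "ann (\<lambda>z. c * u z + d * v z)" if "ann u" "ann v" for u v c d
  proof -
    have cont: "continuous_on UNIV u" "continuous_on UNIV v" using that by (auto simp: ann_def)
    have "I (\<lambda>z. c * u z + d * v z) a b = c * I u a b + d * I v a b" for a b
    proof -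
      have "I (\<lambda>z. c * u z + d * v z) a b =
          (LINT z|\<mu>. c * (h z * (u z * (z ^ a * cnj z ^ b))) + d * (h z * (v z * (z ^ a * cnj z ^ b))))"
        by (simp add: I_def algebra_simps)
      also have "\<dots> = c * I u a b + d * I v a b"
        unfolding I_def by (subst Bochner_Integration.integral_add)
          (auto intro!: integrable_mult_right int continuous_intros cont)
      finally show ?thesis .
    qed
    then show ?thesis using that cont unfolding ann_def by (auto intro!: continuous_intros)
  qed
  have ann_mult_ident: "ann (\<lambda>z. u z * z)" and ann_mult_cnj: "ann (\<lambda>z. u z * cnj z)" if "ann u" for u
  proof -
    have "I (\<lambda>z. u z * z) a b = I u (Suc a) b" "I (\<lambda>z. u z * cnj z) a b = I u a (Suc b)" for a b
      by (simp_all add: I_def mult_ac)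
    then show "ann (\<lambda>z. u z * z)" "ann (\<lambda>z. u z * cnj z)"
      using that unfolding ann_def by (auto intro!: continuous_intros)
  qed
  have ann_poly: "ann (\<lambda>z. u z * of_real (p z))" if "real_polynomial_function p" "ann u" for p u
    using that
  proof (induction arbitrary: u rule: real_polynomial_function.induct)
    case (linear p)
    note bl = linear(1) and u = linear(2)
    interpret bounded_linear p by (rule bl)
    \<comment> \<open>A real-linear functional has the form \<open>c * z + cnj c * cnj z\<close>,
      which reduces it to the two multiplications already handled.\<close>
    define c where "c = (of_real (p 1) - \<i> * of_real (p \<i>)) / 2"
    have "of_real (p z) = c * z + cnj c * cnj z" for z
    proof -
      have "z = Re z *\<^sub>R 1 + Im z *\<^sub>R \<i>" by (simp add: complex_eq_iff)
      then have "p z = p (Re z *\<^sub>R 1 + Im z *\<^sub>R \<i>)" by (rule arg_cong)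
      also have "\<dots> = Re z * p 1 + Im z * p \<i>" unfolding add scaleR by simp
      finally show ?thesis by (simp add: c_def complex_eq_iff field_simps)
    qed
    then have "(\<lambda>z. u z * of_real (p z)) = (\<lambda>z. c * (u z * z) + cnj c * (u z * cnj z))"
      by (auto simp: algebra_simps)
    then show ?case using ann_lincomb[OF ann_mult_ident[OF u] ann_mult_cnj[OF u], of c "cnj c"] by simp
  next
    case (const c)
    then show ?case using ann_lincomb[of u u "of_real c" 0] by (simp add: mult.commute)
  next
    case (add p q)
    then show ?case
      using ann_lincomb[of "\<lambda>z. u z * of_real (p z)" "\<lambda>z. u z * of_real (q z)" 1 1]
      by (simp add: distrib_left)
  next
    case (mult p q)
    have "ann (\<lambda>z. (u z * of_real (p z)) * of_real (q z))"
      using mult by blast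
    then show ?case by (simp add: mult.assoc)
  qed
  have ann1: "ann (\<lambda>z. 1)"
    using orth unfolding L2_inner_def ann_def I_def by (auto simp: mult.commute)
  have poly0: "(LINT z|\<mu>. h z * g z) = 0" if "polynomial_function g" for g :: "complex \<Rightarrow> complex"
  proof -
    have "ann (\<lambda>z. of_real (Re (g z)))" "ann (\<lambda>z. of_real (Im (g z)))"
      using ann_poly[OF _ ann1, of "Re \<circ> g"] ann_poly[OF _ ann1, of "Im \<circ> g"]
        that bounded_linear_Re bounded_linear_Im unfolding polynomial_function_def by (simp_all add: o_def)
    from ann_lincomb[OF this, of 1 \<i>] have "ann g" by (simp flip: complex_eq)
    then have "I g 0 0 = 0" unfolding ann_def by blast
    then show ?thesis by (simp add: I_def)
  qed
  note polyc = continuous_on_polymonial_function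
  have h1: "integrable \<mu> h"
    using int[OF continuous_on_const, of 1] by (simp only: mult_1_right)
  define B where "B = (LINT z|\<mu>. cmod (h z))"
  have "B \<ge> 0" unfolding B_def by (rule Bochner_Integration.integral_nonneg) simp
  have "cmod (LINT z|\<mu>. h z * v z) \<le> e" if "e > 0" for e
  proof -
    \<comment> \<open>The summand \<open>1\<close> keeps the quotient meaningful when
      \<open>B = 0\<close>.\<close>
    define e' where "e' = e / (B + 1)"
    have "e' > 0" using \<open>e > 0\<close> \<open>B \<ge> 0\<close> by (simp add: e'_def)
    obtain g where g: "polynomial_function g" "\<And>z. z \<in> cball 0 1 \<Longrightarrow> cmod (v z - g z) < e'"
      using Stone_Weierstrass_polynomial_function[OF compact_cball continuous_on_subset[OF v] \<open>e' > 0\<close>, of 0 1] by auto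
    have "(LINT z|\<mu>. h z * v z) = (LINT z|\<mu>. h z * (v z - g z))"
      using int[OF v] int[OF polyc[OF g(1)]] by (simp add: right_diff_distrib poly0[OF g(1)])
    also have "cmod \<dots> \<le> (LINT z|\<mu>. cmod (h z * (v z - g z)))"
      by (rule integral_norm_bound)
    also have "\<dots> \<le> (LINT z|\<mu>. e' * cmod (h z))"
    proof (rule integral_mono)
      show "integrable \<mu> (\<lambda>z. cmod (h z * (v z - g z)))"
        by (intro integrable_norm int continuous_intros v polyc g)
      show "integrable \<mu> (\<lambda>z. e' * cmod (h z))"
        by (intro integrable_mult_right integrable_norm h1)
      show "cmod (h z * (v z - g z)) \<le> e' * cmod (h z)" if "z \<in> space \<mu>" for z
        using mult_right_mono[OF less_imp_le[OF g(2)[of z]], of "cmod (h z)"] that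
        by (simp add: norm_mult mult.commute)
    qed
    also have "\<dots> = e' * B" by (simp add: B_def)
    also have "\<dots> \<le> e" using \<open>e > 0\<close> \<open>B \<ge> 0\<close> by (simp add: e'_def field_simps)
    finally show ?thesis .
  qed
  then have "cmod (LINT z|\<mu>. h z * v z) \<le> 0" by (rule field_le_epsilon) simp
  then show ?thesis by simp
qed

text \<open>The bounded function \<open>cnj h / (1 + \<bar>h\<bar>)\<close> is an almost everywhere limit of continuous functions
  bounded by 1, so \<open>h\<close> annihilates it.\<close>

lemma L2_monomials_total:
  assumes h: "h \<in> L2"
    and orth: "\<And>a b. ip h (\<lambda>z. z ^ a * cnj z ^ b) = 0"
  shows "AE z in \<mu>. h z = 0"
proof -
  let ?q = "\<lambda>z. (cmod (h z))\<^sup>2 / (1 + cmod (h z))"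
  define k where "k z = cnj (h z) / of_real (1 + cmod (h z))" for z
  have pos: "0 < 1 + cmod w" for w using norm_ge_zero[of w] by linarith
  have k1: "cmod (k z) \<le> 1" for z
    using pos[of "h z"] by (simp add: k_def norm_divide divide_le_eq del: of_real_add)
  have hm: "h \<in> \<M>" by (rule L2_disc_measurable[OF h])
  have "k \<in> \<M>"
    unfolding k_def
    by (rule borel_measurable_continuous_on[OF _ hm, of "\<lambda>w. cnj w / of_real (1 + cmod w)"])
      (intro continuous_intros ballI, simp only: of_real_eq_0_iff, metis pos less_irrefl)
  then have "k measurable_on \<D>"
    by (simp add: measurable_on_iff_borel_measurable borel_measurable_disc_measure_iff)
  then obtain N g where N: "negligible N" and gc: "\<And>n. continuous_on UNIV (g n)"
    and glim: "\<And>z. z \<notin> N \<Longrightarrow> (\<lambda>n. g n z) \<longlonglongrightarrow> (if z \<in> \<D> then k z else 0)"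
    unfolding measurable_on_def by blast
  \<comment> \<open>Radial retraction onto the closed unit disc: it keeps the approximants
    continuous, lets \<open>|h|\<close> dominate the integrands, and fixes the values of
    \<open>k\<close>.\<close>
  define cl where "cl w = w / of_real (max 1 (cmod w))" for w :: complex
  have clc: "continuous_on UNIV cl"
    unfolding cl_def by (intro continuous_intros) auto
  have cl1: "cmod (cl w) \<le> 1" for w
    by (simp add: cl_def norm_divide divide_le_eq max_def)
  have clk: "cl (k z) = k z" for z using k1[of z] by (simp add: cl_def max_def)
  have Gc: "continuous_on UNIV (\<lambda>z. cl (g n z))" for n
    by (rule continuous_on_compose2[OF clc gc]) simp
  have lim: "(\<lambda>n. LINT z|\<mu>. h z * cl (g n z)) \<longlonglongrightarrow> (LINT z|\<mu>. h z * k z)"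
  proof (rule integral_dominated_convergence)
    show "integrable \<mu> (\<lambda>z. cmod (h z))"
      using integrable_L2_continuous[OF h, of "\<lambda>z. 1"] by (simp add: integrable_norm)
    show "(\<lambda>z. h z * k z) \<in> \<M>"
      using hm \<open>k \<in> _\<close> by measurable
    show "(\<lambda>z. h z * cl (g n z)) \<in> \<M>" for n
      using integrable_L2_continuous[OF h Gc] by (rule borel_measurable_integrable)
    show "AE z in \<mu>. norm (h z * cl (g n z)) \<le> cmod (h z)" for n
      using cl1 by (intro AE_I2) (simp add: norm_mult mult_left_le)
    show "AE z in \<mu>. (\<lambda>n. h z * cl (g n z)) \<longlonglongrightarrow> h z * k z"
      using AE_disc_measure_not_in_negligible[OF N] AE_space
    proof eventually_elim
      case (elim z)
      then have "(\<lambda>n. g n z) \<longlonglongrightarrow> k z" using glim[of z] by simp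
      then have "(\<lambda>n. cl (g n z)) \<longlonglongrightarrow> cl (k z)"
        by (rule isCont_tendsto_compose[rotated]) (use clc in \<open>simp add: continuous_on_eq_continuous_at\<close>)
      then show ?case by (intro tendsto_intros) (simp add: clk)
    qed
  qed
  have "(\<lambda>n. LINT z|\<mu>. h z * cl (g n z)) = (\<lambda>n. 0)"
    using L2_annihilates_continuous[OF h orth Gc] by auto
  with lim have 0: "(LINT z|\<mu>. h z * k z) = 0"
    using LIMSEQ_unique[OF _ tendsto_const[of "0::complex" sequentially]] by simp
  \<comment> \<open>The product is nonnegative and vanishes only where \<open>h\<close> does, so a
    zero integral settles the claim.\<close>
  have hk: "h z * k z = of_real (?q z)" for z
    by (simp only: k_def of_real_divide times_divide_eq_right complex_norm_square)
  have int: "integrable \<mu> (\<lambda>z. ?q z)"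
  proof (rule Bochner_Integration.integrable_bound[OF L2_disc_integrable[OF h]])
    show "(\<lambda>z. ?q z) \<in> \<M>"
      using hm by measurable
    show "AE z in \<mu>. norm (?q z) \<le> norm ((cmod (h z))\<^sup>2)"
      using pos by (intro AE_I2) (simp add: divide_le_eq distrib_left less_imp_not_less)
  qed
  have "(LINT z|\<mu>. ?q z) = 0"
    using 0 unfolding hk by (simp only: integral_complex_of_real of_real_eq_0_iff)
  then have "AE z in \<mu>. ?q z = 0"
    by (subst (asm) integral_nonneg_eq_0_iff_AE[OF int]) auto
  then show ?thesis
    by eventually_elim (auto simp: add_nonneg_eq_0_iff)
qed

section \<open>Orthogonality of the disc polynomials\<close>

text \<open>The defining series is in powers of \<open>s\<close> alone. Chu-Vandermonde expands the
  quotient of Pochhammer symbols in its \<open>p\<close>-th coefficient, and \<open>(k choose p) (p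
  choose j) = (k choose j) (k - j choose p - j)\<close> lets the summation over \<open>p\<close>
  collapse to \<open>(1 - s) ^ (k - j)\<close>. At the argument used by \<open>disc_poly\<close>,
  \<open>s\<close> is \<open>\<delta> z\<close>.\<close>

lemma jacobi_eq_sum:
  "jacobi \<gamma> (real d) k (1 - 2 * s) =
    (\<Sum>j\<le>k. (-1) ^ j * fact j * real (k choose j) * real ((k + d) choose j) / poch j
      * s ^ j * (1 - s) ^ (k - j))"
proof -
  let ?t = "\<lambda>j. pochhammer (- real k) j * pochhammer (real k + \<gamma> + real d + 1) j / poch j * (s ^ j / fact j)"
  let ?g = "\<lambda>j i. (-1) ^ (j + i) * s ^ (j + i) * (fact j * real ((k + d) choose j) / poch j) *
      (real (k choose j) * real ((k - j) choose i))"
  have "jacobi \<gamma> (real d) k (1 - 2 * s) = (\<Sum>j. ?t j)"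
    by (simp add: jacobi_def hyp2F1_def)
  also have "\<dots> = (\<Sum>j\<le>k. ?t j)"
    by (rule suminf_finite) (auto simp: pochhammer_of_nat_eq_0_iff)
  also have "\<dots> = (\<Sum>p\<le>k. (-1) ^ p * real (k choose p) * s ^ p *
      (\<Sum>j\<le>p. fact j * real (p choose j) * real ((k + d) choose j) / poch j))"
  proof (rule sum.cong[OF refl])
    fix p assume "p \<in> {..k}"
    have "real (k choose p) = (-1) ^ p * pochhammer (- real k) p / fact p"
      by (simp add: binomial_gbinomial gbinomial_pochhammer)
    then have "pochhammer (- real k) p = (-1) ^ p * real (k choose p) * fact p"
      by (simp flip: power_mult_distrib)
    then show "?t p = (-1) ^ p * real (k choose p) * s ^ p *
      (\<Sum>j\<le>p. fact j * real (p choose j) * real ((k + d) choose j) / poch j)"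
      unfolding sum_choose_pochhammer[OF gamma_pos] by (simp add: algebra_simps)
  qed
  also have "\<dots> = (\<Sum>p\<le>k. \<Sum>j\<le>p. ?g j (p - j))"
  proof (intro sum.cong[OF refl], unfold sum_distrib_left, intro sum.cong[OF refl])
    fix p j assume "p \<in> {..k}" "j \<in> {..p}"
    then have "real (k choose p) * real (p choose j) = real (k choose j) * real ((k - j) choose (p - j))"
        and p: "j + (p - j) = p"
      using choose_mult[of j p k] by (simp_all flip: of_nat_mult)
    then show "(- 1) ^ p * real (k choose p) * s ^ p * (fact j * real (p choose j) * real ((k + d) choose j) / poch j) =
      ?g j (p - j)"
      unfolding p by (simp add: mult_ac)
  qed
  also have "\<dots> = (\<Sum>(j,i)\<in>{(j,i). j + i \<le> k}. ?g j i)"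
    by (rule sum.triangle_reindex_eq[symmetric])
  also have "{(j,i). j + i \<le> k} = Sigma {..k} (\<lambda>j. {..k - j})" by auto
  also have "(\<Sum>(j,i)\<in>Sigma {..k} (\<lambda>j. {..k - j}). ?g j i) = (\<Sum>j\<le>k. \<Sum>i\<le>k - j. ?g j i)"
    by (rule sum.Sigma[symmetric]) auto
  also have "\<dots> = (\<Sum>j\<le>k. (-1) ^ j * fact j * real (k choose j) * real ((k + d) choose j) / poch j
      * s ^ j * (1 - s) ^ (k - j))"
  proof (rule sum.cong[OF refl])
    fix j
    have "(1 - s) ^ (k - j) = (\<Sum>i\<le>k - j. real ((k - j) choose i) * ((- 1) ^ i * s ^ i))"
      using binomial_ring[of "- s" 1 "k - j"] by (simp add: power_minus[of s])
    then show "(\<Sum>i\<le>k - j. ?g j i) = (-1) ^ j * fact j * real (k choose j) * real ((k + d) choose j) / poch j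
      * s ^ j * (1 - s) ^ (k - j)"
      by (simp only: sum_distrib_left) (simp add: power_add mult_ac)
  qed
  finally show ?thesis .
qed

text \<open>The powers of \<open>|z|^2 = z * cnj z\<close> left by the Jacobi polynomial are
  absorbed into the monomial prefactor, which removes the distinction between \<open>m <= n\<close>
  and \<open>n <= m\<close>.\<close>

lemma disc_poly_eq_sum:
  "R m n z = (\<Sum>j\<le>n. of_real (disc_coeff m n j) * of_real (\<delta> z ^ j) * z ^ (m - j) * cnj z ^ (n - j))"
proof -
  define t where "t = (cmod z)\<^sup>2"
  define k d where "k = min m n" and "d = max m n - k"
  have t: "complex_of_real t = z * cnj z" by (simp only: t_def complex_norm_square)
  have *: "z ^ (m - k) * cnj z ^ (n - k) * of_real (t ^ (k - j)) = z ^ (m - j) * cnj z ^ (n - j)" if "j \<le> k" for j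
  proof -
    have "m - j = (m - k) + (k - j)" "n - j = (n - k) + (k - j)" using that by (auto simp: k_def)
    then show ?thesis by (simp add: t power_add power_mult_distrib mult_ac)
  qed
  have "jacobi \<gamma> (real d) k (1 - 2 * (1 - t)) = (\<Sum>j\<le>k. disc_coeff m n j * (1 - t) ^ j * t ^ (k - j))"
    unfolding jacobi_eq_sum disc_coeff_def by (cases "n \<le> m") (simp_all add: k_def d_def mult_ac)
  moreover have "\<bar>real m - real n\<bar> = real d" by (auto simp: k_def d_def)
  ultimately have "R m n z = z ^ (m - k) * cnj z ^ (n - k) *
      of_real (\<Sum>j\<le>k. disc_coeff m n j * (1 - t) ^ j * t ^ (k - j))"
    unfolding disc_poly_def t_def[symmetric] k_def[symmetric] by simp
  also have "\<dots> = (\<Sum>j\<le>k. of_real (disc_coeff m n j) * of_real ((1 - t) ^ j) *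
      (z ^ (m - k) * cnj z ^ (n - k) * of_real (t ^ (k - j))))"
    by (simp add: sum_distrib_left mult_ac)
  also have "\<dots> = (\<Sum>j\<le>k. of_real (disc_coeff m n j) * of_real ((1 - t) ^ j) * z ^ (m - j) * cnj z ^ (n - j))"
    by (intro sum.cong refl) (simp only: * atMost_iff, simp only: mult.assoc)
  also have "\<dots> = (\<Sum>j\<le>n. of_real (disc_coeff m n j) * of_real ((1 - t) ^ j) * z ^ (m - j) * cnj z ^ (n - j))"
    by (rule sum.mono_neutral_left) (auto simp: disc_coeff_def k_def)
  finally show ?thesis by (simp only: t_def)
qed

lemma disc_poly_eq_double_sum:
  "R m n z = (\<Sum>j\<le>n. \<Sum>i\<le>j. of_real (disc_coeff m n j * real (j choose i) * (-1) ^ i) *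
    (z ^ (m - j + i) * cnj z ^ (n - j + i)))"
proof -
  have "of_real (\<delta> z ^ j) = (\<Sum>i\<le>j. of_real (real (j choose i) * (-1) ^ i) * (z ^ i * cnj z ^ i))" for j
  proof -
    have "complex_of_real (\<delta> z) = - (z * cnj z) + 1"
      by (simp only: of_real_diff complex_norm_square) simp
    then have "complex_of_real (\<delta> z ^ j) = (- (z * cnj z) + 1) ^ j"
      by (simp only: of_real_power)
    also have "\<dots> = (\<Sum>i\<le>j. of_nat (j choose i) * (- (z * cnj z)) ^ i * 1 ^ (j - i))"
      by (rule binomial_ring)
    also have "\<dots> = (\<Sum>i\<le>j. of_real (real (j choose i) * (-1) ^ i) * (z ^ i * cnj z ^ i))"
      by (simp add: power_minus[of "z * cnj z"] power_mult_distrib mult_ac)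
    finally show ?thesis .
  qed
  then show ?thesis
    unfolding disc_poly_eq_sum
    by (simp only: sum_distrib_left sum_distrib_right power_add of_real_mult) (simp add: mult_ac)
qed

lemma continuous_on_disc_poly:
  "continuous_on S (R m n)"
  unfolding disc_poly_eq_sum[abs_def] by (intro continuous_intros)

lemma disc_poly_L2: "R m n \<in> L2"
  by (simp add: L2_disc_continuous continuous_on_disc_poly)

lemma monomial_L2: "(\<lambda>z. z ^ a * cnj z ^ b) \<in> L2"
  by (intro L2_disc_continuous continuous_intros)

lemma L2_inner_disc_poly_monomial_phase:
  assumes "m + b \<noteq> n + a"
  shows "ip (R m n) (\<lambda>z. z ^ a * cnj z ^ b) = 0"
  unfolding L2_inner_def
proof (rule integral_disc_measure_phase_eq_0[OF _ assms(1)])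
  show "(\<lambda>z. R m n z * cnj (z ^ a * cnj z ^ b)) \<in> borel_measurable borel"
    by (intro borel_measurable_continuous_onI continuous_intros continuous_on_disc_poly)
qed (simp add: disc_poly_rotate power_mult_distrib power_add mult_ac)

text \<open>With matching phases the integrand is radial and each term is a Beta integral. Its
  factor \<open>poch j\<close> cancels the one in \<open>disc_coeff\<close>, and the remaining
  denominator is free of \<open>j\<close>; what is left is an alternating binomial sum, whose
  vanishing for \<open>b < n\<close> is the source of all orthogonality.\<close>

lemma L2_inner_disc_poly_monomial:
  assumes ab: "m + b = n + a"
  shows "ip (R m n) (\<lambda>z. z ^ a * cnj z ^ b) =
    of_real (pi * fact m * fact b / poch (m + b + 1) *
      (if n \<le> b then real ((m + b - n) choose (b - n)) else 0))"
proof -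
  let ?P = "pi * fact m * fact b / poch (m + b + 1)"
  let ?B = "\<lambda>j. pi * Beta (real (m + b - j) + 1) (\<gamma> + 1 + real j)"
  let ?f = "\<lambda>j z. of_real (disc_coeff m n j) * of_real (cmod z ^ (2 * (m + b - j)) * \<delta> z ^ j) :: complex"
  have integrand: "R m n z * cnj (z ^ a * cnj z ^ b) = (\<Sum>j\<le>n. ?f j z)" for z
  proof -
    have "of_real (disc_coeff m n j) * of_real (\<delta> z ^ j) * z ^ (m - j) * cnj z ^ (n - j) * cnj (z ^ a * cnj z ^ b)
      = ?f j z" if "j \<le> n" for j
    proof (cases "j \<le> m")
      case True
      have "z ^ (m - j) * cnj z ^ (n - j) * cnj (z ^ a * cnj z ^ b) = z ^ (m - j + b) * cnj z ^ (n - j + a)"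
        by (simp add: power_add mult_ac)
      also have "m - j + b = m + b - j" using True by simp
      also have "n - j + a = m + b - j" using that ab by simp
      also have "z ^ (m + b - j) * cnj z ^ (m + b - j) = of_real (cmod z ^ (2 * (m + b - j)))"
        unfolding power_mult of_real_power[of "(cmod z)\<^sup>2"] complex_norm_square
        by (simp add: power_mult_distrib)
      finally show ?thesis by (simp add: mult_ac)
    next
      case False
      then show ?thesis by (simp add: disc_coeff_def)
    qed
    then show ?thesis
      unfolding disc_poly_eq_sum sum_distrib_right by (intro sum.cong) auto
  qed
  have "has_bochner_integral \<mu> (\<lambda>z. \<Sum>j\<le>n. ?f j z)
      (\<Sum>j\<le>n. of_real (disc_coeff m n j) * of_real (pi * Beta (real (m + b - j) + 1) (\<gamma> + real j + 1)))"
    by (intro has_bochner_integral_sum has_bochner_integral_mult_right has_bochner_integral_disc_moment \<gamma>)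
  then have "ip (R m n) (\<lambda>z. z ^ a * cnj z ^ b) =
      (\<Sum>j\<le>n. of_real (disc_coeff m n j) * of_real (pi * Beta (real (m + b - j) + 1) (\<gamma> + real j + 1)))"
    unfolding L2_inner_def integrand by (rule has_bochner_integral_integral_eq)
  also have "\<dots> = of_real (\<Sum>j\<le>n. disc_coeff m n j * (?B j))"
    by (simp add: add_ac)
  also have "(\<Sum>j\<le>n. disc_coeff m n j * (?B j)) =
      (\<Sum>j\<le>n. ?P *
        ((-1) ^ j * real (n choose j) * real ((m + b - j) choose b)))"
  proof (rule sum.cong[OF refl])
    fix j assume "j \<in> {..n}"
    then have j: "j \<le> n" by simp
    have pos: "poch j > 0" using gamma_pos by (rule pochhammer_pos)
    show "disc_coeff m n j * (?B j) =
      ?P *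
        ((-1) ^ j * real (n choose j) * real ((m + b - j) choose b))"
    proof (cases "j \<le> m")
      case True
      have 1: "fact j * real (m choose j) = fact m / fact (m - j)"
        using True by (simp add: binomial_fact)
      have 2: "real ((m + b - j) choose b) = fact (m + b - j) / (fact b * fact (m - j))"
        using True by (subst binomial_fact) auto
      have "m + b - j + j + 1 = m + b + 1" using True by simp
      then have "Beta (real (m + b - j) + 1) (\<gamma> + 1 + real j) =
          fact (m + b - j) * poch j / poch (m + b + 1)"
        using Beta_nat_shift[OF gamma_pos, of "m + b - j" j] by (simp only:)
      then have "disc_coeff m n j * (?B j) =
          (-1) ^ j * real (n choose j) * (fact j * real (m choose j)) * pi * fact (m + b - j) / poch (m + b + 1)"
        using pos by (simp add: disc_coeff_def)
      then show ?thesis unfolding 1 2 by (simp add: mult_ac)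
    next
      case False
      \<comment> \<open>For \<open>j > m\<close> both sides are zero, the left one through
        \<open>disc_coeff\<close>. If \<open>b = 0\<close>, then \<open>j <= n <= m\<close> excludes
        this case.\<close>
      then have "m + b - j < b" using j ab by (cases "b = 0") auto
      then show ?thesis using False by (simp add: disc_coeff_def binomial_eq_0)
    qed
  qed
  also have "\<dots> = ?P *
      (\<Sum>j\<le>n. (-1) ^ j * real (n choose j) * real ((m + b - j) choose b))"
    by (simp only: sum_distrib_left)
  also have "(\<Sum>j\<le>n. (-1) ^ j * real (n choose j) * real ((m + b - j) choose b)) =
      (if n \<le> b then real ((m + b - n) choose (b - n)) else 0)"
    by (rule alternating_choose_sum) (use ab in simp)
  finally show ?thesis .
qed

lemma L2_inner_disc_poly_monomial_less:
  assumes "b < n"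
  shows "ip (R m n) (\<lambda>z. z ^ a * cnj z ^ b) = 0"
  using assms L2_inner_disc_poly_monomial[of m b n a] L2_inner_disc_poly_monomial_phase[of m b n a]
  by (cases "m + b = n + a") auto

lemma L2_inner_disc_poly_double_sum:
  assumes f: "f \<in> L2"
  shows "ip f (R p q) =
    (\<Sum>j\<le>q. \<Sum>i\<le>j. of_real (disc_coeff p q j * real (j choose i) * (-1) ^ i) *
      ip f (\<lambda>z. z ^ (p - j + i) * cnj z ^ (q - j + i)))"
  unfolding disc_poly_eq_double_sum[abs_def]
  by (simp add: L2_inner_sum_right L2_inner_cmult_right L2_disc_sum L2_disc_cmult monomial_L2 \<gamma> f
      del: of_real_mult)

text \<open>Every monomial of \<open>R p q\<close> has degree at most \<open>q\<close> in
  \<open>cnj z\<close>, which settles \<open>q < n\<close>; conjugate symmetry settles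
  \<open>n < q\<close>. For equal second indices the rotation phases differ.\<close>

lemma L2_inner_disc_poly_orthogonal:
  assumes ne: "(m, n) \<noteq> (p, q)"
  shows "ip (R m n) (R p q) = 0"
proof -
  have less: "ip (R m n) (R p q) = 0" if "q < n" for m n p q
    unfolding L2_inner_disc_poly_double_sum[OF disc_poly_L2]
    using that by (intro sum.neutral ballI) (simp add: L2_inner_disc_poly_monomial_less)
  have same: "ip (R m n) (R p n) = 0" if "m \<noteq> p"
    unfolding L2_inner_disc_poly_double_sum[OF disc_poly_L2]
  proof (intro sum.neutral ballI)
    fix j i assume "j \<in> {..n}" "i \<in> {..j}"
    then have "m + (n - j + i) = n + (p - j + i) \<Longrightarrow> j \<le> p \<Longrightarrow> False" using that by simp
    then show "of_real (disc_coeff p n j * real (j choose i) * (- 1) ^ i) *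
        ip (R m n) (\<lambda>z. z ^ (p - j + i) * cnj z ^ (n - j + i)) = 0"
      using L2_inner_disc_poly_monomial_phase[of m "n - j + i" n "p - j + i"]
      by (cases "j \<le> p") (auto simp: disc_coeff_def)
  qed
  consider "q < n" | "n < q" | "n = q" "m \<noteq> p" using ne by force
  then show ?thesis
    using less[of q n m p] less[of n q p m] same L2_inner_commute[of "R m n" "R p q"]
    by cases auto
qed

text \<open>If \<open>h\<close> is orthogonal to all \<open>z ^ i * cnj z ^ k\<close> with \<open>k < b\<close>, only the leading monomial
  of \<open>disc_poly\<close> contributes; its coefficient is a Chu-Vandermonde sum.\<close>

lemma L2_inner_disc_poly_leading:
  assumes h: "h \<in> L2" and low: "\<And>i k. k < b \<Longrightarrow> ip h (\<lambda>z. z ^ i * cnj z ^ k) = 0"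
  shows "ip h (R a b) = of_real (pochhammer (\<gamma> + 1 + real a) b / poch b) *
    ip h (\<lambda>z. z ^ a * cnj z ^ b)"
proof -
  let ?w = "\<lambda>j. fact j * real (b choose j) * real (a choose j) / poch j"
  let ?I = "ip h (\<lambda>z. z ^ a * cnj z ^ b)"
  have "ip h (R a b) = (\<Sum>j\<le>b. of_real (?w j) * ?I)"
    unfolding L2_inner_disc_poly_double_sum[OF h]
  proof (rule sum.cong[OF refl])
    fix j assume "j \<in> {..b}"
    then have j: "j \<le> b" by simp
    let ?t = "\<lambda>i. of_real (disc_coeff a b j * real (j choose i) * (-1) ^ i) *
      ip h (\<lambda>z. z ^ (a - j + i) * cnj z ^ (b - j + i))"
    have "(\<Sum>i\<le>j. ?t i) = (\<Sum>i\<in>{j}. ?t i)"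
    proof (rule sum.mono_neutral_right)
      show "\<forall>i\<in>{..j} - {j}. ?t i = 0"
      proof
        fix i assume "i \<in> {..j} - {j}"
        then have "b - j + i < b" using j by auto
        then show "?t i = 0" by (simp only: low mult_zero_right)
      qed
    qed auto
    also have "\<dots> = of_real (disc_coeff a b j * (-1) ^ j) * ip h (\<lambda>z. z ^ (a - j + j) * cnj z ^ b)"
      using j by simp
    also have "\<dots> = of_real (disc_coeff a b j * (-1) ^ j) * ?I"
      by (cases "j \<le> a") (simp_all add: disc_coeff_def binomial_eq_0)
    also have "disc_coeff a b j * (-1) ^ j = ?w j"
      by (simp add: disc_coeff_def mult_ac flip: power_mult_distrib)
    finally show "(\<Sum>i\<le>j. ?t i) = of_real (?w j) * ?I" .
  qed
  also have "\<dots> = of_real (\<Sum>j\<le>b. ?w j) * ?I" by (simp only: sum_distrib_right of_real_sum)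
  finally show ?thesis unfolding sum_choose_pochhammer[OF gamma_pos] .
qed

text \<open>\<open>R m n\<close> is orthogonal to all monomials with fewer than \<open>n\<close>
  factors \<open>cnj z\<close>, so its squared norm is its leading coefficient times the inner
  product with \<open>z ^ m * cnj z ^ n\<close>.\<close>

lemma L2_norm_disc_poly:
  "(nrm (R m n))\<^sup>2 =
    pi * fact m * fact n / ((\<gamma> + real m + real n + 1) * poch m * poch n)"
proof -
  let ?M = "pi * fact m * fact n / poch (m + n + 1)"
  have "ip (R m n) (\<lambda>z. z ^ m * cnj z ^ n) = of_real ?M"
    using L2_inner_disc_poly_monomial[of m n n m] by (simp add: add.commute)
  then have "complex_of_real ((nrm (R m n))\<^sup>2) =
      of_real (pochhammer (\<gamma> + 1 + real m) n / poch n * ?M)"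
    using L2_inner_disc_poly_leading[where h="R m n" and b=n and a=m, OF disc_poly_L2 L2_inner_disc_poly_monomial_less]
    by (simp only: L2_inner_self of_real_mult)
  then have "(nrm (R m n))\<^sup>2 = pochhammer (\<gamma> + 1 + real m) n / poch n * ?M"
    by (simp only: of_real_eq_iff)
  moreover have "poch (m + n + 1) =
      poch m * pochhammer (\<gamma> + 1 + real m) n * (\<gamma> + real m + real n + 1)"
    by (simp add: pochhammer_Suc pochhammer_product'[of _ m n] algebra_simps)
  moreover have "pochhammer (\<gamma> + 1 + real m) n > 0" using gamma_pos by (intro pochhammer_pos) simp
  ultimately show ?thesis by (simp add: mult_ac)
qed

lemma L2_norm_disc_poly_pos:
  "nrm (R m n) > 0"
proof -
  have "(nrm (R m n))\<^sup>2 > 0"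
    unfolding L2_norm_disc_poly using gamma_pos
    by (intro divide_pos_pos mult_pos_pos pochhammer_pos) (auto simp: add_pos_nonneg)
  then show ?thesis using L2_norm_nonneg[of "R m n"] by (simp add: less_le)
qed

section \<open>Expansions in disc polynomials\<close>

text \<open>Summing \<open>c m * R m n\<close> over \<open>m\<close> replaces the powers of \<open>z\<close> in
  \<open>disc_poly\<close> by the derivatives of the power series with coefficients \<open>c\<close>.\<close>

lemma disc_poly_series:
  assumes c: "\<And>z. cmod z < 1 \<Longrightarrow> summable (\<lambda>n. c n * z ^ n)" and z: "cmod z < 1"
  shows "(\<lambda>m. c m * R m n z) sums
    (\<Sum>j\<le>n. of_real ((-1) ^ j * real (n choose j) / poch j * \<delta> z ^ j) *
      cnj z ^ (n - j) * (\<Sum>p. (diffs ^^ j) c p * z ^ p))"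
proof -
  have "(\<lambda>m. \<Sum>j\<le>n. of_real ((-1) ^ j * real (n choose j) / poch j * \<delta> z ^ j) *
      cnj z ^ (n - j) * (c m * of_nat (fact j * (m choose j)) * z ^ (m - j))) sums
    (\<Sum>j\<le>n. of_real ((-1) ^ j * real (n choose j) / poch j * \<delta> z ^ j) *
      cnj z ^ (n - j) * (\<Sum>p. (diffs ^^ j) c p * z ^ p))"
    by (intro sums_sum sums_mult sums_funpow_diffs c z)
  then show ?thesis
    unfolding disc_poly_eq_sum sum_distrib_left by (simp add: disc_coeff_def mult_ac)
qed

lemma polyanalytic_disc_poly_series:
  assumes c: "\<And>z. cmod z < 1 \<Longrightarrow> summable (\<lambda>n. c n * z ^ n)"
  shows "polyanalytic (Suc n) (\<lambda>z. \<Sum>m. c m * R m n z)"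
proof -
  have "polyanalytic (Suc n) (\<lambda>z. of_real ((-1) ^ j * real (n choose j) / poch j) *
      (of_real (\<delta> z ^ j) * cnj z ^ (n - j) * (\<Sum>p. (diffs ^^ j) c p * z ^ p)))" if "j \<le> n" for j
  proof -
    have "(\<lambda>z. \<Sum>p. (diffs ^^ j) c p * z ^ p) holomorphic_on \<D>"
      using has_field_derivative_diffs_disc[OF c]
      by (intro holomorphic_onI) (auto simp: field_differentiable_def intro: has_field_derivative_at_within)
    from polyanalytic_weight_term[OF this, of "n - j" j] show ?thesis
      using that by (intro polyanalytic_cmult) simp
  qed
  then have "polyanalytic (Suc n) (\<lambda>z. \<Sum>j\<le>n. of_real ((-1) ^ j * real (n choose j) / poch j) *
      (of_real (\<delta> z ^ j) * cnj z ^ (n - j) * (\<Sum>p. (diffs ^^ j) c p * z ^ p)))"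
    by (intro polyanalytic_sum) auto
  then show ?thesis
    by (rule polyanalytic_cong[THEN iffD1, rotated])
      (simp add: sums_unique[OF disc_poly_series[OF c], symmetric] mult.assoc)
qed

text \<open>The Leibniz expansion and the series of disc polynomials involve the same derivatives of
  the same power series; only constants have to be compared, using \<open>(- (\<gamma> + n))_{n-j} =
  (-1)^(n-j) (\<gamma> + 1 + j)_{n-j}\<close> and splitting \<open>poch n\<close> at
  \<open>j\<close>.\<close>

lemma disc_poly_Rodrigues:
  fixes c :: "nat \<Rightarrow> complex"
  assumes c: "\<And>z. cmod z < 1 \<Longrightarrow> summable (\<lambda>n. c n * z ^ n)" and z: "cmod z < 1"
  shows "(wirtinger ^^ n) (\<lambda>z. of_real (\<delta> z powr (\<gamma> + real n)) * (\<Sum>m. c m * z ^ m)) z =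
    of_real ((-1) ^ n * poch n * \<delta> z powr \<gamma>) * (\<Sum>m. c m * R m n z)"
proof -
  let ?K = "(-1) ^ n * poch n * \<delta> z powr \<gamma>"
    and ?b = "\<lambda>j. (-1) ^ j * real (n choose j) / poch j * \<delta> z ^ j"
    and ?D = "\<lambda>j. \<Sum>p. (diffs ^^ j) c p * z ^ p"
  have pos: "0 < \<delta> z" using z by (simp add: abs_square_less_1)
  have "of_nat (n choose j) * weighted_term (\<gamma> + real n) c (n - j) j z =
    of_real ?K *
    (of_real (?b j) *
      cnj z ^ (n - j) * ?D j)" if "j \<le> n" for j
  proof -
    have 1: "pochhammer (- (\<gamma> + real n)) (n - j) = (-1) ^ (n - j) * pochhammer (\<gamma> + 1 + real j) (n - j)"
    proof -
      have "\<gamma> + real n - of_nat (n - j) + 1 = \<gamma> + 1 + real j" using that by (simp add: of_nat_diff)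
      then show ?thesis by (simp only: pochhammer_minus)
    qed
    have 2: "poch n = poch j * pochhammer (\<gamma> + 1 + real j) (n - j)"
      using that by (rule pochhammer_product)
    have "(-1::real) ^ n = (-1) ^ (n - j) * (-1) ^ j"
      using that by (simp flip: power_add)
    then have 3: "(-1::real) ^ (n - j) = (-1) ^ n * (-1) ^ j"
      by (simp add: mult.assoc flip: power_mult_distrib)
    have "\<gamma> + real n - real (n - j) = \<gamma> + real j" using that by (simp add: of_nat_diff)
    then have 4: "\<delta> z powr (\<gamma> + real n - real (n - j)) = \<delta> z powr \<gamma> * \<delta> z ^ j"
      using pos by (simp add: powr_add powr_realpow)
    have "poch j > 0" using gamma_pos by (rule pochhammer_pos)
    then have "real (n choose j) * (pochhammer (- (\<gamma> + real n)) (n - j) * \<delta> z powr (\<gamma> + real n - real (n - j))) =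
      ?K * ?b j"
      unfolding 1 2 3 4 by simp
    note eq = this
    have "of_nat (n choose j) * weighted_term (\<gamma> + real n) c (n - j) j z =
      of_real (real (n choose j) * (pochhammer (- (\<gamma> + real n)) (n - j) * \<delta> z powr (\<gamma> + real n - real (n - j)))) *
      cnj z ^ (n - j) * ?D j"
      by (simp only: weighted_term_def of_real_mult of_real_of_nat_eq mult.assoc)
    then show ?thesis unfolding eq by (simp only: of_real_mult mult.assoc)
  qed
  then have "(\<Sum>j\<le>n. of_nat (n choose j) * weighted_term (\<gamma> + real n) c (n - j) j z) =
    of_real ?K *
    (\<Sum>j\<le>n. of_real (?b j) *
      cnj z ^ (n - j) * ?D j)"
    unfolding sum_distrib_left by (intro sum.cong) auto
  also have "(\<Sum>j\<le>n. of_real (?b j) *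
      cnj z ^ (n - j) * ?D j) = (\<Sum>m. c m * R m n z)"
    by (rule sums_unique[OF disc_poly_series[OF c z]])
  finally show ?thesis
    using funpow_wirtinger_weighted_series[of c z n "\<gamma> + real n", OF c z] by (simp only:)
qed

lemma disc_poly_Rodrigues_cnj:
  fixes c :: "nat \<Rightarrow> complex"
  assumes c: "\<And>z. cmod z < 1 \<Longrightarrow> summable (\<lambda>n. c n * z ^ n)" and z: "cmod z < 1"
  shows "(wirtinger_bar ^^ n) (\<lambda>z. of_real (\<delta> z powr (\<gamma> + real n)) * cnj (\<Sum>m. c m * z ^ m)) z =
    of_real ((-1) ^ n * poch n * \<delta> z powr \<gamma>) * cnj (\<Sum>m. c m * R m n z)"
  using funpow_wirtinger_bar_eq_cnj[OF funpow_wirtinger_weighted_series_differentiable[OF c], of n z "\<gamma> + real n"] z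
    disc_poly_Rodrigues[OF c z, of n]
  by simp

lemma summable_power_over_norm_square_disc_poly:
  assumes r: "0 \<le> r" "r < 1"
  shows "summable (\<lambda>m. r ^ m / (nrm (R m n))\<^sup>2)"
proof -
  define a where "a m = (\<gamma> + real m + real n + 1) * poch m / fact m * r ^ m" for m
  \<comment> \<open>Quotient of consecutive values of \<open>1 / (nrm (R m n))^2\<close>. It tends
    to \<open>1\<close>, so the ratio test works with \<open>(1 + r) / 2\<close>, which lies
    strictly between \<open>r\<close> and \<open>1\<close>.\<close>
  define q where "q m = (\<gamma> + real m + real n + 2) * (\<gamma> + 1 + real m) / ((\<gamma> + real m + real n + 1) * (real m + 1))" for m
  have step: "a (Suc m) = r * q m * a m" for m
  proof -
    define A P F where "A = \<gamma> + real m + real n + 1" and "P = poch m" and "F = (fact m :: real)"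
    have "a (Suc m) = (A + 1) * (P * (\<gamma> + 1 + real m)) / ((real m + 1) * F) * (r * r ^ m)"
      by (simp add: a_def A_def P_def F_def pochhammer_Suc add_ac)
    moreover have "q m = (A + 1) * (\<gamma> + 1 + real m) / (A * (real m + 1))" "a m = A * P / F * r ^ m"
      by (simp_all add: q_def a_def A_def P_def F_def)
    moreover have "A \<noteq> 0" "real m + 1 \<noteq> 0" "F \<noteq> 0" using \<gamma> unfolding A_def F_def by (linarith, linarith, simp)
    ultimately show ?thesis by simp
  qed
  have nonneg: "a m \<ge> 0" for m
  proof -
    have "\<gamma> + real m + real n + 1 \<ge> 0" using \<gamma> by linarith
    then show ?thesis using r pochhammer_pos[OF gamma_pos, of m] by (simp add: a_def)
  qed
  have "(\<lambda>m. r * q m) \<longlonglongrightarrow> r * 1"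
    unfolding q_def by (intro tendsto_mult tendsto_const) real_asymp
  then have "\<forall>\<^sub>F m in sequentially. r * q m < (1 + r) / 2"
    by (rule order_tendstoD) (use r in simp)
  then obtain M where M: "\<And>m. m \<ge> M \<Longrightarrow> r * q m < (1 + r) / 2"
    unfolding eventually_sequentially by blast
  have "summable a"
  proof (rule summable_ratio_test)
    show "(1 + r) / 2 < 1" using r by simp
    show "norm (a (Suc m)) \<le> (1 + r) / 2 * norm (a m)" if "m \<ge> M" for m
    proof -
      have "r * q m * a m \<le> (1 + r) / 2 * a m"
        using M[OF that] nonneg by (intro mult_right_mono) auto
      then show ?thesis using nonneg[of m] nonneg[of "Suc m"] step[of m] by simp
    qed
  qed
  then have "summable (\<lambda>m. poch n / (pi * fact n) * a m)" by (rule summable_mult)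
  then show ?thesis
    unfolding L2_norm_disc_poly a_def by (simp add: mult_ac)
qed

text \<open>Reduces to the squared norms and a geometric series by
  \<open>x <= 1 + x^2\<close>.\<close>

lemma summable_power_over_norm_disc_poly:
  assumes r: "0 \<le> r" "r < 1"
  shows "summable (\<lambda>m. r ^ m / nrm (R m n))"
proof (rule summable_comparison_test'[where N=0])
  show "summable (\<lambda>m. r ^ m + r ^ m / (nrm (R m n))\<^sup>2)"
    using r by (intro summable_add summable_geometric summable_power_over_norm_square_disc_poly \<gamma>) auto
  fix m
  define x where "x = 1 / nrm (R m n)"
  have "0 \<le> (x - 1)\<^sup>2" "x \<ge> 0" using L2_norm_disc_poly_pos[of m n] by (simp_all add: x_def)
  then have "x \<le> 1 + x\<^sup>2" unfolding power2_diff by simp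
  then have "r ^ m * x \<le> r ^ m * (1 + x\<^sup>2)" using r by (intro mult_left_mono) auto
  then show "norm (r ^ m / nrm (R m n)) \<le> r ^ m + r ^ m / (nrm (R m n))\<^sup>2"
    using r L2_norm_nonneg[of "R m n"] by (simp add: x_def algebra_simps power_divide)
qed

lemma summable_power_series_bound:
  assumes d: "\<And>m. cmod (d m) \<le> B / nrm (R m n)" and z: "cmod z < 1"
  shows "summable (\<lambda>m. d m * z ^ m)"
proof (rule summable_comparison_test'[where N=0])
  show "summable (\<lambda>m. B * (cmod z ^ m / nrm (R m n)))"
    using z by (intro summable_mult summable_power_over_norm_disc_poly \<gamma>) auto
  show "norm (d m * z ^ m) \<le> B * (cmod z ^ m / nrm (R m n))" for m
    using mult_right_mono[OF d[of m], of "cmod z ^ m"] by (simp add: norm_mult norm_power)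
qed

text \<open>No pointwise bound on \<open>R m n\<close> is used. For the fixed point \<open>z\<close>
  the coefficients are given the phases that make every term at \<open>z\<close> nonnegative, and
  convergence of that particular series is absolute convergence.\<close>

lemma summable_disc_poly_over_norm:
  assumes z: "cmod z < 1"
  shows "summable (\<lambda>m. cmod (R m n z) / nrm (R m n))"
proof -
  define c where "c m = cnj (sgn (R m n z)) / of_real (nrm (R m n))" for m
  have "cmod (c m) \<le> 1 / nrm (R m n)" for m
    using L2_norm_nonneg[of "R m n"] by (simp add: c_def norm_divide norm_sgn)
  then have "\<And>z. cmod z < 1 \<Longrightarrow> summable (\<lambda>m. c m * z ^ m)"
    by (rule summable_power_series_bound)
  from sums_summable[OF disc_poly_series[OF this z]]
  have "summable (\<lambda>m. c m * R m n z)" .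
  moreover have "c m * R m n z = of_real (cmod (R m n z) / nrm (R m n))" for m
  proof -
    have "cnj (sgn w) * w = of_real (cmod w)" for w :: complex
    proof (cases "w = 0")
      case False
      have "cnj (sgn w) * w = (w * cnj w) / of_real (cmod w)"
        by (simp add: sgn_eq mult.commute)
      also have "\<dots> = of_real (cmod w)"
        using False by (simp add: complex_norm_square[symmetric] power2_eq_square)
      finally show ?thesis .
    qed simp
    then show ?thesis by (simp add: c_def)
  qed
  ultimately show ?thesis by (simp only: summable_complex_of_real)
qed

lemma polyanalytic_disc_poly:
  "polyanalytic (Suc n) (R m n)"
proof -
  let ?c = "\<lambda>k. if k = m then 1 else 0 :: complex"
  have "\<And>z. summable (\<lambda>k. ?c k * z ^ k)"
    by (rule summable_finite[of "{m}"]) auto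
  from polyanalytic_disc_poly_series[OF this, of n]
  have "polyanalytic (Suc n) (\<lambda>z. \<Sum>k. ?c k * R k n z)" .
  moreover have "(\<Sum>k. ?c k * R k n z) = R m n z" for z
    by (subst suminf_finite[of "{m}"]) auto
  ultimately show ?thesis by simp
qed

lemma disc_fourier_bound:
  assumes f: "f \<in> L2"
  shows "cmod (disc_fourier n f m) \<le> nrm f / nrm (R m n)"
proof -
  let ?N = "nrm (R m n)"
  have N: "?N > 0" by (rule L2_norm_disc_poly_pos)
  have "cmod (disc_fourier n f m) = cmod (ip f (R m n)) / ?N\<^sup>2"
    by (simp add: disc_fourier_def norm_divide norm_power)
  also have "\<dots> \<le> (nrm f * ?N) / ?N\<^sup>2"
    by (intro divide_right_mono L2_Cauchy_Schwarz f disc_poly_L2 \<gamma>) simp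
  also have "\<dots> = nrm f / ?N" using N by (simp add: power2_eq_square)
  finally show ?thesis .
qed

lemma disc_fourier_summable:
  assumes f: "f \<in> L2" and z: "cmod z < 1"
  shows "summable (\<lambda>m. disc_fourier n f m * z ^ m)"
  using disc_fourier_bound[OF f] z by (rule summable_power_series_bound)

lemma disc_proj_sums:
  assumes f: "f \<in> L2" and z: "z \<in> \<D>"
  shows "(\<lambda>m. disc_fourier n f m * R m n z) sums disc_proj n f z"
  unfolding disc_proj_def
  using disc_poly_series[OF disc_fourier_summable[OF f], of z n] z
  by (intro summable_sums sums_summable) auto

lemma polyanalytic_disc_proj:
  assumes f: "f \<in> L2"
  shows "polyanalytic (Suc n) (disc_proj n f)"
  unfolding disc_proj_def using disc_fourier_summable[OF f]
  by (rule polyanalytic_disc_poly_series)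

lemma disc_fourier_inner:
  "disc_fourier n f m * of_real ((nrm (R m n))\<^sup>2) = ip f (R m n)"
  using L2_norm_disc_poly_pos[of m n] by (simp add: disc_fourier_def)

text \<open>Bessel makes the partial sums Cauchy, and they converge pointwise on the disc; the
  pointwise sum is therefore also their norm limit. The norm bound passes to the limit from Bessel's
  inequality.\<close>

lemma
  assumes f: "f \<in> L2"
  shows disc_proj_L2: "disc_proj n f \<in> L2"
    and disc_proj_tendsto: "L2_tendsto \<gamma> (\<lambda>N z. \<Sum>m<N. disc_fourier n f m * R m n z) (disc_proj n f)"
    and disc_proj_norm_le: "nrm (disc_proj n f) \<le> nrm f"
proof -
  define u where "u m z = disc_fourier n f m * R m n z" for m z
  have u: "u m \<in> L2" for m unfolding u_def by (intro L2_disc_cmult disc_poly_L2 \<gamma>)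
  have orth: "ip (u i) (u j) = 0" if "i \<noteq> j" for i j
    using L2_inner_disc_poly_orthogonal[of i n j n] that
    by (simp add: u_def[abs_def] L2_inner_cmult_left L2_inner_cmult_right)
  have fu: "ip f (u i) = ip (u i) (u i)" for i
    by (simp add: u_def[abs_def] L2_inner_cmult_left L2_inner_cmult_right L2_inner_self
        flip: disc_fourier_inner)
  have S: "(\<lambda>z. \<Sum>m<N. u m z) \<in> L2" for N by (intro L2_disc_sum u)
  have "AE z in \<mu>. (\<lambda>N. \<Sum>m<N. u m z) \<longlonglongrightarrow> disc_proj n f z"
    using disc_proj_sums[OF f] by (intro AE_I2) (simp add: sums_def u_def)
  note lim = L2_Cauchy_pointwise_limit[OF S L2_Bessel(2)[OF u f orth fu]
      polyanalytic_measurable[OF polyanalytic_disc_proj[OF f]] this]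
  show L2: "disc_proj n f \<in> L2" using lim(1) by simp
  show tend: "L2_tendsto \<gamma> (\<lambda>N z. \<Sum>m<N. disc_fourier n f m * R m n z) (disc_proj n f)"
    using lim(2) by (simp add: u_def)
  have "nrm (disc_proj n f) \<le> nrm (\<lambda>z. (\<Sum>m<N. u m z) - disc_proj n f z) + nrm f" for N
  proof -
    have "(nrm (\<lambda>z. \<Sum>m<N. u m z))\<^sup>2 \<le> (nrm f)\<^sup>2"
      using L2_norm_sum_orthogonal[of "{..<N}" u] u orth L2_Bessel(1)[OF u f orth fu, where N=N] by simp
    then have "nrm (\<lambda>z. \<Sum>m<N. u m z) \<le> nrm f"
      by (rule power2_le_imp_le) (rule L2_norm_nonneg)
    moreover have "nrm (disc_proj n f) \<le> nrm (\<lambda>z. disc_proj n f z - (\<Sum>m<N. u m z)) + nrm (\<lambda>z. \<Sum>m<N. u m z)"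
      using L2_norm_triangle[OF L2_disc_diff[OF L2 S[of N]] S[of N]] by simp
    ultimately show ?thesis by (simp add: L2_norm_minus_commute[of "disc_proj n f"])
  qed
  moreover have "(\<lambda>N. nrm (\<lambda>z. (\<Sum>m<N. u m z) - disc_proj n f z) + nrm f) \<longlonglongrightarrow> 0 + nrm f"
    using lim(2) unfolding L2_tendsto_def by (intro tendsto_intros)
  ultimately show "nrm (disc_proj n f) \<le> nrm f"
    by (intro LIMSEQ_le_const[where X="\<lambda>N. nrm (\<lambda>z. (\<Sum>m<N. u m z) - disc_proj n f z) + nrm f"]) auto
qed

lemma disc_proj_inner_sums:
  assumes f: "f \<in> L2" and h: "h \<in> L2"
  shows "(\<lambda>m. disc_fourier n f m * ip (R m n) h) sums ip (disc_proj n f) h"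
proof -
  have "(\<lambda>N. ip (\<lambda>z. \<Sum>m<N. disc_fourier n f m * R m n z) h) \<longlonglongrightarrow> ip (disc_proj n f) h"
    by (intro L2_tendsto_inner L2_disc_sum L2_disc_cmult disc_poly_L2 disc_proj_L2 disc_proj_tendsto f h \<gamma>)
  then show ?thesis
    unfolding sums_def by (simp add: L2_inner_sum_left L2_inner_cmult_left L2_disc_cmult disc_poly_L2 \<gamma> h)
qed

lemma disc_proj_inner_disc_poly:
  assumes f: "f \<in> L2"
  shows "ip (disc_proj n f) (R m k) =
    (if k = n then ip f (R m n) else 0)"
proof -
  let ?a = "\<lambda>j. disc_fourier n f j * ip (R j n) (R m k)"
  have zero: "?a j = 0" if "j \<notin> (if k = n then {m} else {})" for j
    using that L2_inner_disc_poly_orthogonal[of j n m k] by (auto split: if_splits)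
  have "?a sums ip (disc_proj n f) (R m k)"
    by (intro disc_proj_inner_sums f disc_poly_L2 \<gamma>)
  moreover have "?a sums (\<Sum>j\<in>(if k = n then {m} else {}). ?a j)"
    by (rule sums_finite) (use zero in auto)
  ultimately have "ip (disc_proj n f) (R m k) = (\<Sum>j\<in>(if k = n then {m} else {}). ?a j)"
    by (rule sums_unique2)
  then show ?thesis by (auto simp: L2_inner_self disc_fourier_inner simp del: of_real_power)
qed

lemma disc_fourier_disc_proj:
  "f \<in> L2 \<Longrightarrow> disc_fourier k (disc_proj n f) = (if k = n then disc_fourier n f else (\<lambda>m. 0))"
  by (auto simp: disc_fourier_def disc_proj_inner_disc_poly)

lemma disc_proj_idem: "f \<in> L2 \<Longrightarrow> disc_proj n (disc_proj n f) = disc_proj n f"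
  by (simp add: disc_proj_def[abs_def] disc_fourier_disc_proj[unfolded disc_proj_def[abs_def]])

text \<open>Expanding \<open>g\<close> leaves inner products of \<open>R m k\<close> with
  \<open>disc_proj n f\<close>, which are those with \<open>f\<close> for \<open>k = n\<close> and
  zero otherwise. One formula thus encodes symmetry, idempotence and mutual orthogonality.\<close>

lemma disc_proj_self_adjoint:
  assumes f: "f \<in> L2" and g: "g \<in> L2"
  shows "ip (disc_proj k g) (disc_proj n f) = (if k = n then ip (disc_proj n g) f else 0)"
proof -
  have eq: "ip (R m k) (disc_proj n f) = (if k = n then ip (R m n) f else 0)" for m
    using disc_proj_inner_disc_poly[OF f, of n m k] L2_inner_commute[of "R m k"] by auto
  show ?thesis
    using sums_unique2[OF disc_proj_inner_sums[OF g disc_proj_L2[OF f, of n], of k, unfolded eq]]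
      disc_proj_inner_sums[OF g f, of n] by auto
qed

text \<open>The coefficients are at most \<open>nrm f / nrm (R m n)\<close>, so the constant is the
  sum of \<open>|R m n w| / nrm (R m n)\<close>. This yields bounded point evaluations without a
  mean value inequality for polyanalytic functions.\<close>

lemma disc_proj_bound:
  assumes w: "w \<in> \<D>"
  shows "\<exists>C. \<forall>f\<in>L2. cmod (disc_proj n f w) \<le> C * nrm f"
proof (intro exI ballI)
  let ?t = "\<lambda>m. cmod (R m n w) / nrm (R m n)"
  fix f assume f: "f \<in> L2"
  have s: "summable ?t" using w by (intro summable_disc_poly_over_norm \<gamma>) auto
  have le: "norm (disc_fourier n f m * R m n w) \<le> nrm f * ?t m" for m
    using mult_right_mono[OF disc_fourier_bound[OF f, of n m], of "cmod (R m n w)"]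
    by (simp add: norm_mult)
  have "cmod (disc_proj n f w) \<le> (\<Sum>m. nrm f * ?t m)"
    unfolding disc_proj_def by (rule norm_suminf_le[OF le]) (intro summable_mult s)
  then show "cmod (disc_proj n f w) \<le> suminf ?t * nrm f"
    unfolding suminf_mult[OF s] by (simp only: mult.commute)
qed

lemma disc_proj_lincomb:
  assumes f: "f \<in> L2" and g: "g \<in> L2" and z: "z \<in> \<D>"
  shows "disc_proj n (\<lambda>z. c * f z + d * g z) z = c * disc_proj n f z + d * disc_proj n g z"
proof -
  have "disc_fourier n (\<lambda>z. c * f z + d * g z) m = c * disc_fourier n f m + d * disc_fourier n g m" for m
    using f g by (simp add: disc_fourier_def L2_inner_add_left L2_inner_cmult_left L2_disc_cmult disc_poly_L2 \<gamma> add_divide_distrib)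
  then have "(\<lambda>m. c * (disc_fourier n f m * R m n z) + d * (disc_fourier n g m * R m n z)) sums
      disc_proj n (\<lambda>z. c * f z + d * g z) z"
    using disc_proj_sums[OF L2_disc_add[OF L2_disc_cmult[OF f, of c] L2_disc_cmult[OF g, of d]] z, of n]
    by (simp add: algebra_simps)
  moreover have "(\<lambda>m. c * (disc_fourier n f m * R m n z) + d * (disc_fourier n g m * R m n z)) sums
      (c * disc_proj n f z + d * disc_proj n g z)"
    by (intro sums_add sums_mult disc_proj_sums f g z)
  ultimately show ?thesis by (rule sums_unique2)
qed

lemma disc_proj_diff:
  assumes "f \<in> L2" "g \<in> L2" "z \<in> \<D>"
  shows "disc_proj n (\<lambda>z. f z - g z) z = disc_proj n f z - disc_proj n g z"
  using disc_proj_lincomb[OF assms, of n 1 "-1"] by simp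

lemma disc_proj_disc_poly:
  assumes z: "z \<in> \<D>"
  shows "disc_proj n (R m n) z = R m n z"
proof -
  have four: "disc_fourier n (R m n) k = (if k = m then 1 else 0)" for k
    using L2_inner_disc_poly_orthogonal[of m n k n] L2_norm_disc_poly_pos[of m n]
    by (auto simp: disc_fourier_def L2_inner_self)
  show ?thesis
    unfolding disc_proj_def four by (subst suminf_finite[of "{m}"]) auto
qed

section \<open>The poly-Bergman spaces\<close>

text \<open>Inside radius \<open>\<rho> < 1\<close> the terms are dominated by a convergent
  numerical series, so sum and integral may be exchanged. Rotation invariance then leaves the single
  exponent \<open>a\<close> with \<open>a + K = A + k\<close>, if there is one.\<close>

lemma integral_ball_power_series_disc_poly:
  assumes c: "\<And>z. z \<in> \<D> \<Longrightarrow> (\<lambda>a. c a * z ^ a) sums g z" and \<rho>: "0 < \<rho>" "\<rho> < 1"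
  shows "integrable \<mu> (\<lambda>z. indicator (ball 0 \<rho>) z * (cnj z ^ k * g z * cnj (R A K z)))"
    and "(LINT z|\<mu>. indicator (ball 0 \<rho>) z * (cnj z ^ k * g z * cnj (R A K z))) =
      (if K \<le> A + k then c (A + k - K) * (LINT z|\<mu>. indicator (ball 0 \<rho>) z *
        (z ^ (A + k - K) * cnj z ^ k * cnj (R A K z))) else 0)"
proof -
  let ?R = "R A K"
  let ?G = "\<lambda>z. indicator (ball 0 \<rho>) z * (cnj z ^ k * g z * cnj (?R z))"
  define J where "J a z = indicator (ball 0 \<rho>) z * (z ^ a * cnj z ^ k * cnj (?R z))" for a z
  have "compact (?R ` cball 0 1)"
    by (intro compact_continuous_image continuous_on_disc_poly \<gamma>) auto
  then obtain B where B: "\<And>z. z \<in> cball 0 1 \<Longrightarrow> cmod (?R z) \<le> B"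
    by (meson bounded_iff compact_imp_bounded image_eqI)
  have J_borel: "J a \<in> borel_measurable borel" for a
    unfolding J_def
    by (intro borel_measurable_times borel_measurable_indicator borel_measurable_continuous_onI
        continuous_intros continuous_on_disc_poly \<gamma>) simp
  have J_bound: "cmod (J a z) \<le> \<rho> ^ a * B" if "z \<in> \<D>" for a z
  proof (cases "cmod z < \<rho>")
    case True
    have "cmod z ^ a * cmod z ^ k * cmod (?R z) \<le> \<rho> ^ a * 1 * B"
      using True that \<rho> B[of z]
      by (intro mult_mono power_mono power_le_one) auto
    then show ?thesis using True by (simp add: J_def norm_mult norm_power)
  next
    case False
    have "0 \<le> B" using B[of 0] norm_ge_zero order_trans by (metis centre_in_cball zero_le_one)
    then show ?thesis using False \<rho> by (simp add: J_def)
  qed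
  have J_int: "integrable \<mu> (J a)" for a
    by (rule integrable_disc_measure_bounded[OF borel_imp_disc_measurable[OF J_borel] J_bound])
  \<comment> \<open>Convergence at a radius strictly beyond \<open>\<rho>\<close> gives absolute
    convergence at \<open>\<rho>\<close>.\<close>
  define r where "r = (1 + \<rho>) / 2"
  have r: "\<rho> < r" "r < 1" "0 < r" using \<rho> by (auto simp: r_def)
  have "summable (\<lambda>a. c a * (of_real r) ^ a)"
    using c[of "of_real r"] r by (auto intro: sums_summable)
  then have "summable (\<lambda>a. norm (c a * (of_real \<rho>) ^ a))"
    by (rule powser_insidea) (use r \<rho> in simp)
  then have cs: "summable (\<lambda>a. cmod (c a) * \<rho> ^ a)"
    using \<rho> by (simp add: norm_mult norm_power)
  have cJ: "cmod (c a * J a z) \<le> cmod (c a) * \<rho> ^ a * B" if "z \<in> \<D>" for a z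
    using mult_left_mono[OF J_bound[OF that, of a], of "cmod (c a)"] by (simp add: norm_mult mult.assoc)
  have cJ_int: "integrable \<mu> (\<lambda>z. c a * J a z)" for a
    by (intro integrable_mult_right J_int)
  have AEs: "AE z in \<mu>. summable (\<lambda>a. norm (c a * J a z))"
  proof (rule AE_I2)
    fix z assume "z \<in> space \<mu>"
    then show "summable (\<lambda>a. norm (c a * J a z))"
      using cJ[of z] by (intro summable_comparison_test'[OF summable_mult2[OF cs, of B], of 0]) auto
  qed
  have ints: "summable (\<lambda>a. LINT z|\<mu>. norm (c a * J a z))"
  proof (rule summable_comparison_test'[where N=0])
    show "summable (\<lambda>a. measure \<mu> \<D> * (cmod (c a) * \<rho> ^ a * B))"
      by (intro summable_mult summable_mult2 cs)
    fix a
    interpret finite_measure \<mu> by (rule finite_measure_disc_measure)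
    have "(LINT z|\<mu>. norm (c a * J a z)) \<le> (LINT z|\<mu>. cmod (c a) * \<rho> ^ a * B)"
      by (intro integral_mono integrable_norm cJ_int) (auto intro: cJ)
    also have "\<dots> = measure \<mu> \<D> * (cmod (c a) * \<rho> ^ a * B)" by simp
    finally show "norm (LINT z|\<mu>. norm (c a * J a z)) \<le> measure \<mu> \<D> * (cmod (c a) * \<rho> ^ a * B)"
      by simp
  qed
  have sum_eq: "(\<Sum>a. c a * J a z) = ?G z" if "z \<in> space \<mu>" for z
  proof -
    have "(\<lambda>a. indicator (ball 0 \<rho>) z * cnj z ^ k * cnj (?R z) * (c a * z ^ a)) sums
        (indicator (ball 0 \<rho>) z * cnj z ^ k * cnj (?R z) * g z)"
      by (intro sums_mult c) (use that in simp)
    then show ?thesis by (simp add: J_def sums_iff mult_ac)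
  qed
  have "integrable \<mu> (\<lambda>z. \<Sum>a. c a * J a z)"
    by (rule integrable_suminf[OF cJ_int AEs ints])
  then show "integrable \<mu> ?G"
    using Bochner_Integration.integrable_cong[of \<mu> \<mu>, OF refl sum_eq] by (simp only:)
  have "(\<lambda>a. LINT z|\<mu>. c a * J a z) sums (LINT z|\<mu>. (\<Sum>a. c a * J a z))"
    by (rule sums_integral[OF cJ_int AEs ints])
  also have "(LINT z|\<mu>. (\<Sum>a. c a * J a z)) =
      integral\<^sup>L \<mu> ?G"
    by (rule Bochner_Integration.integral_cong) (simp_all only: sum_eq)
  finally have 1: "(\<lambda>a. c a * integral\<^sup>L \<mu> (J a)) sums
      integral\<^sup>L \<mu> ?G"
    by (simp only: integral_mult_right_zero)
  have phase: "integral\<^sup>L \<mu> (J a) = 0" if "a + K \<noteq> A + k" for a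
  proof (rule integral_disc_measure_phase_eq_0[OF J_borel, of "a + K" "k + A"])
    show "J a (u * z) = u ^ (a + K) * cnj u ^ (k + A) * J a z" if "cmod u = 1" for u z
      by (simp add: J_def disc_poly_rotate[OF that] power_mult_distrib power_add norm_mult that indicator_def mult_ac)
  qed (use that in simp)
  have "(\<lambda>a. c a * integral\<^sup>L \<mu> (J a)) sums
      (\<Sum>a\<in>(if K \<le> A + k then {A + k - K} else {}). c a * integral\<^sup>L \<mu> (J a))"
    by (rule sums_finite) (auto intro!: phase split: if_splits)
  from sums_unique2[OF 1 this]
  show "integral\<^sup>L \<mu> ?G =
      (if K \<le> A + k then c (A + k - K) * (LINT z|\<mu>. indicator (ball 0 \<rho>) z *
        (z ^ (A + k - K) * cnj z ^ k * cnj (?R z))) else 0)"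
    by (simp add: J_def[abs_def] split: if_splits)
qed

text \<open>The integral of \<open>F * cnj (R A K)\<close> over a smaller disc only sees the monomials
  \<open>z ^ a * cnj z ^ k\<close> of \<open>F\<close> with \<open>a - k = A - K\<close>, one for each \<open>k \<le> n\<close>. As the radius tends to 1,
  those with \<open>k < K\<close> drop out by orthogonality, so all coefficients vanish by downward induction on \<open>K\<close>.\<close>

lemma polyanalytic_orthogonal_eq_0:
  assumes F: "F \<in> L2" "polyanalytic (Suc n) F"
    and orth: "\<And>m k. k \<le> n \<Longrightarrow> ip F (R m k) = 0"
    and z: "z \<in> \<D>"
  shows "F z = 0"
proof -
  obtain g where g: "\<And>k. k < Suc n \<Longrightarrow> g k holomorphic_on \<D>"
    and Fg: "\<And>z. z \<in> \<D> \<Longrightarrow> F z = (\<Sum>k<Suc n. cnj z ^ k * g k z)"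
    using F(2) unfolding polyanalytic_def by blast
  define c where "c k a = (deriv ^^ a) (g k) 0 / fact a" for k a
  have c: "(\<lambda>a. c k a * z ^ a) sums g k z" if "k < Suc n" "z \<in> \<D>" for k z
    using holomorphic_power_series[OF g[OF that(1)] that(2)] by (simp add: c_def)
  have "c k a = 0" if "k \<le> n" for k a
    using that
  proof (induction "n - k" arbitrary: k a rule: less_induct)
    case (less K A)
    let ?R = "R A K"
    let ?s = "\<lambda>X k. if K \<le> A + k then c k (A + k - K) * X (A + k - K) k else 0"
    define L where "L a k = cnj (ip ?R (\<lambda>z. z ^ a * cnj z ^ k))" for a k
    \<comment> \<open>The offset \<open>2\<close> keeps every radius strictly between
      \<open>0\<close> and \<open>1\<close>, also for \<open>i = 0\<close>.\<close>
    define \<rho> where "\<rho> i = 1 - 1 / real (i + 2)" for i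
    have \<rho>: "0 < \<rho> i" "\<rho> i < 1" for i by (auto simp: \<rho>_def)
    have \<rho>1: "\<rho> \<longlonglongrightarrow> 1" unfolding \<rho>_def by real_asymp
    define J where "J i a k = (LINT z|\<mu>. indicator (ball 0 (\<rho> i)) z * (z ^ a * cnj z ^ k * cnj (?R z)))" for i a k
    let ?I = "\<lambda>i. LINT z|\<mu>. indicator (ball 0 (\<rho> i)) z * (F z * cnj (?R z))"
    have int_F: "?I i =
        (\<Sum>k<Suc n. ?s (J i) k)" for i
    proof -
      have "?I i =
        (LINT z|\<mu>. (\<Sum>k<Suc n. indicator (ball 0 (\<rho> i)) z * (cnj z ^ k * g k z * cnj (?R z))))"
        by (rule Bochner_Integration.integral_cong) (simp_all add: Fg sum_distrib_left sum_distrib_right distrib_left distrib_right)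
      also have "\<dots> = (\<Sum>k<Suc n. LINT z|\<mu>. indicator (ball 0 (\<rho> i)) z * (cnj z ^ k * g k z * cnj (?R z)))"
        by (rule Bochner_Integration.integral_sum) (rule integral_ball_power_series_disc_poly(1)[OF c \<rho>], auto)
      also have "\<dots> = (\<Sum>k<Suc n. ?s (J i) k)"
        unfolding J_def by (intro sum.cong refl integral_ball_power_series_disc_poly(2)[OF c \<rho>]) auto
      finally show ?thesis .
    qed
    have limJ: "(\<lambda>i. J i a k) \<longlonglongrightarrow> L a k" for a k
      unfolding J_def L_def L2_inner_commute[of ?R, THEN arg_cong[where f=cnj], unfolded complex_cnj_cnj]
      unfolding L2_inner_def
      by (intro integral_disc_exhaustion \<rho>1 L2_disc_integrable_mult monomial_L2 disc_poly_L2 \<gamma>)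
    have "(\<lambda>i. \<Sum>k<Suc n. ?s (J i) k) \<longlonglongrightarrow>
      (\<Sum>k<Suc n. ?s L k)"
    proof (rule tendsto_sum)
      show "(\<lambda>i. ?s (J i) k) \<longlonglongrightarrow>
        (?s L k)" for k
        by (cases "K \<le> A + k") (auto intro!: tendsto_mult tendsto_const limJ)
    qed
    moreover have "?I \<longlonglongrightarrow> 0"
      using integral_disc_exhaustion[OF L2_disc_integrable_mult[OF F(1) disc_poly_L2] \<rho>1, of A K]
        orth[OF less.prems, of A] unfolding L2_inner_def by simp
    ultimately have "(\<Sum>k<Suc n. ?s L k) = 0"
      unfolding int_F by (rule LIMSEQ_unique)
    moreover have "(\<Sum>k<Suc n. ?s L k)
      = (\<Sum>k\<in>{K}. c k (A + k - K) * L (A + k - K) k)"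
    proof (rule sum.mono_neutral_cong_right)
      show "\<forall>k\<in>{..<Suc n} - {K}. (?s L k) = 0"
      proof
        fix k assume k: "k \<in> {..<Suc n} - {K}"
        then consider "k < K" | "K < k" "k \<le> n" by force
        then show "(?s L k) = 0"
        proof cases
          case 1
          then show ?thesis by (simp add: L_def L2_inner_disc_poly_monomial_less)
        next
          case 2
          then have "c k (A + k - K) = 0" using less.hyps[of k] by simp
          then show ?thesis by simp
        qed
      qed
    qed (use less.prems in auto)
    ultimately have "c K A * L A K = 0" by simp
    \<comment> \<open>This diagonal moment is
      \<open>pi * fact A * fact K / poch (A + K + 1)\<close>, a positive number.\<close>
    moreover have "L A K \<noteq> 0"
      using L2_inner_disc_poly_monomial[of A K K A] pochhammer_pos[of "\<gamma> + 1" "A + K + 1"] \<gamma>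
      by (simp add: L_def add.commute)
    ultimately show ?case by simp
  qed
  then have "g k z = 0" if "k < Suc n" for k
    using c[OF that z] that by (simp add: sums_iff)
  then show ?thesis by (simp add: Fg[OF z])
qed

text \<open>The difference of the two sides has order \<open>Suc n\<close> and is orthogonal to
  every \<open>R m k\<close> with \<open>k <= n\<close>, so it vanishes at every point of the disc
  and not merely almost everywhere.\<close>

lemma poly_bergman_space_decomposition:
  assumes F: "F \<in> PB n" and z: "z \<in> \<D>"
  shows "F z = (\<Sum>k\<le>n. disc_proj k F z)"
proof -
  let ?G = "\<lambda>z. F z - (\<Sum>k\<le>n. disc_proj k F z)"
  have F': "F \<in> L2" "polyanalytic (Suc n) F" using F by (simp_all add: poly_bergman_space_iff)
  have P: "(\<lambda>z. \<Sum>k\<le>n. disc_proj k F z) \<in> L2" by (intro L2_disc_sum disc_proj_L2 \<gamma> F')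
  have "F z - (\<Sum>k\<le>n. disc_proj k F z) = 0"
  proof (rule polyanalytic_orthogonal_eq_0[where n=n, OF _ _ _ z])
    show "?G \<in> L2" by (intro L2_disc_diff P F')
    show "polyanalytic (Suc n) ?G"
      by (intro polyanalytic_diff polyanalytic_sum F' polyanalytic_mono[OF polyanalytic_disc_proj]) auto
    fix m k assume "k \<le> n"
    have "ip ?G (R m k) =
      ip F (R m k) - (\<Sum>j\<le>n. ip (disc_proj j F) (R m k))"
      by (simp add: L2_inner_diff_left L2_inner_sum_left disc_proj_L2 disc_poly_L2 \<gamma> F' P)
    also have "\<dots> = 0"
      using \<open>k \<le> n\<close> by (simp add: disc_proj_inner_disc_poly[OF F'(1)])
    finally show "ip ?G (R m k) = 0" .
  qed
  then show ?thesis by simp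
qed

lemma disc_proj_in_poly_bergman_space:
  "f \<in> L2 \<Longrightarrow> k \<le> n \<Longrightarrow> disc_proj k f \<in> PB n"
  unfolding poly_bergman_space_iff
  by (auto intro: disc_proj_L2 polyanalytic_mono[OF polyanalytic_disc_proj])

text \<open>Orthogonality to the previous space kills all projections of index below
  \<open>n\<close> in the decomposition; conversely the ranges of distinct projections are
  orthogonal. The equation is asked on the disc only, because values elsewhere are
  arbitrary.\<close>

lemma true_poly_bergman_space_eq:
  "TB n = {f \<in> L2. \<forall>z\<in>\<D>. f z = disc_proj n f z}"
proof (intro set_eqI iffI)
  fix f assume "f \<in> TB n"
  then have f: "f \<in> PB n"
    and orth: "\<And>m k. k < n \<Longrightarrow> ip f (R m k) = 0"
  proof -
    have R: "R m k \<in> PB j" if "k \<le> j" for m k j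
      using that by (auto simp: poly_bergman_space_iff intro: disc_poly_L2 polyanalytic_mono[OF polyanalytic_disc_poly])
    show "f \<in> PB n"
      using \<open>f \<in> TB n\<close> by (cases n) (auto simp: bergman_space_eq)
    show "ip f (R m k) = 0" if "k < n" for m k
      using \<open>f \<in> TB n\<close> that R by (cases n) auto
  qed
  have L2: "f \<in> L2" using f by (simp add: poly_bergman_space_iff)
  have "f z = disc_proj n f z" if "z \<in> \<D>" for z
  proof -
    have "disc_proj k f z = 0" if "k < n" for k
      using orth[OF that] by (simp add: disc_proj_def disc_fourier_def)
    then have "(\<Sum>k\<le>n. disc_proj k f z) = disc_proj n f z"
      by (simp add: lessThan_Suc_atMost[symmetric])
    then show ?thesis using poly_bergman_space_decomposition[OF f that] by simp
  qed
  then show "f \<in> {f \<in> L2. \<forall>z\<in>\<D>. f z = disc_proj n f z}" using L2 by simp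
next
  fix f assume "f \<in> {f \<in> L2. \<forall>z\<in>\<D>. f z = disc_proj n f z}"
  then have L2: "f \<in> L2" and f: "\<And>z. z \<in> \<D> \<Longrightarrow> f z = disc_proj n f z" by auto
  have H: "f \<in> PB n"
    using L2 polyanalytic_cong[OF f] polyanalytic_disc_proj[OF L2, of n] by (simp add: poly_bergman_space_iff)
  show "f \<in> TB n"
  proof (cases n)
    case 0
    then show ?thesis using H by (simp add: bergman_space_eq)
  next
    case (Suc j)
    have "ip f G = 0" if G: "G \<in> PB j" for G
    proof -
      have GL2: "G \<in> L2" using G by (simp add: poly_bergman_space_iff)
      have "ip f G = ip (disc_proj n f) (\<lambda>z. \<Sum>k\<le>j. disc_proj k G z)"
        by (rule L2_inner_cong) (use f poly_bergman_space_decomposition[OF G] in auto)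
      also have "\<dots> = (\<Sum>k\<le>j. ip (disc_proj n f) (disc_proj k G))"
        by (intro L2_inner_sum_right disc_proj_L2 \<gamma> L2 GL2)
      also have "\<dots> = 0"
        using Suc by (intro sum.neutral) (auto simp: disc_proj_self_adjoint[OF GL2 L2])
      finally show ?thesis .
    qed
    then show ?thesis using H Suc by simp
  qed
qed

text \<open>Each projection is a contraction, so the triangle inequality costs the factor
  \<open>card A\<close>; this crude constant suffices for passing to limits.\<close>

lemma disc_proj_sum_norm_le:
  assumes X: "X \<in> L2" and f: "f \<in> L2"
    and eq: "\<And>z. z \<in> \<D> \<Longrightarrow> X z = (\<Sum>k\<in>A. disc_proj k X z)"
  shows "nrm (\<lambda>z. X z - (\<Sum>k\<in>A. disc_proj k f z)) \<le> real (card A) * nrm (\<lambda>z. X z - f z)"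
proof -
  have "nrm (\<lambda>z. X z - (\<Sum>k\<in>A. disc_proj k f z)) =
      nrm (\<lambda>z. \<Sum>k\<in>A. disc_proj k (\<lambda>z. X z - f z) z)"
    by (rule L2_norm_cong) (simp only: eq disc_proj_diff[OF X f] sum_subtractf)
  also have "\<dots> \<le> (\<Sum>k\<in>A. nrm (disc_proj k (\<lambda>z. X z - f z)))"
    by (intro L2_norm_sum disc_proj_L2 L2_disc_diff X f \<gamma>)
  also have "\<dots> \<le> (\<Sum>k\<in>A. nrm (\<lambda>z. X z - f z))"
    by (intro sum_mono disc_proj_norm_le L2_disc_diff X f \<gamma>)
  finally show ?thesis by simp
qed

text \<open>The limit \<open>f\<close> supplied by completeness may violate the pointwise equation
  on a null set. The sum of its projections satisfies it and is a norm limit of the same sequence.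
  Finite \<open>A\<close> treats the poly-Bergman spaces (\<open>{..n}\<close>) and the true ones
  (\<open>{n}\<close>) together.\<close>

lemma hilbert_subspace_disc_proj:
  assumes "finite A"
  shows "hilbert_subspace \<gamma> {f \<in> L2. \<forall>z\<in>\<D>. f z = (\<Sum>k\<in>A. disc_proj k f z)}"
    (is "hilbert_subspace \<gamma> ?V")
  unfolding hilbert_subspace_def
proof (intro conjI allI ballI impI)
  show "(\<lambda>z. 0) \<in> ?V"
    by (simp add: L2_disc_zero disc_proj_def disc_fourier_def L2_inner_zero_left)
  show "(\<lambda>z. f z + g z) \<in> ?V" if "f \<in> ?V" "g \<in> ?V" for f g
    using that disc_proj_lincomb[of f g _ _ 1 1] by (simp add: L2_disc_add sum.distrib)
  show "(\<lambda>z. c * f z) \<in> ?V" if "f \<in> ?V" for c f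
    using that disc_proj_lincomb[of f f _ _ c 0] by (simp add: L2_disc_cmult sum_distrib_left)
  fix X assume X: "(\<forall>i. X i \<in> ?V) \<and> L2_Cauchy \<gamma> X"
  then have XL2: "X i \<in> L2" for i by simp
  then obtain f where f: "f \<in> L2" "L2_tendsto \<gamma> X f" using L2_disc_complete X by blast
  let ?F = "\<lambda>z. \<Sum>k\<in>A. disc_proj k f z"
  have F: "?F \<in> L2" by (intro L2_disc_sum disc_proj_L2 f)
  have "disc_fourier k ?F = disc_fourier k f" if "k \<in> A" for k
    using that assms
    by (auto simp: disc_fourier_def L2_inner_sum_left disc_proj_L2 disc_poly_L2 disc_proj_inner_disc_poly f)
  then have "?F \<in> ?V" using F by (simp add: disc_proj_def)
  moreover have "L2_tendsto \<gamma> X ?F"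
    using f(2) by (rule L2_tendsto_comparison)
      (use X in \<open>auto intro!: disc_proj_sum_norm_le XL2 f(1)\<close>)
  ultimately show "\<exists>f\<in>?V. L2_tendsto \<gamma> X f" by blast
qed auto

lemma hilbert_subspace_poly_bergman_space: "hilbert_subspace \<gamma> (PB n)"
proof -
  have "PB n = {f \<in> L2. \<forall>z\<in>\<D>. f z = (\<Sum>k\<le>n. disc_proj k f z)}"
  proof (intro set_eqI iffI)
    fix f assume f: "f \<in> {f \<in> L2. \<forall>z\<in>\<D>. f z = (\<Sum>k\<le>n. disc_proj k f z)}"
    then have "polyanalytic (Suc n) (\<lambda>z. \<Sum>k\<le>n. disc_proj k f z)"
      by (intro polyanalytic_sum polyanalytic_mono[OF polyanalytic_disc_proj]) auto
    then show "f \<in> PB n" using f polyanalytic_cong[of f] by (auto simp: poly_bergman_space_iff)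
  qed (use poly_bergman_space_decomposition in \<open>auto simp: poly_bergman_space_iff\<close>)
  then show ?thesis using hilbert_subspace_disc_proj[of "{..n}"] by simp
qed

lemma hilbert_subspace_true_poly_bergman_space: "hilbert_subspace \<gamma> (TB n)"
  using hilbert_subspace_disc_proj[of "{n}"] by (simp add: true_poly_bergman_space_eq)

lemma disc_proj_in_true_poly_bergman_space:
  "f \<in> L2 \<Longrightarrow> disc_proj n f \<in> TB n"
  by (simp add: true_poly_bergman_space_eq disc_proj_L2 disc_proj_idem)

lemma rkhs_true_poly_bergman_space: "rkhs \<gamma> (TB n)"
  unfolding rkhs_def
proof (intro conjI ballI hilbert_subspace_true_poly_bergman_space)
  fix w :: complex assume w: "w \<in> \<D>"
  from disc_proj_bound[OF this, of n] obtain C where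
    "\<forall>f\<in>L2. cmod (disc_proj n f w) \<le> C * nrm f" ..
  then show "\<exists>C. \<forall>f\<in>TB n. cmod (f w) \<le> C * nrm f"
    using w by (auto simp: true_poly_bergman_space_eq)
qed

lemma true_poly_bergman_space_orthogonal:
  assumes "j \<noteq> k"
  shows "L2_orthogonal \<gamma> (TB j) (TB k)"
  unfolding L2_orthogonal_def
proof (intro ballI)
  fix f g assume "f \<in> TB j" "g \<in> TB k"
  then have f: "f \<in> L2" "\<And>z. z \<in> \<D> \<Longrightarrow> f z = disc_proj j f z"
    and g: "g \<in> L2" "\<And>z. z \<in> \<D> \<Longrightarrow> g z = disc_proj k g z"
    by (auto simp: true_poly_bergman_space_eq)
  have "ip f g = ip (disc_proj j f) (disc_proj k g)"
    using f(2) g(2) by (rule L2_inner_cong)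
  also have "\<dots> = 0" using assms by (simp add: disc_proj_self_adjoint[OF g(1) f(1)])
  finally show "ip f g = 0" .
qed

lemma orthogonal_basis_disc_poly:
  "orthogonal_basis \<gamma> (TB n) (\<lambda>m. R m n)"
  unfolding orthogonal_basis_def
proof (intro conjI allI impI ballI)
  show "R m n \<in> TB n" for m
    by (simp add: true_poly_bergman_space_eq disc_poly_L2 disc_proj_disc_poly)
  show "nrm (R m n) \<noteq> 0" for m
    using L2_norm_disc_poly_pos[of m n] by simp
  show "ip (R k n) (R m n) = 0" if "k \<noteq> m" for k m
    using L2_inner_disc_poly_orthogonal[of k n m n] that by simp
  fix f assume "f \<in> TB n"
  then have f: "f \<in> L2" "\<And>z. z \<in> \<D> \<Longrightarrow> f z = disc_proj n f z"
    by (auto simp: true_poly_bergman_space_eq)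
  have "nrm (\<lambda>z. X z - f z) = nrm (\<lambda>z. X z - disc_proj n f z)" for X
    by (rule L2_norm_cong) (simp add: f(2))
  then show "\<exists>c. L2_tendsto \<gamma> (\<lambda>N z. \<Sum>m<N. c m * R m n z) f"
    using disc_proj_tendsto[OF f(1), of n] unfolding L2_tendsto_def
    by (intro exI[of _ "disc_fourier n f"]) simp
qed

lemma hilbert_direct_sum_poly_bergman_space:
  "hilbert_direct_sum \<gamma> {..n} TB (PB n)"
  unfolding hilbert_direct_sum_def
proof (intro conjI ballI impI)
  show "hilbert_subspace \<gamma> (PB n)" by (rule hilbert_subspace_poly_bergman_space)
  show "hilbert_subspace \<gamma> (TB i)" for i by (rule hilbert_subspace_true_poly_bergman_space)
  show "TB i \<subseteq> PB n" if "i \<in> {..n}" for i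
  proof
    fix f assume "f \<in> TB i"
    then have f: "f \<in> L2" "\<And>z. z \<in> \<D> \<Longrightarrow> f z = disc_proj i f z"
      by (auto simp: true_poly_bergman_space_eq)
    then show "f \<in> PB n"
      using disc_proj_in_poly_bergman_space[OF f(1), of i n] that polyanalytic_cong[OF f(2)]
      by (simp add: poly_bergman_space_iff)
  qed
  show "L2_orthogonal \<gamma> (TB i) (TB j)" if "i \<noteq> j" for i j
    using that by (rule true_poly_bergman_space_orthogonal)
  fix f assume f: "f \<in> PB n"
  then have L2: "f \<in> L2" by (simp add: poly_bergman_space_iff)
  show "\<exists>g. (\<forall>i\<in>{..n}. g i \<in> TB i) \<and>
      L2_tendsto \<gamma> (\<lambda>N z. \<Sum>i\<in>{..n} \<inter> {..<N}. g i z) f"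
  proof (intro exI[of _ "\<lambda>i. disc_proj i f"] conjI ballI)
    show "disc_proj i f \<in> TB i" for i
      by (rule disc_proj_in_true_poly_bergman_space[OF L2])
    have "nrm (\<lambda>z. (\<Sum>i\<in>{..n} \<inter> {..<N}. disc_proj i f z) - f z) = 0" if "N > n" for N
    proof -
      have "{..n} \<inter> {..<N} = {..n}" using that by auto
      then have "nrm (\<lambda>z. (\<Sum>i\<in>{..n} \<inter> {..<N}. disc_proj i f z) - f z) = nrm (\<lambda>z. 0)"
        by (intro L2_norm_cong) (simp add: poly_bergman_space_decomposition[OF f])
      then show ?thesis by (simp add: L2_norm_zero)
    qed
    then show "L2_tendsto \<gamma> (\<lambda>N z. \<Sum>i\<in>{..n} \<inter> {..<N}. disc_proj i f z) f"
      unfolding L2_tendsto_def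
      by (intro tendsto_eventually eventually_mono[OF eventually_gt_at_top[of n]])
  qed
qed

text \<open>The passage from monomials to disc polynomials is triangular in the power of
  \<open>cnj z\<close> with positive leading coefficients, so it can be inverted by induction on
  \<open>b\<close>.\<close>

lemma disc_poly_orthogonal_imp_monomial_orthogonal:
  assumes h: "h \<in> L2" and orth: "\<And>m k. ip h (R m k) = 0"
  shows "ip h (\<lambda>z. z ^ a * cnj z ^ b) = 0"
proof (induction b arbitrary: a rule: less_induct)
  case (less b)
  have "pochhammer (\<gamma> + 1 + real a) b / poch b > 0"
    using \<gamma> by (intro divide_pos_pos pochhammer_pos) auto
  moreover have "ip h (R a b) = of_real (pochhammer (\<gamma> + 1 + real a) b / poch b) *
      ip h (\<lambda>z. z ^ a * cnj z ^ b)"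
    by (rule L2_inner_disc_poly_leading[OF h less.IH])
  ultimately show ?case using orth[of a b] by auto
qed

text \<open>Bessel and completeness give some limit \<open>h\<close> of the partial sums. It has the
  same inner products with all disc polynomials as \<open>f\<close>, so totality makes
  \<open>h - f\<close> null, which is enough for norm convergence to \<open>f\<close>.\<close>

lemma hilbert_direct_sum_L2_disc:
  "hilbert_direct_sum \<gamma> UNIV TB (L2)"
  unfolding hilbert_direct_sum_def
proof (intro conjI ballI impI)
  show "hilbert_subspace \<gamma> (L2)" by (rule hilbert_subspace_L2_disc)
  show "hilbert_subspace \<gamma> (TB i)" for i by (rule hilbert_subspace_true_poly_bergman_space)
  show "TB i \<subseteq> L2" for i by (auto simp: true_poly_bergman_space_eq)
  show "L2_orthogonal \<gamma> (TB i) (TB j)" if "i \<noteq> j" for i j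
    using that by (rule true_poly_bergman_space_orthogonal)
  fix f assume f: "f \<in> L2"
  let ?u = "\<lambda>i. disc_proj i f"
  let ?S = "\<lambda>N z. \<Sum>i<N. disc_proj i f z"
  have u: "?u i \<in> L2" for i by (rule disc_proj_L2[OF f])
  have S: "?S N \<in> L2" for N by (intro L2_disc_sum u)
  have orth: "ip (?u i) (?u j) = 0" if "i \<noteq> j" for i j
    using that by (simp add: disc_proj_self_adjoint[OF f f])
  have fu: "ip f (?u i) = ip (?u i) (?u i)" for i
    using disc_proj_self_adjoint[OF f f, of i i] L2_inner_commute[of f "?u i"] L2_inner_commute[of "?u i" "?u i"] by simp
  obtain h where h: "h \<in> L2" "L2_tendsto \<gamma> ?S h"
    using L2_disc_complete[OF S L2_Bessel(2)[OF u f orth fu]] by blast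
  define d where "d z = h z - f z" for z
  have d: "d \<in> L2" unfolding d_def by (intro L2_disc_diff h f)
  have "ip d (R m k) = 0" for m k
  proof -
    have "(\<lambda>N. ip (?S N) (R m k)) \<longlonglongrightarrow> ip h (R m k)"
      by (intro L2_tendsto_inner S h disc_poly_L2 \<gamma>)
    moreover have "(\<lambda>N. ip (?S N) (R m k)) \<longlonglongrightarrow> ip f (R m k)"
    proof (rule tendsto_eventually, rule eventually_mono[OF eventually_gt_at_top[of k]])
      fix N assume "k < N"
      have "ip (?S N) (R m k) = (\<Sum>i<N. ip (?u i) (R m k))"
        by (intro L2_inner_sum_left u disc_poly_L2 \<gamma>)
      also have "\<dots> = ip f (R m k)"
        using \<open>k < N\<close> by (simp add: disc_proj_inner_disc_poly[OF f])
      finally show "ip (?S N) (R m k) = ip f (R m k)" .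
    qed
    ultimately have "ip h (R m k) = ip f (R m k)"
      by (rule LIMSEQ_unique)
    then show ?thesis by (simp add: d_def[abs_def] L2_inner_diff_left h f disc_poly_L2)
  qed
  then have "AE z in \<mu>. d z = 0"
    by (intro L2_monomials_total[OF d] disc_poly_orthogonal_imp_monomial_orthogonal[OF d])
  then have "AE z in \<mu>. (cmod (d z))\<^sup>2 = 0" by eventually_elim simp
  then have "nrm d = 0"
    unfolding L2_norm_def by (subst integral_eq_zero_AE) simp_all
  have "nrm (\<lambda>z. ?S N z - f z) \<le> 1 * nrm (\<lambda>z. ?S N z - h z)" for N
    using L2_norm_triangle_diff[OF S h(1) f, of N] \<open>nrm d = 0\<close> by (simp add: d_def[abs_def])
  with h(2) have "L2_tendsto \<gamma> ?S f" by (rule L2_tendsto_comparison)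
  then show "\<exists>g. (\<forall>i\<in>UNIV. g i \<in> TB i) \<and>
      L2_tendsto \<gamma> (\<lambda>N z. \<Sum>i\<in>UNIV \<inter> {..<N}. g i z) f"
    using disc_proj_in_true_poly_bergman_space[OF f] by (intro exI[of _ ?u]) simp
qed

section \<open>The reproducing kernels\<close>

text \<open>The terms \<open>|R m n w| / nrm (R m n)\<close> are bounded by their sum, so the
  coefficients are \<open>O(1 / nrm (R m n))\<close> for fixed \<open>w\<close>.\<close>

lemma kernel_coeff_summable:
  assumes w: "w \<in> \<D>" and x: "cmod x < 1"
  shows "summable (\<lambda>m. kernel_coeff n w m * x ^ m)"
proof -
  let ?t = "\<lambda>m. cmod (R m n w) / nrm (R m n)"
  have s: "summable ?t" using w by (intro summable_disc_poly_over_norm) auto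
  have "?t m \<le> suminf ?t" for m
    using sum_le_suminf[OF s, of "{m}"] L2_norm_nonneg by simp
  then have "?t m / nrm (R m n) \<le> suminf ?t / nrm (R m n)" for m
    by (intro divide_right_mono L2_norm_nonneg)
  then have "cmod (kernel_coeff n w m) \<le> suminf ?t / nrm (R m n)" for m
    by (simp add: kernel_coeff_def norm_divide norm_mult power2_eq_square L2_norm_nonneg)
  then show ?thesis using x by (rule summable_power_series_bound)
qed

lemma disc_kernel_sums:
  assumes w: "w \<in> \<D>" and z: "z \<in> \<D>"
  shows "(\<lambda>m. kernel_coeff n w m * R m n z)
    sums disc_kernel n z w"
proof -
  have "cmod z < 1" using z by simp
  from disc_poly_series[OF kernel_coeff_summable[OF w] this]
  show ?thesis unfolding disc_kernel_def by (intro summable_sums sums_summable)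
qed

text \<open>The \<open>m\<close>-th term has norm \<open>|R m n w| / nrm (R m n)\<close>. These
  norms are summable, so the partial sums are Cauchy by the triangle inequality, and the pointwise
  sum is their norm limit.\<close>

lemma
  assumes w: "w \<in> \<D>"
  shows disc_kernel_L2: "(\<lambda>z. disc_kernel n z w) \<in> L2"
    and disc_kernel_tendsto: "L2_tendsto \<gamma> (\<lambda>N z. \<Sum>m<N. kernel_coeff n w m * R m n z)
      (\<lambda>z. disc_kernel n z w)"
proof -
  define u where "u m z = kernel_coeff n w m * R m n z" for m z
  let ?t = "\<lambda>m. cmod (R m n w) / nrm (R m n)"
  have u: "u m \<in> L2" for m unfolding u_def by (intro L2_disc_cmult disc_poly_L2 \<gamma>)
  have S: "(\<lambda>z. \<Sum>m<N. u m z) \<in> L2" for N by (intro L2_disc_sum u)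
  have nu: "nrm (u m) = ?t m" for m
    using L2_norm_disc_poly_pos[of m n] unfolding u_def[abs_def] L2_norm_cmult
    by (simp add: kernel_coeff_def norm_divide norm_mult power2_eq_square)
  have s: "summable ?t" using w by (intro summable_disc_poly_over_norm \<gamma>) auto
  have C: "L2_Cauchy \<gamma> (\<lambda>N z. \<Sum>m<N. u m z)"
  proof (rule L2_Cauchy_seriesI)
    fix e :: real assume "e > 0"
    then obtain N where N: "\<And>i j. i \<ge> N \<Longrightarrow> norm (sum ?t {i..<j}) < e"
      using s unfolding summable_Cauchy by blast
    have "nrm (\<lambda>z. \<Sum>m=j..<i. u m z) < e" if "N \<le> j" for i j
    proof -
      have "nrm (\<lambda>z. \<Sum>m=j..<i. u m z) \<le> (\<Sum>m=j..<i. nrm (u m))"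
        by (intro L2_norm_sum u)
      also have "\<dots> < e" using N[OF that, of i] by (simp add: nu)
      finally show ?thesis .
    qed
    then show "\<exists>N. \<forall>j\<ge>N. \<forall>i. nrm (\<lambda>z. \<Sum>m=j..<i. u m z) < e" by blast
  qed
  have meas: "(\<lambda>z. disc_kernel n z w) \<in> \<M>"
    unfolding disc_kernel_def
    by (rule polyanalytic_measurable[OF polyanalytic_disc_poly_series[OF kernel_coeff_summable[OF w]]])
  have AE: "AE z in \<mu>. (\<lambda>N. \<Sum>m<N. u m z) \<longlonglongrightarrow> disc_kernel n z w"
    using disc_kernel_sums[OF w] by (intro AE_I2) (simp add: sums_def u_def)
  note lim = L2_Cauchy_pointwise_limit[OF S C meas AE]
  show "(\<lambda>z. disc_kernel n z w) \<in> L2" by (rule lim(1))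
  show "L2_tendsto \<gamma> (\<lambda>N z. \<Sum>m<N. kernel_coeff n w m * R m n z)
      (\<lambda>z. disc_kernel n z w)"
    using lim(2) unfolding u_def .
qed

lemma disc_kernel_inner_sums:
  assumes w: "w \<in> \<D>" and h: "h \<in> L2"
  shows "(\<lambda>m. kernel_coeff n w m * ip (R m n) h)
    sums ip (\<lambda>z. disc_kernel n z w) h"
proof -
  let ?c = "\<lambda>m. kernel_coeff n w m"
  have "(\<lambda>N. ip (\<lambda>z. \<Sum>m<N. ?c m * R m n z) h) \<longlonglongrightarrow> ip (\<lambda>z. disc_kernel n z w) h"
    by (intro L2_tendsto_inner L2_disc_sum L2_disc_cmult disc_poly_L2 disc_kernel_L2 disc_kernel_tendsto w h \<gamma>)
  moreover have "ip (\<lambda>z. \<Sum>m<N. ?c m * R m n z) h = (\<Sum>m<N. ?c m * ip (R m n) h)" for N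
    by (subst L2_inner_sum_left) (auto simp only: L2_inner_cmult_left intro!: L2_disc_cmult disc_poly_L2 \<gamma> h)
  ultimately show ?thesis unfolding sums_def by (simp only:)
qed

lemma disc_kernel_in_true_poly_bergman_space:
  assumes w: "w \<in> \<D>"
  shows "(\<lambda>z. disc_kernel n z w) \<in> TB n"
proof -
  have "disc_fourier n (\<lambda>z. disc_kernel n z w) k = kernel_coeff n w k" for k
  proof -
    let ?a = "\<lambda>m. kernel_coeff n w m * ip (R m n) (R k n)"
    have "?a sums (\<Sum>m\<in>{k}. ?a m)"
      by (rule sums_finite) (use L2_inner_disc_poly_orthogonal[of _ n k n] in auto)
    moreover have "(\<Sum>m\<in>{k}. ?a m) = cnj (R k n w)"
      using L2_norm_disc_poly_pos[of k n] by (simp add: L2_inner_self kernel_coeff_def)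
    ultimately have "ip (\<lambda>z. disc_kernel n z w) (R k n) = cnj (R k n w)"
      using sums_unique2[OF disc_kernel_inner_sums[OF w disc_poly_L2, of n k n]] by simp
    then show ?thesis by (simp add: disc_fourier_def kernel_coeff_def)
  qed
  note four = this
  have "disc_proj n (\<lambda>z. disc_kernel n z w) z = disc_kernel n z w" for z
    unfolding disc_proj_def four by (simp only: disc_kernel_def)
  then show ?thesis
    by (simp add: true_poly_bergman_space_eq disc_kernel_L2[OF w])
qed

text \<open>Expanding the inner product with the kernel and conjugating gives, term by term, the
  series of \<open>disc_proj n f\<close> at \<open>w\<close>.\<close>

lemma reproducing_kernel_disc_kernel: "reproducing_kernel \<gamma> (TB n) (disc_kernel n)"
  unfolding reproducing_kernel_def
proof (intro ballI conjI)
  fix w :: complex assume w: "w \<in> \<D>"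
  show "(\<lambda>z. disc_kernel n z w) \<in> TB n"
    by (rule disc_kernel_in_true_poly_bergman_space[OF w])
  fix f assume "f \<in> TB n"
  then have f: "f \<in> L2" "f w = disc_proj n f w"
    using w by (auto simp: true_poly_bergman_space_eq)
  have "(\<lambda>m. cnj (kernel_coeff n w m * ip (R m n) f)) sums
      cnj (ip (\<lambda>z. disc_kernel n z w) f)"
    using disc_kernel_inner_sums[OF w f(1)] by (simp only: sums_cnj)
  moreover have "cnj (kernel_coeff n w m * ip (R m n) f) =
      disc_fourier n f m * R m n w" for m
    using L2_inner_commute[of f "R m n"] by (simp add: disc_fourier_def kernel_coeff_def)
  moreover have "cnj (ip (\<lambda>z. disc_kernel n z w) f) = ip f (\<lambda>z. disc_kernel n z w)"
    by (rule L2_inner_commute[symmetric])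
  ultimately show "f w = ip f (\<lambda>z. disc_kernel n z w)"
    using sums_unique2[OF disc_proj_sums[OF f(1) w, of n]] f(2) by simp
qed

text \<open>Uniqueness: for fixed \<open>w\<close> the difference \<open>d\<close> of two kernels
  lies in the space, and reproducing \<open>d\<close> by each of them gives
  \<open>ip d d = d w - d w = 0\<close>. Bounded point evaluation turns norm zero into pointwise
  zero on the disc.\<close>

lemma reproducing_kernel_iff:
  "reproducing_kernel \<gamma> (TB n) K \<longleftrightarrow>
    (\<forall>z\<in>\<D>. \<forall>w\<in>\<D>. K z w = disc_kernel n z w)"
proof
  assume K: "\<forall>z\<in>\<D>. \<forall>w\<in>\<D>. K z w = disc_kernel n z w"
  show "reproducing_kernel \<gamma> (TB n) K"
    unfolding reproducing_kernel_def
  proof (intro ballI conjI)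
    fix w :: complex assume w: "w \<in> \<D>"
    have eq: "\<And>z. z \<in> \<D> \<Longrightarrow> K z w = disc_kernel n z w" using K w by blast
    show "(\<lambda>z. K z w) \<in> TB n"
      using disc_kernel_in_true_poly_bergman_space[OF w, of n] eq
        L2_disc_cong[of "\<lambda>z. K z w" "\<lambda>z. disc_kernel n z w"] disc_proj_cong[of "\<lambda>z. K z w" "\<lambda>z. disc_kernel n z w" n]
      by (simp add: true_poly_bergman_space_eq)
    fix f assume "f \<in> TB n"
    then have "f w = ip f (\<lambda>z. disc_kernel n z w)"
      using reproducing_kernel_disc_kernel w unfolding reproducing_kernel_def by blast
    also have "\<dots> = ip f (\<lambda>z. K z w)" by (rule L2_inner_cong) (simp_all add: eq)
    finally show "f w = ip f (\<lambda>z. K z w)" .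
  qed
next
  assume K: "reproducing_kernel \<gamma> (TB n) K"
  show "\<forall>z\<in>\<D>. \<forall>w\<in>\<D>. K z w = disc_kernel n z w"
  proof (intro ballI)
    fix z w :: complex assume z: "z \<in> \<D>" and w: "w \<in> \<D>"
    let ?V = "TB n"
    let ?k1 = "\<lambda>z. K z w" and ?k2 = "\<lambda>z. disc_kernel n z w"
    define d where "d z = K z w - disc_kernel n z w" for z
    have k1: "?k1 \<in> ?V" "\<And>f. f \<in> ?V \<Longrightarrow> f w = ip f ?k1"
      using K w unfolding reproducing_kernel_def by auto
    have k2: "?k2 \<in> ?V" "\<And>f. f \<in> ?V \<Longrightarrow> f w = ip f ?k2"
      using reproducing_kernel_disc_kernel[of n] w unfolding reproducing_kernel_def by auto
    have L2: "?k1 \<in> L2" "?k2 \<in> L2" using k1 k2 by (auto simp: true_poly_bergman_space_eq)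
    have d: "d \<in> ?V"
      using k1(1) k2(1) disc_proj_diff[OF L2, of _ n] L2_disc_diff[OF L2]
      by (simp add: true_poly_bergman_space_eq d_def[abs_def])
    then have "d \<in> L2" by (auto simp: true_poly_bergman_space_eq)
    then have "ip d d = ip d ?k1 - ip d ?k2"
      using L2 by (subst (2) d_def[abs_def]) (simp add: L2_inner_diff_right)
    also have "\<dots> = 0" using k1(2)[OF d] k2(2)[OF d] by simp
    finally have "nrm d = 0" by (simp add: L2_inner_self)
    moreover obtain C where "cmod (d z) \<le> C * nrm d"
      using rkhs_true_poly_bergman_space[of n] z d unfolding rkhs_def by blast
    ultimately have "d z = 0" by simp
    then show "K z w = disc_kernel n z w" by (simp add: d_def)
  qed
qed

text \<open>Raising the parameter \<open>c = \<gamma> + n + 1\<close> by one multiplies its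
  Pochhammer symbol by \<open>(c + m) / c\<close>. That supplies the linear factor of the inverse
  squared norm, while \<open>poch m / fact m\<close> supplies the rest of its dependence on
  \<open>m\<close>.\<close>

lemma hyp2F1_coeff_eq:
  "pochhammer (complex_of_real (\<gamma> + real n + 2)) m * pochhammer (complex_of_real (\<gamma> + 1)) m /
      pochhammer (complex_of_real (\<gamma> + real n + 1)) m / fact m =
    of_real (pi * fact n / ((\<gamma> + real n + 1) * poch n) / (nrm (R m n))\<^sup>2)"
proof -
  let ?x = "pochhammer (\<gamma> + real n + 2) m * poch m / pochhammer (\<gamma> + real n + 1) m / fact m"
  define c where "c = \<gamma> + real n + 1"
  have c: "c > 0" "c + real m > 0" using \<gamma> by (auto simp: c_def)
  have pos: "pochhammer c m > 0" "poch m > 0" "poch n > 0"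
    using \<gamma> c by (auto intro!: pochhammer_pos)
  have "c * pochhammer (c + 1) m = pochhammer c m * (c + real m)"
    by (metis pochhammer_Suc pochhammer_rec)
  then have ratio: "pochhammer (c + 1) m / pochhammer c m = (c + real m) / c"
    using pos c by (simp add: field_simps)
  have "?x =
      (pochhammer (c + 1) m / pochhammer c m) * poch m / fact m"
    by (simp add: c_def add_ac)
  also have "\<dots> = pi * fact n / (c * poch n) / (nrm (R m n))\<^sup>2"
  proof -
    have e: "\<gamma> + real m + real n + 1 = c + real m" by (simp add: c_def)
    show ?thesis
      unfolding ratio L2_norm_disc_poly e using pos c by (simp add: field_simps)
  qed
  finally have "?x =
      pi * fact n / ((\<gamma> + real n + 1) * poch n) / (nrm (R m n))\<^sup>2"
    by (simp only: c_def)
  then have "complex_of_real (?x) =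
      of_real (pi * fact n / ((\<gamma> + real n + 1) * poch n) / (nrm (R m n))\<^sup>2)"
    by (rule arg_cong)
  then show ?thesis
    by (simp only: of_real_divide of_real_mult pochhammer_of_real[symmetric] of_real_fact)
qed

text \<open>The hypergeometric series has coefficients proportional to
  \<open>1 / ||R m n||^2\<close>. The conjugate Rodrigues formula in \<open>w\<close> replaces
  \<open>cnj w ^ m\<close> by \<open>cnj (R m n w)\<close>, giving a power series in
  \<open>z\<close> with the kernel coefficients; the formula in \<open>z\<close> then replaces
  \<open>z ^ m\<close> by \<open>R m n z\<close>.\<close>

lemma disc_kernel_eq:
  assumes z: "z \<in> \<D>" and w: "w \<in> \<D>"
  shows "disc_kernel n z w =
    complex_of_real ((\<gamma> + real n + 1) / (pi * fact n * poch n))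
            * complex_of_real (\<delta> z powr (-\<gamma>))
            * complex_of_real (\<delta> w powr (-\<gamma>))
            * (wirtinger ^^ n) (\<lambda>z'. (wirtinger_bar ^^ n) (\<lambda>w'.
                  complex_of_real (\<delta> z' powr (\<gamma> + real n))
                  * complex_of_real (\<delta> w' powr (\<gamma> + real n))
                  * hyp2F1 (complex_of_real (\<gamma> + real n + 2)) (complex_of_real (\<gamma> + 1))
                      (complex_of_real (\<gamma> + real n + 1)) (z' * cnj w')) w) z"
proof -
  let ?k = "(\<gamma> + real n + 1) / (pi * fact n * poch n)"
  define \<kappa> where "\<kappa> = pi * fact n / ((\<gamma> + real n + 1) * poch n)"
  define \<phi> where "\<phi> m = complex_of_real (\<kappa> / (nrm (R m n))\<^sup>2)" for m
  define W where "W z = complex_of_real (\<delta> z powr (\<gamma> + real n))" for z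
  define E where "E z = complex_of_real ((-1) ^ n * poch n * \<delta> z powr \<gamma>)" for z
  have z1: "cmod z < 1" and w1: "cmod w < 1" using z w by auto
  have \<phi>R: "\<phi> m * cnj (R m n w) = of_real \<kappa> * kernel_coeff n w m" for m
    by (simp add: \<phi>_def kernel_coeff_def)
  have hyp: "hyp2F1 (complex_of_real (\<gamma> + real n + 2)) (complex_of_real (\<gamma> + 1))
      (complex_of_real (\<gamma> + real n + 1)) x = (\<Sum>m. \<phi> m * x ^ m)" for x
    unfolding hyp2F1_def \<phi>_def \<kappa>_def hyp2F1_coeff_eq[symmetric] by simp
  have \<phi>_summable: "summable (\<lambda>m. \<phi> m * x ^ m)" if "cmod x < 1" for x
  proof (rule summable_comparison_test'[where N=0])
    show "summable (\<lambda>m. \<bar>\<kappa>\<bar> * (cmod x ^ m / (nrm (R m n))\<^sup>2))"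
      using that by (intro summable_mult summable_power_over_norm_square_disc_poly) auto
  qed (simp add: \<phi>_def norm_mult norm_divide norm_power)
  have kc: "summable (\<lambda>m. of_real \<kappa> * kernel_coeff n w m * x ^ m)" if "cmod x < 1" for x
    using summable_mult[OF kernel_coeff_summable[OF w that], of "of_real \<kappa>"] by (simp add: mult_ac)
  let ?H = "\<lambda>z' w'. W z' * W w' * (\<Sum>m. \<phi> m * (z' * cnj w') ^ m)"
  have inner: "(wirtinger_bar ^^ n) (?H z') w =
      W z' * (\<Sum>m. E w * (of_real \<kappa> * kernel_coeff n w m) * z' ^ m)" if z': "cmod z' < 1" for z'
  proof -
    have lt1: "cmod (z' * cnj x) < 1" "cmod (cnj z' * x) < 1" if "cmod x < 1" for x
      using mult_strict_mono[of "cmod z'" 1 "cmod x" 1] z' that by (simp_all add: norm_mult)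
    \<comment> \<open>For fixed \<open>z'\<close> the function of \<open>w'\<close> is the weight
      times the conjugate of a power series in \<open>w'\<close> with these coefficients.\<close>
    define c where "c m = W z' * (\<phi> m * cnj z' ^ m)" for m
    have c: "summable (\<lambda>m. c m * x ^ m)" if "cmod x < 1" for x
      using summable_mult[OF \<phi>_summable[OF lt1(2)[OF that]], of "W z'"]
      by (simp add: c_def power_mult_distrib mult_ac)
    \<comment> \<open>Left general in \<open>y\<close> for two uses: with the powers
      \<open>x ^ m\<close> before differentiation and with \<open>R m n w\<close> after it.\<close>
    have cnj_c: "cnj (\<Sum>m. c m * y m) = W z' * (\<Sum>m. \<phi> m * cnj (y m) * z' ^ m)"
      if "summable (\<lambda>m. c m * y m)" "summable (\<lambda>m. \<phi> m * cnj (y m) * z' ^ m)" for y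
    proof -
      have "(\<lambda>m. cnj (c m * y m)) sums cnj (\<Sum>m. c m * y m)"
        unfolding sums_cnj by (rule summable_sums[OF that(1)])
      moreover have "cnj (c m * y m) = W z' * (\<phi> m * cnj (y m) * z' ^ m)" for m
        by (simp add: c_def W_def \<phi>_def mult_ac)
      ultimately have "(\<lambda>m. W z' * (\<phi> m * cnj (y m) * z' ^ m)) sums cnj (\<Sum>m. c m * y m)" by (simp only:)
      from sums_unique2[OF this sums_mult[OF summable_sums[OF that(2)]]] show ?thesis .
    qed
    have "(wirtinger_bar ^^ n) (?H z') w =
        (wirtinger_bar ^^ n) (\<lambda>w'. W w' * cnj (\<Sum>m. c m * w' ^ m)) w"
    proof (rule funpow_wirtinger_bar_cong[OF open_ball _ w])
      fix x :: complex assume "x \<in> \<D>"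
      then have x: "cmod x < 1" by simp
      have "cnj (\<Sum>m. c m * x ^ m) = W z' * (\<Sum>m. \<phi> m * cnj (x ^ m) * z' ^ m)"
        using \<phi>_summable[OF lt1(1)[OF x]] by (intro cnj_c c x) (simp add: power_mult_distrib mult_ac)
      then show "W z' * W x * (\<Sum>m. \<phi> m * (z' * cnj x) ^ m) = W x * cnj (\<Sum>m. c m * x ^ m)"
        by (simp add: power_mult_distrib mult_ac)
    qed
    also have "\<dots> = E w * cnj (\<Sum>m. c m * R m n w)"
      unfolding W_def E_def by (rule disc_poly_Rodrigues_cnj[OF c w1])
    also have "cnj (\<Sum>m. c m * R m n w) = W z' * (\<Sum>m. of_real \<kappa> * kernel_coeff n w m * z' ^ m)"
      using cnj_c[of "\<lambda>m. R m n w", unfolded \<phi>R, OF sums_summable[OF disc_poly_series[OF c w1]] kc[OF z']] .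
    finally show ?thesis
      using suminf_mult[OF kc[OF z'], of "E w"] by (simp add: mult_ac)
  qed
  have d: "summable (\<lambda>m. E w * (of_real \<kappa> * kernel_coeff n w m) * x ^ m)" if "cmod x < 1" for x
    using summable_mult[OF kc[OF that], of "E w"] by (simp add: mult_ac)
  have "(wirtinger ^^ n) (\<lambda>z'. (wirtinger_bar ^^ n) (?H z') w) z =
      (wirtinger ^^ n) (\<lambda>z'. W z' * (\<Sum>m. E w * (of_real \<kappa> * kernel_coeff n w m) * z' ^ m)) z"
    by (rule funpow_wirtinger_cong[OF open_ball _ z]) (simp add: inner)
  also have "\<dots> = E z * (\<Sum>m. E w * (of_real \<kappa> * kernel_coeff n w m) * R m n z)"
    unfolding W_def E_def[of z] by (rule disc_poly_Rodrigues[OF d z1])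
  also have "(\<Sum>m. E w * (of_real \<kappa> * kernel_coeff n w m) * R m n z) = E w * of_real \<kappa> * disc_kernel n z w"
    using sums_mult[OF disc_kernel_sums[OF w z], of "E w * of_real \<kappa>" n] by (simp add: sums_iff mult_ac)
  finally have main: "(wirtinger ^^ n) (\<lambda>z'. (wirtinger_bar ^^ n) (?H z') w) z =
      E z * (E w * of_real \<kappa> * disc_kernel n z w)" .
  have cancel: "complex_of_real (\<delta> x powr (-\<gamma>)) * E x = of_real ((-1) ^ n * poch n)" if "cmod x < 1" for x
  proof -
    have "\<delta> x > 0" using that by (simp add: abs_square_less_1)
    then have "\<delta> x powr (-\<gamma>) * \<delta> x powr \<gamma> = 1"
      by (simp flip: powr_add)
    then have "\<delta> x powr (-\<gamma>) * ((-1) ^ n * poch n * \<delta> x powr \<gamma>) = (-1) ^ n * poch n"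
      by (simp add: mult_ac)
    then show ?thesis unfolding E_def of_real_mult[symmetric] by (rule arg_cong)
  qed
  have "complex_of_real ?k
            * complex_of_real (\<delta> z powr (-\<gamma>))
            * complex_of_real (\<delta> w powr (-\<gamma>)) * (E z * (E w * of_real \<kappa> * disc_kernel n z w)) =
    complex_of_real ?k * of_real \<kappa>
      * (complex_of_real (\<delta> z powr (-\<gamma>)) * E z) * (complex_of_real (\<delta> w powr (-\<gamma>)) * E w) * disc_kernel n z w"
    by (simp only: mult_ac)
  also have "\<dots> = of_real (?k * \<kappa>
      * ((-1) ^ n * poch n) * ((-1) ^ n * poch n)) * disc_kernel n z w"
    unfolding cancel[OF z1] cancel[OF w1] by (simp only: of_real_mult mult.assoc)
  \<comment> \<open>The prefactor is the reciprocal of \<open>\<kappa>\<close> times the square of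
    \<open>poch n\<close>, one factor coming from each Rodrigues formula; their signs multiply to
    \<open>1\<close>.\<close>
  also have "?k * \<kappa>
      * ((-1) ^ n * poch n) * ((-1) ^ n * poch n) = 1"
  proof -
    have "\<gamma> + real n + 1 > 0" "poch n > 0" using \<gamma> by (auto intro!: pochhammer_pos)
    moreover have "(-1::real) ^ n * (-1) ^ n = 1" by (simp flip: power_mult_distrib)
    ultimately show ?thesis by (simp add: \<kappa>_def mult_ac)
  qed
  finally show ?thesis unfolding hyp W_def[symmetric] main by simp
qed

end

end

theorem theorem1p2:
  fixes \<gamma> :: real
  assumes "\<gamma> > -1"
  shows "(\<forall>n. orthogonal_basis \<gamma> (true_poly_bergman_space \<gamma> n) (\<lambda>m. disc_poly \<gamma> m n))
    \<and> ((\<forall>n. rkhs \<gamma> (true_poly_bergman_space \<gamma> n))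
      \<and> (\<forall>j k. j \<noteq> k \<longrightarrow>
            L2_orthogonal \<gamma> (true_poly_bergman_space \<gamma> j) (true_poly_bergman_space \<gamma> k))
      \<and> hilbert_direct_sum \<gamma> UNIV (true_poly_bergman_space \<gamma>) (L2_disc \<gamma>)
      \<and> (\<forall>n. hilbert_direct_sum \<gamma> {..n} (true_poly_bergman_space \<gamma>) (poly_bergman_space \<gamma> n)))
    \<and> (\<forall>n K. reproducing_kernel \<gamma> (true_poly_bergman_space \<gamma> n) K \<longleftrightarrow>
        (\<forall>z\<in>unit_disc. \<forall>w\<in>unit_disc.
          K z w =
            complex_of_real ((\<gamma> + real n + 1) / (pi * fact n * pochhammer (\<gamma> + 1) n))
            * complex_of_real ((1 - (cmod z)\<^sup>2) powr (-\<gamma>))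
            * complex_of_real ((1 - (cmod w)\<^sup>2) powr (-\<gamma>))
            * (wirtinger ^^ n) (\<lambda>z'. (wirtinger_bar ^^ n) (\<lambda>w'.
                  complex_of_real ((1 - (cmod z')\<^sup>2) powr (\<gamma> + real n))
                  * complex_of_real ((1 - (cmod w')\<^sup>2) powr (\<gamma> + real n))
                  * hyp2F1 (complex_of_real (\<gamma> + real n + 2)) (complex_of_real (\<gamma> + 1))
                      (complex_of_real (\<gamma> + real n + 1)) (z' * cnj w')) w) z))"
proof (intro conjI allI impI)
qed (fact orthogonal_basis_disc_poly[OF assms] rkhs_true_poly_bergman_space[OF assms]
    hilbert_direct_sum_L2_disc[OF assms] hilbert_direct_sum_poly_bergman_space[OF assms]
  | erule true_poly_bergman_space_orthogonal[OF assms]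
  | (unfold reproducing_kernel_iff[OF assms], intro ball_cong refl, simp only: disc_kernel_eq[OF assms]))+

end
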